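(* Let $u$ be the solution of the parabolic problem $\partial_t u+\mathcal{L}u=f$ in $\Omega\times(0,T]$, $u(\cdot,0)=u^0$, $u=0$ on $\partial\Omega\times[0,T]$, and let the Green's function bounds (with constants $\kappa_0,\kappa_1,\kappa_1',\gamma$) stated in the context hold. Let $0=t_0<t_1<\dots<t_M=T$ be an arbitrary mesh and let $U^j\in H_0^1(\Omega)$ be the Crank-Nicolson approximations: $U^0=u^0$ and $$\frac{U^j-U^{j-1}}{\tau_j}+\frac{\mathcal{L}U^j+\mathcal{L}U^{j-1}}{2}=\frac{f^j+f^{j-1}}{2}\quad\text{in }\Omega,\qquad j=1,\dots,M.$$ Let $$\beta^j:=-4\,\frac{f^j-2f^{j-1/2}+f^{j-1}}{\tau_j^2},\qquad \tilde f(s):=\hat f(s)+\beta^j\,\frac{(t_j-s)(s-t_{j-1})}{2},\quad s\in[t_{j-1},t_j],$$ and let $q^j\in H_0^1(\Omega)$ be the unique solution of $\mathcal{L}q^j=\beta^j$, $j=1,\dots,M$. Then $$\|u(T)-U^M\|_{\infty,\Omega}\le\sum_{j=1}^M\mathrm{e}^{-\gamma(T-t_j)}\left(\eta_{\tilde f}^j+\eta_{\delta\psi q}^j\right)$$ with $$\eta_{\tilde f}^j:=\kappa_0\int_{I_j}\|(f-\tilde f)(s)\|_{\infty,\Omega}\,\mathrm{d}s,\qquad \eta_{\delta\psi q}^j:=\frac{\Psi_{1,j}}{2}\|\delta_t\psi^j-q^j\|_{\infty,\Omega},\qquad \psi^j:=\mathcal{L}U^j-f^j,$$ where $\Psi_{1,j}:=\min\{\Phi_{1,j},\Phi_{1,j}^*\}$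 and $$\Phi_{1,j}:=\kappa_1\int_{t_{j-1}}^{t_j}\frac{(t_j-s)(s-t_{j-1})}{T-s}\,\mathrm{d}s+\kappa_1'\frac{\tau_j^3}{6},\qquad \Phi_{1,j}^*:=\kappa_0\int_{t_{j-1}}^{t_j}\left|\frac{\mathrm{d}}{\mathrm{d}s}\left[(t_j-s)(s-t_{j-1})\right]\right|\mathrm{d}s.$$
   Context: Setting. $\Omega\subset\mathbb{R}^n$ is a spatial domain with Lipschitz boundary, $T>0$, $\mathcal{L}$ is a second-order linear elliptic operator in $\Omega$ with adjoint $\mathcal{L}^*$, $f\colon[0,T]\to L_2(\Omega)$, and $\mathcal{K}w:=\partial_t w+\mathcal{L}w$. The problems $\mathcal{L}q=\beta$ considered are uniquely solvable in $H_0^1(\Omega)$. For functions $w$ on $\Omega\times[0,T]$ write $w(t):=w(\cdot,t)$. $\|\cdot\|_{p,\Omega}$, $p\in[1,\infty]$, is the norm of $L_p(\Omega)$, and $\langle\cdot,\cdot\rangle$ denotes both the duality pairing on $H^{-1}(\Omega)\times H_0^1(\Omega)$ and the $L_2(\Omega)$ scalar product. Green's function. For fixed $x\in\Omega$, $\mathcal{G}$ solves $\partial_t\mathcal{G}+\mathcal{L}^*\mathcal{G}=0$ in $\Omega\times\mathbb{R}^+$, $\mathcal{G}|_{\partial\Omega}=0$, $\mathcal{G}(0)=\delta_x$ (Dirac distribution at $x$). For all $w\in W^{1,1}([0,T],H_0^1(\Omega))$ and $t\in(0,T]$ one has $w(x,t)=\langle\mathcal{G}(t),w(0)\rangle+\int_0^t\langle\mathcal{G}(t-s),(\mathcal{K}w)(s)\rangle\,\mathrm{d}s$;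 the solution $u$ is assumed regular enough that this representation applies to $u$ minus a continuous function that is piecewise polynomial in time and built from the discrete approximations. Standing assumption. There are non-negative constants $\kappa_0,\kappa_1,\kappa_2,\kappa_1',\kappa_2',\gamma$ such that, with $\kappa_0'=0$, $\|\partial_t^p\mathcal{G}(t)\|_{1,\Omega}\le\left(\frac{\kappa_p}{t^p}+\kappa_p'\right)\mathrm{e}^{-\gamma t}$ for all $x\in\bar\Omega$, $t\in[0,T]$, $p=0,1,2$. Mesh notation. $I_j:=(t_{j-1},t_j)$, $\tau_j:=t_j-t_{j-1}$, $t_{j-1/2}:=t_j-\tau_j/2$; $f^j:=f(t_j)$, $f^{j-1/2}:=f(t_{j-1/2})$; $\delta_t v^j:=(v^j-v^{j-1})/\tau_j$. $\hat f$ is the piecewise linear interpolant in time of $f$ on the mesh: $\hat f(s)=f^j-(t_j-s)\,\delta_tf^j$ for $s\in[t_{j-1},t_j]$. *)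

theory Defs
  imports "HOL-Analysis.Analysis" "HOL-Probability.Essential_Supremum" "HOL-Computational_Algebra.Polynomial"
begin

section \<open>Function spaces on a spatial domain\<close>

text \<open>Functions on \<open>\<Omega>\<close> are total functions on \<open>\<real>\<^sup>n\<close> of which only the restriction to \<open>\<Omega>\<close>
  matters; elements of Lebesgue and Sobolev spaces are representatives, and equality in these
  spaces is equality almost everywhere in \<open>\<Omega>\<close>.\<close>

text \<open>Near each boundary point, \<open>\<Omega>\<close> is the part of space above the graph of a Lipschitz function
  \<open>g\<close> over the hyperplane orthogonal to some unit vector \<open>e\<close>.\<close>

definition lipschitz_boundary :: "(real^'n) set \<Rightarrow> bool" where
  "lipschitz_boundary \<Omega> \<longleftrightarrow>
     (\<forall>p\<in>frontier \<Omega>. \<exists>e r C g. norm e = 1 \<and> r > 0 \<and> C-lipschitz_on {y. y \<bullet> e = 0} g \<and>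
        (\<forall>x\<in>ball p r. x \<in> \<Omega> \<longleftrightarrow> x \<bullet> e > (g (x - (x \<bullet> e) *\<^sub>R e) :: real)))"

definition lipschitz_domain :: "(real^'n) set \<Rightarrow> bool" where
  "lipschitz_domain \<Omega> \<longleftrightarrow> open \<Omega> \<and> connected \<Omega> \<and> \<Omega> \<noteq> {} \<and> lipschitz_boundary \<Omega>"

definition gradient :: "(real^'n \<Rightarrow> real) \<Rightarrow> real^'n \<Rightarrow> real^'n" where
  "gradient \<phi> x = (\<chi> i. frechet_derivative \<phi> (at x) (axis i 1))"

primrec C_k :: "nat \<Rightarrow> (real^'n \<Rightarrow> real) \<Rightarrow> bool" where
  "C_k 0 \<phi> \<longleftrightarrow> continuous_on UNIV \<phi>"
| "C_k (Suc k) \<phi> \<longleftrightarrow> \<phi> differentiable_on UNIV \<and> (\<forall>i. C_k k (\<lambda>x. gradient \<phi> x $ i))"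

definition test_functions :: "(real^'n) set \<Rightarrow> (real^'n \<Rightarrow> real) set" where
  "test_functions \<Omega> = {\<phi>. (\<forall>k. C_k k \<phi>) \<and>
     compact (closure {x. \<phi> x \<noteq> 0}) \<and> closure {x. \<phi> x \<noteq> 0} \<subseteq> \<Omega>}"

definition L1_norm :: "(real^'n) set \<Rightarrow> (real^'n \<Rightarrow> real) \<Rightarrow> ennreal" where
  "L1_norm \<Omega> v = (\<integral>\<^sup>+x. ennreal \<bar>v x\<bar> \<partial>lebesgue_on \<Omega>)"

definition Linf_norm :: "(real^'n) set \<Rightarrow> (real^'n \<Rightarrow> real) \<Rightarrow> ennreal" where
  "Linf_norm \<Omega> v = esssup (lebesgue_on \<Omega>) (\<lambda>x. ennreal \<bar>v x\<bar>)"

definition L1_space :: "(real^'n) set \<Rightarrow> (real^'n \<Rightarrow> real) set" where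
  "L1_space \<Omega> = {v. integrable (lebesgue_on \<Omega>) v}"

definition L2_space :: "(real^'n) set \<Rightarrow> (real^'n \<Rightarrow> 'b::euclidean_space) set" where
  "L2_space \<Omega> = {v. v \<in> borel_measurable (lebesgue_on \<Omega>) \<and>
     integrable (lebesgue_on \<Omega>) (\<lambda>x. (norm (v x))\<^sup>2)}"

definition L2_tendsto ::
  "(real^'n) set \<Rightarrow> (nat \<Rightarrow> real^'n \<Rightarrow> 'b::euclidean_space) \<Rightarrow> (real^'n \<Rightarrow> 'b) \<Rightarrow> bool" where
  "L2_tendsto \<Omega> vs v \<longleftrightarrow>
     (\<lambda>k. \<integral>\<^sup>+x. ennreal ((norm (vs k x - v x))\<^sup>2) \<partial>lebesgue_on \<Omega>) \<longlonglongrightarrow> 0"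

text \<open>The integral of a product: the scalar product of \<open>L\<^sub>2(\<Omega>)\<close>, and the pairing of \<open>L\<^sub>1(\<Omega>)\<close> with
  bounded functions.  The partial application \<open>pairing \<Omega> f\<close> is the function \<open>f\<close> read as an element of
  \<open>H\<^sup>-\<^sup>1(\<Omega>)\<close>.\<close>

definition pairing :: "(real^'n) set \<Rightarrow> (real^'n \<Rightarrow> real) \<Rightarrow> (real^'n \<Rightarrow> real) \<Rightarrow> real" where
  "pairing \<Omega> v w = (\<integral>x. v x * w x \<partial>lebesgue_on \<Omega>)"

text \<open>\<open>H\<^sub>0\<^sup>1(\<Omega>)\<close> is the closure of the test functions in the \<open>H\<^sup>1\<close> norm.  The limit of the gradients is
  the weak gradient of the limit function, and is unique up to null sets.\<close>

definition is_H01_gradient :: "(real^'n) set \<Rightarrow> (real^'n \<Rightarrow> real) \<Rightarrow> (real^'n \<Rightarrow> real^'n) \<Rightarrow> bool" where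
  "is_H01_gradient \<Omega> v g \<longleftrightarrow> v \<in> L2_space \<Omega> \<and> g \<in> L2_space \<Omega> \<and>
     (\<exists>\<phi>. (\<forall>k. \<phi> k \<in> test_functions \<Omega>) \<and>
          L2_tendsto \<Omega> \<phi> v \<and> L2_tendsto \<Omega> (\<lambda>k. gradient (\<phi> k)) g)"

definition H01 :: "(real^'n) set \<Rightarrow> (real^'n \<Rightarrow> real) set" where
  "H01 \<Omega> = {v. \<exists>g. is_H01_gradient \<Omega> v g}"

definition weak_gradient :: "(real^'n) set \<Rightarrow> (real^'n \<Rightarrow> real) \<Rightarrow> real^'n \<Rightarrow> real^'n" where
  "weak_gradient \<Omega> v = (SOME g. is_H01_gradient \<Omega> v g)"

definition H1_inner :: "(real^'n) set \<Rightarrow> (real^'n \<Rightarrow> real) \<Rightarrow> (real^'n \<Rightarrow> real) \<Rightarrow> real" where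
  "H1_inner \<Omega> v w =
     (\<integral>x. v x * w x + weak_gradient \<Omega> v x \<bullet> weak_gradient \<Omega> w x \<partial>lebesgue_on \<Omega>)"

definition H1_norm :: "(real^'n) set \<Rightarrow> (real^'n \<Rightarrow> real) \<Rightarrow> real" where
  "H1_norm \<Omega> v = sqrt (H1_inner \<Omega> v v)"

text \<open>\<open>H\<^sup>-\<^sup>1(\<Omega>)\<close> is the dual of \<open>H\<^sub>0\<^sup>1(\<Omega>)\<close>; the duality pairing is function application.\<close>

definition Hm1 :: "(real^'n) set \<Rightarrow> ((real^'n \<Rightarrow> real) \<Rightarrow> real) set" where
  "Hm1 \<Omega> = {F.
     (\<forall>\<phi>\<in>H01 \<Omega>. \<forall>\<rho>\<in>H01 \<Omega>. \<forall>a b. F (\<lambda>x. a * \<phi> x + b * \<rho> x) = a * F \<phi> + b * F \<rho>) \<and>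
     (\<exists>C. \<forall>\<phi>\<in>H01 \<Omega>. \<bar>F \<phi>\<bar> \<le> C * H1_norm \<Omega> \<phi>)}"

text \<open>The \<open>L\<^sub>\<infinity>(\<Omega>)\<close> norm of an element of \<open>H\<^sup>-\<^sup>1(\<Omega>)\<close>: the norm of the function that represents it, and
  \<open>\<infinity>\<close> (the infimum of the empty set) if no bounded function does.  The restriction to \<open>\<phi> \<in> L\<^sub>1(\<Omega>)\<close>
  matters only for unbounded \<open>\<Omega>\<close>.\<close>

definition Hm1_Linf_norm :: "(real^'n) set \<Rightarrow> ((real^'n \<Rightarrow> real) \<Rightarrow> real) \<Rightarrow> ennreal" where
  "Hm1_Linf_norm \<Omega> F = Inf {Linf_norm \<Omega> g | g.
     g \<in> borel_measurable (lebesgue_on \<Omega>) \<and> Linf_norm \<Omega> g < \<infinity> \<and>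
     (\<forall>\<phi>\<in>H01 \<Omega> \<inter> L1_space \<Omega>. F \<phi> = pairing \<Omega> g \<phi>)}"


section \<open>Elliptic and parabolic operators\<close>

text \<open>A second-order operator in divergence form,
  \<open>\<L>v = - div (A \<nabla>v + v d) + b \<cdot> \<nabla>v + c v\<close>; this class is closed under taking adjoints.\<close>

record 'n elliptic_operator =
  coeff_A :: "real^'n \<Rightarrow> real^'n^'n"
  coeff_d :: "real^'n \<Rightarrow> real^'n"
  coeff_b :: "real^'n \<Rightarrow> real^'n"
  coeff_c :: "real^'n \<Rightarrow> real"

definition Linf_space :: "(real^'n) set \<Rightarrow> (real^'n \<Rightarrow> 'b::euclidean_space) set" where
  "Linf_space \<Omega> = {h. h \<in> borel_measurable (lebesgue_on \<Omega>) \<and>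
     (\<exists>C. AE x in lebesgue_on \<Omega>. norm (h x) \<le> C)}"

definition elliptic :: "(real^'n) set \<Rightarrow> 'n elliptic_operator \<Rightarrow> bool" where
  "elliptic \<Omega> L \<longleftrightarrow>
     coeff_A L \<in> Linf_space \<Omega> \<and> coeff_d L \<in> Linf_space \<Omega> \<and>
     coeff_b L \<in> Linf_space \<Omega> \<and> coeff_c L \<in> Linf_space \<Omega> \<and>
     (\<exists>\<theta>>0. AE x in lebesgue_on \<Omega>. \<forall>\<xi>. \<theta> * (norm \<xi>)\<^sup>2 \<le> \<xi> \<bullet> (coeff_A L x *v \<xi>))"

text \<open>\<open>op_app \<Omega> L v\<close> is \<open>\<L>v \<in> H\<^sup>-\<^sup>1(\<Omega>)\<close> for \<open>v \<in> H\<^sub>0\<^sup>1(\<Omega>)\<close>, and \<open>adj_app \<Omega> L v\<close> is \<open>\<L>\<^sup>*v\<close>.\<close>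

definition op_app ::
  "(real^'n) set \<Rightarrow> 'n elliptic_operator \<Rightarrow> (real^'n \<Rightarrow> real) \<Rightarrow> (real^'n \<Rightarrow> real) \<Rightarrow> real" where
  "op_app \<Omega> L v \<phi> = (\<integral>x.
     (coeff_A L x *v weak_gradient \<Omega> v x + v x *\<^sub>R coeff_d L x) \<bullet> weak_gradient \<Omega> \<phi> x +
     (coeff_b L x \<bullet> weak_gradient \<Omega> v x + coeff_c L x * v x) * \<phi> x \<partial>lebesgue_on \<Omega>)"

definition adj_app ::
  "(real^'n) set \<Rightarrow> 'n elliptic_operator \<Rightarrow> (real^'n \<Rightarrow> real) \<Rightarrow> (real^'n \<Rightarrow> real) \<Rightarrow> real" where
  "adj_app \<Omega> L v \<phi> = op_app \<Omega> L \<phi> v"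

definition elliptic_solution ::
  "(real^'n) set \<Rightarrow> 'n elliptic_operator \<Rightarrow> (real^'n \<Rightarrow> real) \<Rightarrow> (real^'n \<Rightarrow> real) \<Rightarrow> bool" where
  "elliptic_solution \<Omega> L \<beta> q \<longleftrightarrow>
     q \<in> H01 \<Omega> \<and> (\<forall>\<phi>\<in>H01 \<Omega>. op_app \<Omega> L q \<phi> = pairing \<Omega> \<beta> \<phi>)"

definition uniquely_solvable :: "(real^'n) set \<Rightarrow> 'n elliptic_operator \<Rightarrow> (real^'n \<Rightarrow> real) \<Rightarrow> bool" where
  "uniquely_solvable \<Omega> L \<beta> \<longleftrightarrow>
     (\<exists>q. elliptic_solution \<Omega> L \<beta> q \<and>
        (\<forall>q'. elliptic_solution \<Omega> L \<beta> q' \<longrightarrow> (AE x in lebesgue_on \<Omega>. q' x = q x)))"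

text \<open>\<open>\<K>w = \<partial>\<^sub>tw + \<L>w = F\<close> on \<open>[0,T]\<close> with \<open>w(t) \<in> H\<^sub>0\<^sup>1(\<Omega>)\<close> and \<open>F(t) \<in> H\<^sup>-\<^sup>1(\<Omega>)\<close>, where \<open>\<partial>\<^sub>tw = F - \<L>w\<close> is
  a weak derivative: \<open>\<langle>w(t),\<phi>\<rangle>\<close> is the indefinite integral of \<open>\<langle>F - \<L>w,\<phi>\<rangle>\<close>.  This determines \<open>F(s)\<close> for
  almost all \<open>s\<close>.\<close>

definition parabolic_image :: "(real^'n) set \<Rightarrow> 'n elliptic_operator \<Rightarrow> real \<Rightarrow>
    (real \<Rightarrow> real^'n \<Rightarrow> real) \<Rightarrow> (real \<Rightarrow> (real^'n \<Rightarrow> real) \<Rightarrow> real) \<Rightarrow> bool" where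
  "parabolic_image \<Omega> L T w F \<longleftrightarrow>
     (\<forall>t\<in>{0..T}. w t \<in> H01 \<Omega> \<and> F t \<in> Hm1 \<Omega>) \<and>
     (\<forall>\<phi>\<in>H01 \<Omega>. \<forall>t\<in>{0..T}.
        (\<lambda>s. F s \<phi> - op_app \<Omega> L (w s) \<phi>) absolutely_integrable_on {0..t} \<and>
        pairing \<Omega> (w t) \<phi> - pairing \<Omega> (w 0) \<phi> =
          integral {0..t} (\<lambda>s. F s \<phi> - op_app \<Omega> L (w s) \<phi>))"

definition parabolic_solution :: "(real^'n) set \<Rightarrow> 'n elliptic_operator \<Rightarrow> real \<Rightarrow>
    (real \<Rightarrow> real^'n \<Rightarrow> real) \<Rightarrow> (real^'n \<Rightarrow> real) \<Rightarrow> (real \<Rightarrow> real^'n \<Rightarrow> real) \<Rightarrow> bool" where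
  "parabolic_solution \<Omega> L T f u0 u \<longleftrightarrow>
     parabolic_image \<Omega> L T u (\<lambda>s. pairing \<Omega> (f s)) \<and> (AE x in lebesgue_on \<Omega>. u 0 x = u0 x)"

text \<open>\<open>W\<^sup>1\<^sup>,\<^sup>1([0,T], H\<^sub>0\<^sup>1(\<Omega>))\<close>: indefinite Bochner integrals of integrable functions \<open>w'\<close>.  As \<open>H\<^sub>0\<^sup>1(\<Omega>)\<close> is
  a separable Hilbert space, strong measurability of \<open>w'\<close> is measurability of its scalar products
  with fixed elements (Pettis), and the Bochner integral is determined by these.\<close>

definition W11_H01 :: "(real^'n) set \<Rightarrow> real \<Rightarrow> (real \<Rightarrow> real^'n \<Rightarrow> real) set" where
  "W11_H01 \<Omega> T = {w. \<exists>w'.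
     (\<forall>t\<in>{0..T}. w t \<in> H01 \<Omega> \<and> w' t \<in> H01 \<Omega>) \<and>
     (\<lambda>s. H1_norm \<Omega> (w' s)) absolutely_integrable_on {0..T} \<and>
     (\<forall>\<phi>\<in>H01 \<Omega>. \<forall>t\<in>{0..T}.
        (\<lambda>s. H1_inner \<Omega> (w' s) \<phi>) absolutely_integrable_on {0..t} \<and>
        H1_inner \<Omega> (w t) \<phi> = H1_inner \<Omega> (w 0) \<phi> + integral {0..t} (\<lambda>s. H1_inner \<Omega> (w' s) \<phi>))}"


section \<open>The Green's function\<close>

text \<open>\<open>dG p x t\<close> stands for \<open>\<partial>\<^sub>t\<^sup>p\<G>(x; \<cdot>, t)\<close>, in particular \<open>dG 0\<close> for \<open>\<G>\<close> itself.  Derivatives in time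
  are those of functions with values in \<open>L\<^sub>1(\<Omega>)\<close>.\<close>

definition has_L1_derivative ::
  "(real^'n) set \<Rightarrow> (real \<Rightarrow> real^'n \<Rightarrow> real) \<Rightarrow> (real^'n \<Rightarrow> real) \<Rightarrow> real \<Rightarrow> bool" where
  "has_L1_derivative \<Omega> v v' t \<longleftrightarrow>
     ((\<lambda>h. L1_norm \<Omega> (\<lambda>y. (v (t + h) y - v t y) / h - v' y)) \<longlongrightarrow> 0) (at 0)"

definition time_derivatives ::
  "(real^'n) set \<Rightarrow> (nat \<Rightarrow> real^'n \<Rightarrow> real \<Rightarrow> real^'n \<Rightarrow> real) \<Rightarrow> bool" where
  "time_derivatives \<Omega> dG \<longleftrightarrow> (\<forall>x\<in>\<Omega>. \<forall>t>0.
     (\<forall>p\<le>2. dG p x t \<in> L1_space \<Omega>) \<and>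
     (\<forall>p<2. has_L1_derivative \<Omega> (dG p x) (dG (Suc p) x t) t))"

text \<open>The homogeneous boundary condition is membership in \<open>H\<^sub>0\<^sup>1(\<Omega>)\<close>; the initial condition
  \<open>\<G>(0) = \<delta>\<^sub>x\<close> is attained in the sense of distributions.\<close>

definition green_function ::
  "(real^'n) set \<Rightarrow> 'n elliptic_operator \<Rightarrow> (nat \<Rightarrow> real^'n \<Rightarrow> real \<Rightarrow> real^'n \<Rightarrow> real) \<Rightarrow> bool" where
  "green_function \<Omega> L dG \<longleftrightarrow> time_derivatives \<Omega> dG \<and> (\<forall>x\<in>\<Omega>.
     (\<forall>t>0. dG 0 x t \<in> H01 \<Omega> \<and>
        (\<forall>\<phi>\<in>test_functions \<Omega>. pairing \<Omega> (dG 1 x t) \<phi> + adj_app \<Omega> L (dG 0 x t) \<phi> = 0)) \<and>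
     (\<forall>\<phi>\<in>test_functions \<Omega>. ((\<lambda>t. pairing \<Omega> (dG 0 x t) \<phi>) \<longlongrightarrow> \<phi> x) (at_right 0)))"

text \<open>The representation holds for almost all \<open>x\<close> only, since \<open>w(t)\<close> is an equivalence class.\<close>

definition green_representation :: "(real^'n) set \<Rightarrow> 'n elliptic_operator \<Rightarrow>
    (real^'n \<Rightarrow> real \<Rightarrow> real^'n \<Rightarrow> real) \<Rightarrow> real \<Rightarrow> (real \<Rightarrow> real^'n \<Rightarrow> real) \<Rightarrow> bool" where
  "green_representation \<Omega> L G T w \<longleftrightarrow>
     (\<forall>F. parabolic_image \<Omega> L T w F \<longrightarrow> (\<forall>t\<in>{0<..T}. AE x in lebesgue_on \<Omega>.
        (\<lambda>s. F s (G x (t - s))) absolutely_integrable_on {0..t} \<and>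
        w t x = pairing \<Omega> (G x t) (w 0) + integral {0..t} (\<lambda>s. F s (G x (t - s)))))"

definition green_bounds :: "(real^'n) set \<Rightarrow> (nat \<Rightarrow> real^'n \<Rightarrow> real \<Rightarrow> real^'n \<Rightarrow> real) \<Rightarrow> real \<Rightarrow>
    (nat \<Rightarrow> real) \<Rightarrow> (nat \<Rightarrow> real) \<Rightarrow> real \<Rightarrow> bool" where
  "green_bounds \<Omega> dG T \<kappa> \<kappa>' \<gamma> \<longleftrightarrow>
     (\<forall>p\<le>2. 0 \<le> \<kappa> p \<and> 0 \<le> \<kappa>' p) \<and> \<kappa>' 0 = 0 \<and> 0 \<le> \<gamma> \<and>
     (\<forall>x\<in>\<Omega>. \<forall>t\<in>{0<..T}. \<forall>p\<le>2.
        L1_norm \<Omega> (dG p x t) \<le> ennreal ((\<kappa> p / t ^ p + \<kappa>' p) * exp (- \<gamma> * t)))"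


section \<open>The Crank-Nicolson discretization\<close>

definition mesh :: "(nat \<Rightarrow> real) \<Rightarrow> nat \<Rightarrow> real \<Rightarrow> bool" where
  "mesh t M T \<longleftrightarrow> t 0 = 0 \<and> (\<forall>j<M. t j < t (Suc j)) \<and> t M = T"

definition tau :: "(nat \<Rightarrow> real) \<Rightarrow> nat \<Rightarrow> real" where
  "tau t j = t j - t (j - 1)"

definition crank_nicolson :: "(real^'n) set \<Rightarrow> 'n elliptic_operator \<Rightarrow> (nat \<Rightarrow> real) \<Rightarrow> nat \<Rightarrow>
    (real \<Rightarrow> real^'n \<Rightarrow> real) \<Rightarrow> (real^'n \<Rightarrow> real) \<Rightarrow> (nat \<Rightarrow> real^'n \<Rightarrow> real) \<Rightarrow> bool" where
  "crank_nicolson \<Omega> L t M f u0 U \<longleftrightarrow>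
     (\<forall>j\<le>M. U j \<in> H01 \<Omega>) \<and> (AE x in lebesgue_on \<Omega>. U 0 x = u0 x) \<and>
     (\<forall>j\<in>{1..M}. \<forall>\<phi>\<in>H01 \<Omega>.
        pairing \<Omega> (\<lambda>x. (U j x - U (j - 1) x) / tau t j) \<phi> +
          (op_app \<Omega> L (U j) \<phi> + op_app \<Omega> L (U (j - 1)) \<phi>) / 2 =
        pairing \<Omega> (\<lambda>x. (f (t j) x + f (t (j - 1)) x) / 2) \<phi>)"

definition beta :: "(nat \<Rightarrow> real) \<Rightarrow> (real \<Rightarrow> real^'n \<Rightarrow> real) \<Rightarrow> nat \<Rightarrow> real^'n \<Rightarrow> real" where
  "beta t f j x =
     - 4 * ((f (t j) x - 2 * f (t j - tau t j / 2) x + f (t (j - 1)) x) / (tau t j)\<^sup>2)"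

text \<open>The index \<open>j\<close> of \<open>f_hat\<close> and \<open>f_tilde\<close> selects the formula valid for \<open>s \<in> [t\<^sub>j\<^sub>-\<^sub>1, t\<^sub>j]\<close>.\<close>

definition f_hat :: "(nat \<Rightarrow> real) \<Rightarrow> (real \<Rightarrow> real^'n \<Rightarrow> real) \<Rightarrow> nat \<Rightarrow> real \<Rightarrow> real^'n \<Rightarrow> real" where
  "f_hat t f j s x = f (t j) x - (t j - s) * ((f (t j) x - f (t (j - 1)) x) / tau t j)"

definition f_tilde :: "(nat \<Rightarrow> real) \<Rightarrow> (real \<Rightarrow> real^'n \<Rightarrow> real) \<Rightarrow> nat \<Rightarrow> real \<Rightarrow> real^'n \<Rightarrow> real" where
  "f_tilde t f j s x = f_hat t f j s x + beta t f j x * ((t j - s) * (s - t (j - 1)) / 2)"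

definition psi :: "(real^'n) set \<Rightarrow> 'n elliptic_operator \<Rightarrow> (nat \<Rightarrow> real) \<Rightarrow>
    (real \<Rightarrow> real^'n \<Rightarrow> real) \<Rightarrow> (nat \<Rightarrow> real^'n \<Rightarrow> real) \<Rightarrow> nat \<Rightarrow> (real^'n \<Rightarrow> real) \<Rightarrow> real" where
  "psi \<Omega> L t f U j \<phi> = op_app \<Omega> L (U j) \<phi> - pairing \<Omega> (f (t j)) \<phi>"

text \<open>Functions of time that are continuous, polynomial on each mesh interval, and whose values are
  linear combinations of the \<open>U\<^sup>j\<close> and \<open>q\<^sup>j\<close>.  Continuity is ensured as the formulae for adjacent
  closed intervals agree at the common mesh point.\<close>

definition discrete_piecewise_poly :: "(nat \<Rightarrow> real) \<Rightarrow> nat \<Rightarrow> (nat \<Rightarrow> real^'n \<Rightarrow> real) \<Rightarrow>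
    (nat \<Rightarrow> real^'n \<Rightarrow> real) \<Rightarrow> (real \<Rightarrow> real^'n \<Rightarrow> real) set" where
  "discrete_piecewise_poly t M U q = {v. \<exists>(a :: nat \<Rightarrow> nat \<Rightarrow> real poly) (b :: nat \<Rightarrow> nat \<Rightarrow> real poly).
     \<forall>j\<in>{1..M}. \<forall>s\<in>{t (j - 1)..t j}. \<forall>x.
       v s x = (\<Sum>i\<le>M. poly (a j i) s * U i x) + (\<Sum>i=1..M. poly (b j i) s * q i x)}"


section \<open>The error estimator\<close>

definition Phi1 :: "(nat \<Rightarrow> real) \<Rightarrow> real \<Rightarrow> real \<Rightarrow> real \<Rightarrow> nat \<Rightarrow> real" where
  "Phi1 t T \<kappa>1 \<kappa>1' j =
     \<kappa>1 * integral {t (j - 1)..t j} (\<lambda>s. (t j - s) * (s - t (j - 1)) / (T - s)) +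
     \<kappa>1' * (tau t j ^ 3 / 6)"

definition Phi1_star :: "(nat \<Rightarrow> real) \<Rightarrow> real \<Rightarrow> nat \<Rightarrow> real" where
  "Phi1_star t \<kappa>0 j =
     \<kappa>0 * integral {t (j - 1)..t j} (\<lambda>s. \<bar>deriv (\<lambda>r. (t j - r) * (r - t (j - 1))) s\<bar>)"

definition Psi1 :: "(nat \<Rightarrow> real) \<Rightarrow> real \<Rightarrow> real \<Rightarrow> real \<Rightarrow> real \<Rightarrow> nat \<Rightarrow> real" where
  "Psi1 t T \<kappa>0 \<kappa>1 \<kappa>1' j = min (Phi1 t T \<kappa>1 \<kappa>1' j) (Phi1_star t \<kappa>0 j)"

definition eta_f :: "(real^'n) set \<Rightarrow> (nat \<Rightarrow> real) \<Rightarrow> (real \<Rightarrow> real^'n \<Rightarrow> real) \<Rightarrow> real \<Rightarrow> nat \<Rightarrow> ennreal"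
  where "eta_f \<Omega> t f \<kappa>0 j = ennreal \<kappa>0 *
     (\<integral>\<^sup>+s. Linf_norm \<Omega> (\<lambda>x. f s x - f_tilde t f j s x) \<partial>lebesgue_on {t (j - 1)<..<t j})"

definition eta_psi :: "(real^'n) set \<Rightarrow> 'n elliptic_operator \<Rightarrow> (nat \<Rightarrow> real) \<Rightarrow> real \<Rightarrow>
    (real \<Rightarrow> real^'n \<Rightarrow> real) \<Rightarrow> (nat \<Rightarrow> real^'n \<Rightarrow> real) \<Rightarrow> (nat \<Rightarrow> real^'n \<Rightarrow> real) \<Rightarrow>
    real \<Rightarrow> real \<Rightarrow> real \<Rightarrow> nat \<Rightarrow> ennreal" where
  "eta_psi \<Omega> L t T f U q \<kappa>0 \<kappa>1 \<kappa>1' j = ennreal (Psi1 t T \<kappa>0 \<kappa>1 \<kappa>1' j / 2) *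
     Hm1_Linf_norm \<Omega>
       (\<lambda>\<phi>. (psi \<Omega> L t f U j \<phi> - psi \<Omega> L t f U (j - 1) \<phi>) / tau t j - pairing \<Omega> (q j) \<phi>)"

end

theory Submission
  imports Defs
begin

text \<open>Let \<open>v\<close> be the linear interpolant in time of the \<open>U\<^sup>j\<close>, corrected on \<open>[t\<^sub>j\<^sub>-\<^sub>1, t\<^sub>j]\<close> by \<open>q\<^sup>j\<close> times the
  bubble \<open>(t\<^sub>j - s) (s - t\<^sub>j\<^sub>-\<^sub>1) / 2\<close>.  It agrees with \<open>U\<^sup>0\<close> at the initial and with \<open>U\<^sup>M\<close> at the final time, and
  the scheme together with \<open>\<L>q\<^sup>j = \<beta>\<^sup>j\<close> gives, inside each mesh interval,
  \<open>(\<partial>\<^sub>t + \<L>) (u - v) = (f - f_tilde) + (t\<^sub>j\<^sub>-\<^sub>1\<^sub>/\<^sub>2 - s) (\<delta>\<^sub>t\<psi>\<^sup>j - q\<^sup>j)\<close>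
  (lemma \<open>error_source_on_interval\<close>).  The Green's function represents \<open>(u - v)(T) = u(T) - U\<^sup>M\<close> by the
  integral over \<open>[0,T]\<close> of this source against \<open>\<G>(T - s)\<close>, which is estimated interval by interval.

  The first part of the source is bounded with the \<open>L\<^sub>1\<close> norm of \<open>\<G>\<close>.  In the second part, the factor
  \<open>t\<^sub>j\<^sub>-\<^sub>1\<^sub>/\<^sub>2 - s\<close> is the derivative of the bubble.  Either its absolute value is integrated, again with the
  bound on \<open>\<G>\<close>; or the derivative is moved from the bubble to \<open>\<G>\<close> without boundary terms, and the bound
  on \<open>\<partial>\<^sub>t\<G>\<close> is used (lemma \<open>bubble_integration_by_parts\<close>).  The better of the two gives the constant of the
  estimator (lemmas \<open>residual_integral_le\<close> and \<open>interval_estimate\<close>).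

  Two points need more than this computation.  The representation formula speaks about \<open>u - v\<close>, so
  its source has to be computed by linearity from those of \<open>u\<close> and \<open>v\<close>.  The operator acts through
  weak gradients, and these are linear only because the gradient is closable
  (lemma \<open>H01_gradient_of_null_function\<close>).  And where the norm of \<open>\<delta>\<^sub>t\<psi>\<^sup>j - q\<^sup>j\<close> is infinite while the
  constant in front of it is zero, the estimator does not see the residual.  In that case \<open>\<G>\<close> is
  constant in time (lemma \<open>green_constant_in_time\<close>), and the residual contributes nothing because the
  derivative of the bubble has integral zero.\<close>


section \<open>Square-integrable functions\<close>

lemma Cauchy_Schwarz_integral:
  fixes u v :: "'a \<Rightarrow> 'b::euclidean_space"
  assumes [measurable]: "u \<in> borel_measurable M" "v \<in> borel_measurable M"
    and u: "integrable M (\<lambda>x. (norm (u x))\<^sup>2)" and v: "integrable M (\<lambda>x. (norm (v x))\<^sup>2)"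
  shows "integrable M (\<lambda>x. u x \<bullet> v x)"
    and "\<bar>\<integral>x. u x \<bullet> v x \<partial>M\<bar> \<le> sqrt (\<integral>x. (norm (u x))\<^sup>2 \<partial>M) * sqrt (\<integral>x. (norm (v x))\<^sup>2 \<partial>M)"
proof -
  have le: "norm (u x) * norm (v x) \<le> (norm (u x))\<^sup>2 + (norm (v x))\<^sup>2" for x
    using sum_squares_bound[of "norm (u x)" "norm (v x)"] mult_nonneg_nonneg[OF norm_ge_zero norm_ge_zero, of "u x" "v x"]
    by linarith
  have nn: "integrable M (\<lambda>x. norm (u x) * norm (v x))"
    by (rule Bochner_Integration.integrable_bound[OF Bochner_Integration.integrable_add[OF u v]])
       (auto intro!: AE_I2 simp: le)
  show int: "integrable M (\<lambda>x. u x \<bullet> v x)"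
    by (rule Bochner_Integration.integrable_bound[OF nn]) (auto intro!: AE_I2 simp: Cauchy_Schwarz_ineq2)
  have "ennreal ((\<integral>x. norm (u x) * norm (v x) \<partial>M)\<^sup>2)
      = (\<integral>\<^sup>+x. ennreal (norm (u x)) * ennreal (norm (v x)) \<partial>M)\<^sup>2"
    by (simp add: nn_integral_eq_integral[OF nn] ennreal_power flip: ennreal_mult)
  also have "\<dots> \<le> (\<integral>\<^sup>+x. (ennreal (norm (u x)))\<^sup>2 \<partial>M) * (\<integral>\<^sup>+x. (ennreal (norm (v x)))\<^sup>2 \<partial>M)"
    by (rule Cauchy_Schwarz_nn_integral) auto
  also have "\<dots> = ennreal ((\<integral>x. (norm (u x))\<^sup>2 \<partial>M) * (\<integral>x. (norm (v x))\<^sup>2 \<partial>M))"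
    by (simp add: ennreal_power nn_integral_eq_integral u v ennreal_mult)
  finally have "(\<integral>x. norm (u x) * norm (v x) \<partial>M)\<^sup>2
      \<le> (\<integral>x. (norm (u x))\<^sup>2 \<partial>M) * (\<integral>x. (norm (v x))\<^sup>2 \<partial>M)"
    by (subst (asm) ennreal_le_iff) auto
  then have "(\<integral>x. norm (u x) * norm (v x) \<partial>M)
      \<le> sqrt (\<integral>x. (norm (u x))\<^sup>2 \<partial>M) * sqrt (\<integral>x. (norm (v x))\<^sup>2 \<partial>M)"
    by (simp add: real_le_rsqrt flip: real_sqrt_mult)
  moreover have "\<bar>\<integral>x. u x \<bullet> v x \<partial>M\<bar> \<le> (\<integral>x. norm (u x) * norm (v x) \<partial>M)"
    by (rule order_trans[OF integral_abs_bound])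
       (intro integral_mono nn integrable_abs int Cauchy_Schwarz_ineq2)
  ultimately show "\<bar>\<integral>x. u x \<bullet> v x \<partial>M\<bar> \<le> sqrt (\<integral>x. (norm (u x))\<^sup>2 \<partial>M) * sqrt (\<integral>x. (norm (v x))\<^sup>2 \<partial>M)"
    by linarith
qed

definition L2_norm :: "(real^'n) set \<Rightarrow> (real^'n \<Rightarrow> 'b::euclidean_space) \<Rightarrow> real" where
  "L2_norm \<Omega> v = sqrt (\<integral>x. (norm (v x))\<^sup>2 \<partial>lebesgue_on \<Omega>)"

lemma L2_norm_nonneg [simp]: "0 \<le> L2_norm \<Omega> v"
  by (simp add: L2_norm_def)

lemma L2_inner:
  assumes "u \<in> L2_space \<Omega>" "v \<in> L2_space \<Omega>"
  shows "integrable (lebesgue_on \<Omega>) (\<lambda>x. u x \<bullet> v x)"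
    and "\<bar>\<integral>x. u x \<bullet> v x \<partial>lebesgue_on \<Omega>\<bar> \<le> L2_norm \<Omega> u * L2_norm \<Omega> v"
  using assms Cauchy_Schwarz_integral[of u "lebesgue_on \<Omega>" v]
  by (auto simp: L2_space_def L2_norm_def)

lemma L2_mult:
  fixes u v :: "real^'n \<Rightarrow> real"
  assumes "u \<in> L2_space \<Omega>" "v \<in> L2_space \<Omega>"
  shows "integrable (lebesgue_on \<Omega>) (\<lambda>x. u x * v x)"
    and "\<bar>pairing \<Omega> u v\<bar> \<le> L2_norm \<Omega> u * L2_norm \<Omega> v"
  using L2_inner[OF assms] by (simp_all add: pairing_def)

lemma norm_lincomb_square_le:
  fixes v w :: "'b::real_normed_vector"
  shows "(norm (a *\<^sub>R v + b *\<^sub>R w))\<^sup>2 \<le> 2 * a\<^sup>2 * (norm v)\<^sup>2 + 2 * b\<^sup>2 * (norm w)\<^sup>2"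
proof -
  have "(norm (a *\<^sub>R v + b *\<^sub>R w))\<^sup>2 \<le> (\<bar>a\<bar> * norm v + \<bar>b\<bar> * norm w)\<^sup>2"
    by (rule power_mono) (metis norm_scaleR norm_triangle_ineq, simp)
  also have "\<dots> \<le> 2 * (\<bar>a\<bar> * norm v)\<^sup>2 + 2 * (\<bar>b\<bar> * norm w)\<^sup>2"
    using sum_squares_bound[of "\<bar>a\<bar> * norm v" "\<bar>b\<bar> * norm w"] by (simp add: power2_sum)
  finally show ?thesis by (simp add: power_mult_distrib)
qed

lemma L2_space_lincomb:
  assumes "v \<in> L2_space \<Omega>" "w \<in> L2_space \<Omega>"
  shows "(\<lambda>x. a *\<^sub>R v x + b *\<^sub>R w x) \<in> L2_space \<Omega>"
proof -
  have [measurable]: "v \<in> borel_measurable (lebesgue_on \<Omega>)" "w \<in> borel_measurable (lebesgue_on \<Omega>)"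
    and int: "integrable (lebesgue_on \<Omega>) (\<lambda>x. 2 * a\<^sup>2 * (norm (v x))\<^sup>2 + 2 * b\<^sup>2 * (norm (w x))\<^sup>2)"
    using assms by (auto simp: L2_space_def)
  have "integrable (lebesgue_on \<Omega>) (\<lambda>x. (norm (a *\<^sub>R v x + b *\<^sub>R w x))\<^sup>2)"
    by (rule Bochner_Integration.integrable_bound[OF int])
       (auto intro!: AE_I2 norm_lincomb_square_le)
  then show ?thesis by (simp add: L2_space_def)
qed

lemma L2_space_lincomb_real:
  fixes v w :: "real^'n \<Rightarrow> real"
  shows "v \<in> L2_space \<Omega> \<Longrightarrow> w \<in> L2_space \<Omega> \<Longrightarrow> (\<lambda>x. a * v x + b * w x) \<in> L2_space \<Omega>"
  using L2_space_lincomb[of v \<Omega> w a b] by simp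

lemma L2_space_diff: "v \<in> L2_space \<Omega> \<Longrightarrow> w \<in> L2_space \<Omega> \<Longrightarrow> (\<lambda>x. v x - w x) \<in> L2_space \<Omega>"
  using L2_space_lincomb[of v \<Omega> w 1 "-1"] by simp

lemma L2_norm_lincomb_square_le:
  assumes "v \<in> L2_space \<Omega>" "w \<in> L2_space \<Omega>"
  shows "(L2_norm \<Omega> (\<lambda>x. a *\<^sub>R v x + b *\<^sub>R w x))\<^sup>2
    \<le> 2 * a\<^sup>2 * (L2_norm \<Omega> v)\<^sup>2 + 2 * b\<^sup>2 * (L2_norm \<Omega> w)\<^sup>2"
proof -
  have int: "integrable (lebesgue_on \<Omega>) (\<lambda>x. (norm (v x))\<^sup>2)" "integrable (lebesgue_on \<Omega>) (\<lambda>x. (norm (w x))\<^sup>2)"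
    using assms by (auto simp: L2_space_def)
  have "(\<integral>x. (norm (a *\<^sub>R v x + b *\<^sub>R w x))\<^sup>2 \<partial>lebesgue_on \<Omega>)
    \<le> (\<integral>x. 2 * a\<^sup>2 * (norm (v x))\<^sup>2 + 2 * b\<^sup>2 * (norm (w x))\<^sup>2 \<partial>lebesgue_on \<Omega>)"
    using L2_space_lincomb[OF assms] int
    by (intro integral_mono norm_lincomb_square_le) (auto simp: L2_space_def)
  then show ?thesis using int by (simp add: L2_norm_def)
qed

text \<open>Convergence is defined with extended non-negative integrals, so that it makes sense before
  membership in \<open>L\<^sub>2(\<Omega>)\<close> is known; for elements of \<open>L\<^sub>2(\<Omega>)\<close> it can be computed with real norms.\<close>

lemma L2_tendsto_iff:
  assumes "\<And>k. vs k \<in> L2_space \<Omega>" "v \<in> L2_space \<Omega>"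
  shows "L2_tendsto \<Omega> vs v \<longleftrightarrow> (\<lambda>k. L2_norm \<Omega> (\<lambda>x. vs k x - v x)) \<longlonglongrightarrow> 0"
proof -
  have "integrable (lebesgue_on \<Omega>) (\<lambda>x. (norm (vs k x - v x))\<^sup>2)" for k
    using L2_space_diff[OF assms(1) assms(2)] by (simp add: L2_space_def)
  then have *: "(\<integral>\<^sup>+x. ennreal ((norm (vs k x - v x))\<^sup>2) \<partial>lebesgue_on \<Omega>)
      = ennreal ((L2_norm \<Omega> (\<lambda>x. vs k x - v x))\<^sup>2)" for k
    by (simp add: nn_integral_eq_integral L2_norm_def)
  show ?thesis
    unfolding L2_tendsto_def *
    using tendsto_power[of "\<lambda>k. L2_norm \<Omega> (\<lambda>x. vs k x - v x)" 0 sequentially 2]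
      tendsto_real_sqrt[of "\<lambda>k. (L2_norm \<Omega> (\<lambda>x. vs k x - v x))\<^sup>2" 0 sequentially]
    by (auto simp: ennreal_tendsto_0_iff)
qed

lemma L2_tendsto_lincomb:
  assumes "\<And>k. vs k \<in> L2_space \<Omega>" "v \<in> L2_space \<Omega>" "\<And>k. ws k \<in> L2_space \<Omega>" "w \<in> L2_space \<Omega>"
    and "L2_tendsto \<Omega> vs v" "L2_tendsto \<Omega> ws w"
  shows "L2_tendsto \<Omega> (\<lambda>k x. a *\<^sub>R vs k x + b *\<^sub>R ws k x) (\<lambda>x. a *\<^sub>R v x + b *\<^sub>R w x)"
proof -
  have V: "(\<lambda>k. L2_norm \<Omega> (\<lambda>x. vs k x - v x)) \<longlonglongrightarrow> 0" and W: "(\<lambda>k. L2_norm \<Omega> (\<lambda>x. ws k x - w x)) \<longlonglongrightarrow> 0"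
    using assms by (auto simp: L2_tendsto_iff)
  let ?B = "\<lambda>k. 2 * a\<^sup>2 * (L2_norm \<Omega> (\<lambda>x. vs k x - v x))\<^sup>2 + 2 * b\<^sup>2 * (L2_norm \<Omega> (\<lambda>x. ws k x - w x))\<^sup>2"
  have B: "?B \<longlonglongrightarrow> 0"
    using tendsto_add[OF tendsto_mult[OF tendsto_const tendsto_power[OF V]] tendsto_mult[OF tendsto_const tendsto_power[OF W]], of "2 * a\<^sup>2" 2 "2 * b\<^sup>2" 2]
    by simp
  have "(\<lambda>k. (L2_norm \<Omega> (\<lambda>x. a *\<^sub>R vs k x + b *\<^sub>R ws k x - (a *\<^sub>R v x + b *\<^sub>R w x)))\<^sup>2) \<longlonglongrightarrow> 0"
  proof (rule tendsto_sandwich[OF _ _ tendsto_const B])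
    have "(L2_norm \<Omega> (\<lambda>x. a *\<^sub>R vs k x + b *\<^sub>R ws k x - (a *\<^sub>R v x + b *\<^sub>R w x)))\<^sup>2 \<le> ?B k" for k
      using L2_norm_lincomb_square_le[OF L2_space_diff L2_space_diff, OF assms(1,2) assms(3,4), of a k b k]
      by (simp add: algebra_simps)
    then show "\<forall>\<^sub>F k in sequentially. (L2_norm \<Omega> (\<lambda>x. a *\<^sub>R vs k x + b *\<^sub>R ws k x - (a *\<^sub>R v x + b *\<^sub>R w x)))\<^sup>2 \<le> ?B k"
      by simp
  qed simp
  from tendsto_real_sqrt[OF this] show ?thesis
    using assms by (subst L2_tendsto_iff) (auto intro: L2_space_lincomb)
qed

lemma L2_norm_eq_0_AE:
  assumes "v \<in> L2_space \<Omega>" "L2_norm \<Omega> v = 0"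
  shows "AE x in lebesgue_on \<Omega>. v x = 0"
  using assms integral_nonneg_eq_0_iff_AE[of "lebesgue_on \<Omega>" "\<lambda>x. (norm (v x))\<^sup>2"]
  by (simp add: L2_space_def L2_norm_def)

lemma pairing_lincomb:
  fixes h \<phi> \<rho> :: "real^'n \<Rightarrow> real"
  assumes "h \<in> L2_space \<Omega>" "\<phi> \<in> L2_space \<Omega>" "\<rho> \<in> L2_space \<Omega>"
  shows "pairing \<Omega> h (\<lambda>x. a * \<phi> x + b * \<rho> x) = a * pairing \<Omega> h \<phi> + b * pairing \<Omega> h \<rho>"
    and "pairing \<Omega> (\<lambda>x. a * \<phi> x + b * \<rho> x) h = a * pairing \<Omega> \<phi> h + b * pairing \<Omega> \<rho> h"
proof -
  have i: "integrable (lebesgue_on \<Omega>) (\<lambda>x. a * (h x * \<phi> x))" "integrable (lebesgue_on \<Omega>) (\<lambda>x. b * (h x * \<rho> x))"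
    using L2_mult(1)[OF assms(1,2)] L2_mult(1)[OF assms(1,3)] by auto
  have "pairing \<Omega> h (\<lambda>x. a * \<phi> x + b * \<rho> x) = (\<integral>x. a * (h x * \<phi> x) + b * (h x * \<rho> x) \<partial>lebesgue_on \<Omega>)"
    by (simp add: pairing_def algebra_simps)
  also have "\<dots> = a * pairing \<Omega> h \<phi> + b * pairing \<Omega> h \<rho>"
    unfolding pairing_def using i by (subst Bochner_Integration.integral_add) auto
  finally show "pairing \<Omega> h (\<lambda>x. a * \<phi> x + b * \<rho> x) = a * pairing \<Omega> h \<phi> + b * pairing \<Omega> h \<rho>" .
  then show "pairing \<Omega> (\<lambda>x. a * \<phi> x + b * \<rho> x) h = a * pairing \<Omega> \<phi> h + b * pairing \<Omega> \<rho> h"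
    by (simp add: pairing_def mult.commute)
qed

section \<open>Test functions\<close>

lemma gradient_lincomb:
  assumes "\<phi> differentiable (at x)" "\<rho> differentiable (at x)"
  shows "gradient (\<lambda>x. a * \<phi> x + b * \<rho> x) x = a *\<^sub>R gradient \<phi> x + b *\<^sub>R gradient \<rho> x"
proof -
  have "((\<lambda>x. a * \<phi> x + b * \<rho> x) has_derivative
      (\<lambda>h. a * frechet_derivative \<phi> (at x) h + b * frechet_derivative \<rho> (at x) h)) (at x)"
    using assms unfolding frechet_derivative_works by (intro has_derivative_add has_derivative_mult_right)
  from frechet_derivative_at[OF this, symmetric] show ?thesis
    by (simp add: gradient_def vec_eq_iff)
qed

lemma C_k_lincomb: "C_k k \<phi> \<Longrightarrow> C_k k \<rho> \<Longrightarrow> C_k k (\<lambda>x. a * \<phi> x + b * \<rho> x)"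
proof (induction k arbitrary: \<phi> \<rho>)
  case (Suc k)
  have d: "\<phi> differentiable (at x)" "\<rho> differentiable (at x)" for x
    using Suc.prems by (auto simp: differentiable_on_def)
  then have "(\<lambda>x. gradient (\<lambda>x. a * \<phi> x + b * \<rho> x) x $ i) = (\<lambda>x. a * gradient \<phi> x $ i + b * gradient \<rho> x $ i)" for i
    by (simp add: gradient_lincomb)
  then show ?case
    using Suc d by (auto simp: differentiable_on_def intro!: differentiable_add differentiable_mult)
qed (auto intro!: continuous_intros)

lemma test_functions_lincomb:
  assumes "\<phi> \<in> test_functions \<Omega>" "\<rho> \<in> test_functions \<Omega>"
  shows "(\<lambda>x. a * \<phi> x + b * \<rho> x) \<in> test_functions \<Omega>"
proof -
  have "closure {x. a * \<phi> x + b * \<rho> x \<noteq> 0} \<subseteq> closure ({x. \<phi> x \<noteq> 0} \<union> {x. \<rho> x \<noteq> 0})"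
    by (rule closure_mono) auto
  then have sub: "closure {x. a * \<phi> x + b * \<rho> x \<noteq> 0} \<subseteq> closure {x. \<phi> x \<noteq> 0} \<union> closure {x. \<rho> x \<noteq> 0}"
    unfolding closure_Un .
  then have "compact (closure {x. a * \<phi> x + b * \<rho> x \<noteq> 0})"
    unfolding compact_eq_bounded_closed using assms
    by (intro conjI closed_closure bounded_subset[OF _ sub] bounded_Un[THEN iffD2])
       (simp_all add: test_functions_def compact_imp_bounded)
  moreover have "closure {x. a * \<phi> x + b * \<rho> x \<noteq> 0} \<subseteq> \<Omega>"
    using sub assms unfolding test_functions_def by blast
  moreover have "C_k k (\<lambda>x. a * \<phi> x + b * \<rho> x)" for k
    using assms C_k_lincomb unfolding test_functions_def by blast
  ultimately show ?thesis unfolding test_functions_def by blast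
qed

lemma test_function_differentiable: "\<phi> \<in> test_functions \<Omega> \<Longrightarrow> \<phi> differentiable (at x)"
proof -
  assume "\<phi> \<in> test_functions \<Omega>"
  then have "C_k (Suc 0) \<phi>" unfolding test_functions_def by blast
  then show ?thesis by (auto simp: differentiable_on_def)
qed

lemma test_function_continuous: "\<phi> \<in> test_functions \<Omega> \<Longrightarrow> continuous_on UNIV \<phi>"
  unfolding test_functions_def using C_k.simps(1) by blast

lemma gradient_eq_0_off_support:
  assumes "x \<notin> closure {x. \<phi> x \<noteq> 0}"
  shows "gradient \<phi> x = 0"
proof -
  have "(\<phi> has_derivative (\<lambda>_. 0)) (at x)"
  proof (rule has_derivative_transform_within_open)
    show "((\<lambda>_. 0) has_derivative (\<lambda>_. 0)) (at x)" by simp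
    show "open (- closure {x. \<phi> x \<noteq> 0})" by auto
    show "x \<in> - closure {x. \<phi> x \<noteq> 0}" using assms by simp
    show "\<And>y. y \<in> - closure {x. \<phi> x \<noteq> 0} \<Longrightarrow> 0 = \<phi> y"
      using closure_subset[of "{x. \<phi> x \<noteq> 0}"] by auto
  qed
  from frechet_derivative_at[OF this, symmetric] show ?thesis
    by (simp add: gradient_def vec_eq_iff)
qed

text \<open>Test functions are closed under partial derivatives, which makes second derivatives of test
  functions available when the gradient is shown to be closable.\<close>

lemma gradient_component_test_function:
  assumes "\<phi> \<in> test_functions \<Omega>"
  shows "(\<lambda>x. gradient \<phi> x $ i) \<in> test_functions \<Omega>"
proof -
  have "C_k (Suc k) \<phi>" for k using assms unfolding test_functions_def by blast
  then have C: "C_k k (\<lambda>x. gradient \<phi> x $ i)" for k by simp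
  have sub: "closure {x. gradient \<phi> x $ i \<noteq> 0} \<subseteq> closure {x. \<phi> x \<noteq> 0}"
    by (rule closure_minimal) (use gradient_eq_0_off_support[of _ \<phi>] in force, rule closed_closure)
  then have "compact (closure {x. gradient \<phi> x $ i \<noteq> 0})"
    unfolding compact_eq_bounded_closed using assms
    by (intro conjI closed_closure bounded_subset[OF _ sub])
       (simp add: test_functions_def compact_imp_bounded)
  moreover have "closure {x. gradient \<phi> x $ i \<noteq> 0} \<subseteq> \<Omega>"
    using sub assms unfolding test_functions_def by blast
  ultimately show ?thesis using C unfolding test_functions_def by blast
qed

text \<open>A function supported in \<open>\<Omega>\<close> can be integrated over the whole space, where the Lebesgue measure is
  invariant under translations.\<close>

lemma continuous_compact_support_integral:
  fixes h :: "real^'n \<Rightarrow> 'b::euclidean_space"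
  assumes \<Omega>: "open \<Omega>" and h: "continuous_on UNIV h" and K: "compact K" "K \<subseteq> \<Omega>" "\<And>x. x \<notin> K \<Longrightarrow> h x = 0"
  shows "h \<in> borel_measurable (lebesgue_on \<Omega>)" "integrable lborel h" "integrable (lebesgue_on \<Omega>) h"
    "integral\<^sup>L (lebesgue_on \<Omega>) h = integral\<^sup>L lborel h"
proof -
  have hb: "h \<in> borel_measurable borel" by (rule borel_measurable_continuous_onI[OF h])
  then have hm: "h \<in> borel_measurable lebesgue" by (simp add: measurable_completion)
  then show "h \<in> borel_measurable (lebesgue_on \<Omega>)" by (rule measurable_restrict_space1)
  have "integrable lborel (\<lambda>x. indicator K x *\<^sub>R h x)"
    by (rule borel_integrable_compact[OF K(1) continuous_on_subset[OF h subset_UNIV]])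
  moreover have eq: "(\<lambda>x. indicator K x *\<^sub>R h x) = h" "(\<lambda>x. indicator \<Omega> x *\<^sub>R h x) = h"
    using K(2,3) by (fastforce simp: indicator_def fun_eq_iff)+
  ultimately show i: "integrable lborel h" by simp
  have "\<Omega> \<inter> space lebesgue \<in> sets lebesgue" using \<Omega> by simp
  then show "integrable (lebesgue_on \<Omega>) h" "integral\<^sup>L (lebesgue_on \<Omega>) h = integral\<^sup>L lborel h"
    using i hb by (simp_all add: integrable_restrict_space integral_restrict_space eq integrable_completion integral_completion)
qed

lemma continuous_compact_support_in_L2:
  fixes h :: "real^'n \<Rightarrow> 'b::euclidean_space"
  assumes \<Omega>: "open \<Omega>" and h: "continuous_on UNIV h" and K: "compact K" "K \<subseteq> \<Omega>" "\<And>x. x \<notin> K \<Longrightarrow> h x = 0"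
  shows "h \<in> L2_space \<Omega>"
proof -
  have "continuous_on UNIV (\<lambda>x. (norm (h x))\<^sup>2)" by (intro continuous_intros h)
  then have "integrable (lebesgue_on \<Omega>) (\<lambda>x. (norm (h x))\<^sup>2)"
    by (rule continuous_compact_support_integral(3)[OF \<Omega> _ K(1,2)]) (simp add: K(3))
  moreover have "h \<in> borel_measurable (lebesgue_on \<Omega>)"
    by (rule continuous_compact_support_integral(1)[OF \<Omega> h K])
  ultimately show ?thesis by (simp add: L2_space_def)
qed

lemma test_function_in_L2:
  assumes \<Omega>: "open \<Omega>" and \<phi>: "\<phi> \<in> test_functions \<Omega>"
  shows "\<phi> \<in> L2_space \<Omega>" "gradient \<phi> \<in> L2_space \<Omega>"
proof -
  let ?K = "closure {x. \<phi> x \<noteq> 0}"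
  have K: "compact ?K" "?K \<subseteq> \<Omega>" using \<phi> by (auto simp: test_functions_def)
  show "\<phi> \<in> L2_space \<Omega>"
    by (rule continuous_compact_support_in_L2[OF \<Omega> test_function_continuous[OF \<phi>] K])
       (use closure_subset[of "{x. \<phi> x \<noteq> 0}"] in blast)
  have "continuous_on UNIV (\<lambda>x. \<chi> i. gradient \<phi> x $ i)"
    by (rule continuous_on_vec_lambda) (rule test_function_continuous[OF gradient_component_test_function[OF \<phi>]])
  then have g: "continuous_on UNIV (gradient \<phi>)" unfolding vec_lambda_eta .
  show "gradient \<phi> \<in> L2_space \<Omega>"
    by (rule continuous_compact_support_in_L2[OF \<Omega> g K]) (rule gradient_eq_0_off_support)
qed

text \<open>Translation invariance of the Lebesgue measure makes the integral of every difference quotient of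
  \<open>h\<close> vanish, and the difference quotients converge boundedly to the partial derivative.\<close>

lemma integral_partial_derivative_eq_0:
  fixes h :: "real^'n \<Rightarrow> real"
  assumes d: "\<And>x. h differentiable (at x)" and c: "continuous_on UNIV (\<lambda>x. gradient h x $ i)"
    and K: "compact K" "\<And>x. x \<notin> K \<Longrightarrow> h x = 0"
  shows "(\<integral>x. gradient h x $ i \<partial>lborel) = 0"
proof -
  let ?e = "axis i 1 :: real^'n"
  \<comment> \<open>With shifts of length at most 1, the difference quotients vanish outside the ball of radius \<open>R + 1\<close>,
    and the intermediate points of the mean value theorem stay in the ball of radius \<open>R + 2\<close>.\<close>
  obtain R where R: "\<And>x. x \<in> K \<Longrightarrow> norm x \<le> R" using compact_imp_bounded[OF K(1)] by (auto simp: bounded_iff)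
  let ?B = "cball (0::real^'n) (R + 2)"
  have "bounded ((\<lambda>x. gradient h x $ i) ` ?B)"
    by (intro compact_imp_bounded compact_continuous_image continuous_on_subset[OF c]) auto
  then obtain C where C: "\<And>x. norm x \<le> R + 2 \<Longrightarrow> \<bar>gradient h x $ i\<bar> \<le> C"
    by (force simp: bounded_iff)
  have hc: "continuous_on UNIV h"
    using d by (auto intro: differentiable_imp_continuous_within simp: continuous_on_eq_continuous_at)
  then have hb[measurable]: "h \<in> borel_measurable borel" by (rule borel_measurable_continuous_onI)
  have hi: "integrable lborel h"
    using continuous_compact_support_integral(2)[OF open_UNIV hc K(1) _ K(2)] by simp
  have line: "((\<lambda>r. h (x + r *\<^sub>R ?e)) has_real_derivative gradient h (x + r *\<^sub>R ?e) $ i) (at r)" for x r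
  proof -
    have "(h has_derivative frechet_derivative h (at (x + r *\<^sub>R ?e))) (at (x + r *\<^sub>R ?e))"
      using d by (simp add: frechet_derivative_works)
    then have "((\<lambda>r. h (x + r *\<^sub>R ?e)) has_derivative (\<lambda>s. frechet_derivative h (at (x + r *\<^sub>R ?e)) (s *\<^sub>R ?e))) (at r)"
      by (rule has_derivative_compose[rotated]) (auto intro!: derivative_eq_intros)
    moreover have "(\<lambda>s. frechet_derivative h (at (x + r *\<^sub>R ?e)) (s *\<^sub>R ?e)) = (*) (gradient h (x + r *\<^sub>R ?e) $ i)"
      using linear_frechet_derivative[OF d, of "x + r *\<^sub>R ?e"]
      by (auto simp: gradient_def linear_scale fun_eq_iff)
    ultimately show ?thesis by (simp add: has_field_derivative_def)
  qed
  define \<epsilon> where "\<epsilon> k = 1 / (1 + real k)" for k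
  have \<epsilon>: "0 < \<epsilon> k" "\<epsilon> k \<le> 1" for k by (auto simp: \<epsilon>_def)
  have \<epsilon>0: "\<epsilon> \<longlonglongrightarrow> 0" unfolding \<epsilon>_def by (rule lim_inverse_n'[THEN LIMSEQ_Suc, simplified])
  let ?Q = "\<lambda>k x. (h (x + \<epsilon> k *\<^sub>R ?e) - h x) / \<epsilon> k"
  have shift: "integrable lborel (\<lambda>x. h (x + y))" "(\<integral>x. h (x + y) \<partial>lborel) = (\<integral>x. h x \<partial>lborel)" for y
  proof -
    have eq: "lborel = distr lborel borel ((+) y)" by (simp add: lborel_distr_plus)
    have "integrable (distr lborel borel ((+) y)) h" using hi by (simp add: lborel_distr_plus)
    then show "integrable lborel (\<lambda>x. h (x + y))" by (subst (asm) integrable_distr_eq) (auto simp: add.commute)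
    have "(\<integral>x. h x \<partial>lborel) = (\<integral>x. h x \<partial>distr lborel borel ((+) y))" by (simp add: lborel_distr_plus)
    also have "\<dots> = (\<integral>x. h (x + y) \<partial>lborel)" by (subst integral_distr) (auto simp: add.commute)
    finally show "(\<integral>x. h (x + y) \<partial>lborel) = (\<integral>x. h x \<partial>lborel)" by simp
  qed
  have "(\<lambda>k. \<integral>x. ?Q k x \<partial>lborel) \<longlonglongrightarrow> (\<integral>x. gradient h x $ i \<partial>lborel)"
  proof (rule integral_dominated_convergence[where w = "\<lambda>x. indicator ?B x * C"])
    show "(\<lambda>x. gradient h x $ i) \<in> borel_measurable lborel" by (simp add: borel_measurable_continuous_onI[OF c])
    show "integrable lborel (\<lambda>x. indicator ?B x * C)"
      by (intro integrable_mult_left integrable_real_indicator) (use emeasure_lborel_cball_finite[of "0::real^'n" "R + 2"] in auto)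
    show "AE x in lborel. (\<lambda>k. ?Q k x) \<longlonglongrightarrow> gradient h x $ i"
    proof (rule AE_I2)
      fix x
      have "((\<lambda>r. (h (x + r *\<^sub>R ?e) - h x) / r) \<longlongrightarrow> gradient h x $ i) (at 0)"
        using line[of x 0] by (simp add: DERIV_def)
      moreover have "filterlim \<epsilon> (at 0) sequentially"
        by (simp add: filterlim_at \<epsilon>0 \<epsilon>(1)[THEN less_imp_neq, THEN not_sym])
      ultimately show "(\<lambda>k. ?Q k x) \<longlonglongrightarrow> gradient h x $ i" by (rule filterlim_compose)
    qed
    show "AE x in lborel. norm (?Q k x) \<le> indicator ?B x * C" for k
    proof (rule AE_I2)
      fix x
      obtain r where r: "0 < r" "r < \<epsilon> k" "h (x + \<epsilon> k *\<^sub>R ?e) - h x = \<epsilon> k * (gradient h (x + r *\<^sub>R ?e) $ i)"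
        using MVT2[OF \<epsilon>(1), of k "\<lambda>r. h (x + r *\<^sub>R ?e)" "\<lambda>r. gradient h (x + r *\<^sub>R ?e) $ i"] line by auto
      show "norm (?Q k x) \<le> indicator ?B x * C"
      proof (cases "norm x \<le> R + 1")
        case True
        then have "norm (x + r *\<^sub>R ?e) \<le> R + 2"
          using norm_triangle_ineq[of x "r *\<^sub>R ?e"] r \<epsilon>(2)[of k] by simp
        with True C r \<epsilon>(1)[of k] show ?thesis by simp
      next
        case False
        then have "norm (x + \<epsilon> k *\<^sub>R ?e) > R"
          using norm_triangle_ineq2[of x "- \<epsilon> k *\<^sub>R ?e"] \<epsilon>[of k] by simp
        with False have "h (x + \<epsilon> k *\<^sub>R ?e) = 0" "h x = 0" using R K(2) by force+
        moreover have "0 \<le> C" if "norm x \<le> R + 2" using C[OF that] by linarith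
        ultimately show ?thesis by (simp add: indicator_def)
      qed
    qed
  qed simp
  moreover have "(\<integral>x. ?Q k x \<partial>lborel) = 0" for k
    using shift[of "\<epsilon> k *\<^sub>R ?e"] hi by simp
  ultimately have "(\<lambda>k. 0) \<longlonglongrightarrow> (\<integral>x. gradient h x $ i \<partial>lborel)" by (simp only:)
  then show ?thesis by (simp add: LIMSEQ_const_iff)
qed

lemma test_function_integration_by_parts:
  assumes \<Omega>: "open \<Omega>" and \<phi>: "\<phi> \<in> test_functions \<Omega>" and \<rho>: "\<rho> \<in> test_functions \<Omega>"
  shows "pairing \<Omega> (\<lambda>x. gradient \<phi> x $ i) \<rho> = - pairing \<Omega> \<phi> (\<lambda>x. gradient \<rho> x $ i)"
proof -
  note d = test_function_differentiable[OF \<phi>] test_function_differentiable[OF \<rho>]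
  note c = test_function_continuous[OF \<phi>] test_function_continuous[OF \<rho>]
    test_function_continuous[OF gradient_component_test_function[OF \<phi>, of i]]
    test_function_continuous[OF gradient_component_test_function[OF \<rho>, of i]]
  let ?K = "closure {x. \<phi> x \<noteq> 0}"
  have K: "compact ?K" "?K \<subseteq> \<Omega>" using \<phi> by (auto simp: test_functions_def)
  have z: "x \<notin> ?K \<Longrightarrow> \<phi> x = 0" "x \<notin> ?K \<Longrightarrow> gradient \<phi> x = 0" for x
    using gradient_eq_0_off_support[of x \<phi>] closure_subset[of "{x. \<phi> x \<noteq> 0}"] by blast+
  let ?h = "\<lambda>x. \<phi> x * \<rho> x"
  have g: "gradient ?h x $ i = gradient \<phi> x $ i * \<rho> x + \<phi> x * (gradient \<rho> x $ i)" for x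
  proof -
    have "(?h has_derivative (\<lambda>y. \<phi> x * frechet_derivative \<rho> (at x) y + frechet_derivative \<phi> (at x) y * \<rho> x)) (at x)"
      using d[of x] unfolding frechet_derivative_works by (rule has_derivative_mult)
    from frechet_derivative_at[OF this, symmetric] show ?thesis by (simp add: gradient_def)
  qed
  have hz: "x \<notin> ?K \<Longrightarrow> ?h x = 0" and hgz: "x \<notin> ?K \<Longrightarrow> gradient ?h x $ i = 0" for x
    using z[of x] by (auto simp: g)
  have gc: "continuous_on UNIV (\<lambda>x. gradient ?h x $ i)"
    unfolding g by (intro continuous_intros c)
  have "(\<integral>x. gradient ?h x $ i \<partial>lborel) = 0"
    by (rule integral_partial_derivative_eq_0[OF _ gc K(1)]) (intro differentiable_mult d, rule hz)
  moreover have "integral\<^sup>L (lebesgue_on \<Omega>) (\<lambda>x. gradient ?h x $ i) = integral\<^sup>L lborel (\<lambda>x. gradient ?h x $ i)"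
    by (rule continuous_compact_support_integral(4)[OF \<Omega> gc K hgz])
  moreover have "integral\<^sup>L (lebesgue_on \<Omega>) (\<lambda>x. gradient ?h x $ i)
      = pairing \<Omega> (\<lambda>x. gradient \<phi> x $ i) \<rho> + pairing \<Omega> \<phi> (\<lambda>x. gradient \<rho> x $ i)"
    unfolding g pairing_def
    by (intro Bochner_Integration.integral_add L2_mult test_function_in_L2(1)[OF \<Omega>] gradient_component_test_function \<phi> \<rho>)
  ultimately show ?thesis by simp
qed

section \<open>The space \<open>H\<^sub>0\<^sup>1(\<Omega>)\<close>\<close>

lemma is_H01_gradientD:
  assumes "is_H01_gradient \<Omega> v g"
  shows "v \<in> L2_space \<Omega>" "g \<in> L2_space \<Omega>"
  using assms by (auto simp: is_H01_gradient_def)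

lemma is_H01_gradient_lincomb:
  assumes \<Omega>: "open \<Omega>" and v: "is_H01_gradient \<Omega> v g" and w: "is_H01_gradient \<Omega> w k"
  shows "is_H01_gradient \<Omega> (\<lambda>x. a * v x + b * w x) (\<lambda>x. a *\<^sub>R g x + b *\<^sub>R k x)"
proof -
  obtain \<phi> \<rho> where \<phi>: "\<And>n. \<phi> n \<in> test_functions \<Omega>" "L2_tendsto \<Omega> \<phi> v" "L2_tendsto \<Omega> (\<lambda>k. gradient (\<phi> k)) g"
    and \<rho>: "\<And>n. \<rho> n \<in> test_functions \<Omega>" "L2_tendsto \<Omega> \<rho> w" "L2_tendsto \<Omega> (\<lambda>k. gradient (\<rho> k)) k"
    using v w unfolding is_H01_gradient_def by blast
  note L2 = is_H01_gradientD[OF v] is_H01_gradientD[OF w] test_function_in_L2[OF \<Omega>]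
  have grad: "gradient (\<lambda>x. a * \<phi> n x + b * \<rho> n x) = (\<lambda>x. a *\<^sub>R gradient (\<phi> n) x + b *\<^sub>R gradient (\<rho> n) x)" for n
    by (intro ext gradient_lincomb test_function_differentiable[OF \<phi>(1)] test_function_differentiable[OF \<rho>(1)])
  have "L2_tendsto \<Omega> (\<lambda>n x. a *\<^sub>R \<phi> n x + b *\<^sub>R \<rho> n x) (\<lambda>x. a *\<^sub>R v x + b *\<^sub>R w x)"
    by (rule L2_tendsto_lincomb[OF L2(5)[OF \<phi>(1)] L2(1) L2(5)[OF \<rho>(1)] L2(3) \<phi>(2) \<rho>(2)])
  moreover have "L2_tendsto \<Omega> (\<lambda>n. gradient (\<lambda>x. a * \<phi> n x + b * \<rho> n x)) (\<lambda>x. a *\<^sub>R g x + b *\<^sub>R k x)"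
    unfolding grad
    by (rule L2_tendsto_lincomb[OF L2(6)[OF \<phi>(1)] L2(2) L2(6)[OF \<rho>(1)] L2(4) \<phi>(3) \<rho>(3)])
  ultimately show ?thesis
    unfolding is_H01_gradient_def real_scaleR_def
    by (intro conjI exI[of _ "\<lambda>n x. a * \<phi> n x + b * \<rho> n x"] allI L2_space_lincomb_real[OF L2(1,3)]
        L2_space_lincomb[OF L2(2,4)] test_functions_lincomb \<phi>(1) \<rho>(1)) auto
qed

lemma L2_tendsto_inner:
  assumes v: "\<And>k. vs k \<in> L2_space \<Omega>" "v \<in> L2_space \<Omega>" "L2_tendsto \<Omega> vs v" and w: "w \<in> L2_space \<Omega>"
  shows "(\<lambda>k. \<integral>x. vs k x \<bullet> w x \<partial>lebesgue_on \<Omega>) \<longlonglongrightarrow> (\<integral>x. v x \<bullet> w x \<partial>lebesgue_on \<Omega>)"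
proof (rule LIM_zero_cancel, rule tendsto_rabs_zero_cancel, rule tendsto_sandwich[OF _ _ tendsto_const])
  show "(\<lambda>k. L2_norm \<Omega> (\<lambda>x. vs k x - v x) * L2_norm \<Omega> w) \<longlonglongrightarrow> 0"
    using v by (intro tendsto_mult_left_zero) (auto simp: L2_tendsto_iff)
  have "\<bar>(\<integral>x. vs k x \<bullet> w x \<partial>lebesgue_on \<Omega>) - (\<integral>x. v x \<bullet> w x \<partial>lebesgue_on \<Omega>)\<bar>
      \<le> L2_norm \<Omega> (\<lambda>x. vs k x - v x) * L2_norm \<Omega> w" for k
    using L2_inner(2)[OF L2_space_diff[OF v(1) v(2)] w, of k] L2_inner(1)[OF v(1) w, of k] L2_inner(1)[OF v(2) w]
    by (simp add: inner_diff_left)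
  then show "\<forall>\<^sub>F k in sequentially. \<bar>(\<integral>x. vs k x \<bullet> w x \<partial>lebesgue_on \<Omega>) - (\<integral>x. v x \<bullet> w x \<partial>lebesgue_on \<Omega>)\<bar>
      \<le> L2_norm \<Omega> (\<lambda>x. vs k x - v x) * L2_norm \<Omega> w" by simp
qed simp

text \<open>The gradient is a closable operator: \<open>h\<close> is a limit of gradients of test functions \<open>\<phi>\<^sub>m\<close>, and it is
  orthogonal to each of them, since \<open>\<langle>\<nabla>\<phi>\<^sub>k, \<nabla>\<phi>\<^sub>m\<rangle> = - \<langle>\<phi>\<^sub>k, \<Delta>\<phi>\<^sub>m\<rangle>\<close> tends to \<open>0\<close> with \<open>\<phi>\<^sub>k\<close>.\<close>

lemma H01_gradient_of_null_function:
  assumes \<Omega>: "open \<Omega>" and v: "is_H01_gradient \<Omega> v h" and v0: "AE x in lebesgue_on \<Omega>. v x = 0"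
  shows "AE x in lebesgue_on \<Omega>. h x = 0"
proof -
  obtain \<phi> where \<phi>: "\<And>n. \<phi> n \<in> test_functions \<Omega>" "L2_tendsto \<Omega> \<phi> v" "L2_tendsto \<Omega> (\<lambda>k. gradient (\<phi> k)) h"
    using v unfolding is_H01_gradient_def by blast
  note L2 = is_H01_gradientD[OF v] test_function_in_L2[OF \<Omega> \<phi>(1)]
  have orth: "(\<integral>x. h x \<bullet> gradient (\<phi> m) x \<partial>lebesgue_on \<Omega>) = 0" for m
  proof -
    let ?\<Delta> = "\<lambda>i x. gradient (\<lambda>x. gradient (\<phi> m) x $ i) x $ i"
    note t = gradient_component_test_function[OF \<phi>(1)] gradient_component_test_function[OF gradient_component_test_function[OF \<phi>(1)]]
    note t2 = t[THEN test_function_in_L2(1)[OF \<Omega>]]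
    have "(\<integral>x. gradient (\<phi> k) x \<bullet> gradient (\<phi> m) x \<partial>lebesgue_on \<Omega>)
        = (\<Sum>i\<in>UNIV. - (\<integral>x. \<phi> k x \<bullet> ?\<Delta> i x \<partial>lebesgue_on \<Omega>))" for k
    proof -
      have "(\<integral>x. gradient (\<phi> k) x \<bullet> gradient (\<phi> m) x \<partial>lebesgue_on \<Omega>)
        = (\<Sum>i\<in>UNIV. pairing \<Omega> (\<lambda>x. gradient (\<phi> k) x $ i) (\<lambda>x. gradient (\<phi> m) x $ i))"
        unfolding inner_vec_def inner_real_def pairing_def by (intro Bochner_Integration.integral_sum L2_mult t2(1))
      then show ?thesis
        unfolding test_function_integration_by_parts[OF \<Omega> \<phi>(1) t(1)] by (simp add: pairing_def)
    qed
    moreover have "(\<lambda>k. \<Sum>i\<in>UNIV. - (\<integral>x. \<phi> k x \<bullet> ?\<Delta> i x \<partial>lebesgue_on \<Omega>)) \<longlonglongrightarrow> (\<Sum>i\<in>UNIV. - (\<integral>x. v x \<bullet> ?\<Delta> i x \<partial>lebesgue_on \<Omega>))"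
      by (intro tendsto_sum tendsto_minus L2_tendsto_inner[OF L2(3) L2(1) \<phi>(2) t2(2)])
    moreover have "(\<integral>x. v x \<bullet> ?\<Delta> i x \<partial>lebesgue_on \<Omega>) = 0" for i
      by (rule integral_eq_zero_AE) (use v0 in auto)
    ultimately have "(\<lambda>k. \<integral>x. gradient (\<phi> k) x \<bullet> gradient (\<phi> m) x \<partial>lebesgue_on \<Omega>) \<longlonglongrightarrow> 0"
      by simp
    moreover have "(\<lambda>k. \<integral>x. gradient (\<phi> k) x \<bullet> gradient (\<phi> m) x \<partial>lebesgue_on \<Omega>) \<longlonglongrightarrow> (\<integral>x. h x \<bullet> gradient (\<phi> m) x \<partial>lebesgue_on \<Omega>)"
      by (rule L2_tendsto_inner[OF L2(4) L2(2) \<phi>(3) L2(4)])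
    ultimately show ?thesis by (rule LIMSEQ_unique[symmetric])
  qed
  have "(\<lambda>m. \<integral>x. gradient (\<phi> m) x \<bullet> h x \<partial>lebesgue_on \<Omega>) \<longlonglongrightarrow> (\<integral>x. h x \<bullet> h x \<partial>lebesgue_on \<Omega>)"
    by (rule L2_tendsto_inner[OF L2(4) L2(2) \<phi>(3) L2(2)])
  then have "(\<integral>x. h x \<bullet> h x \<partial>lebesgue_on \<Omega>) = 0"
    using orth by (simp add: inner_commute LIMSEQ_const_iff)
  then show ?thesis
    using L2 by (intro L2_norm_eq_0_AE) (simp_all add: L2_norm_def dot_square_norm)
qed

text \<open>Hence the choice made in the definition of \<open>weak_gradient\<close> does not matter, and the weak gradient
  is linear almost everywhere.\<close>

lemma H01_gradient_unique:
  assumes \<Omega>: "open \<Omega>" and v: "is_H01_gradient \<Omega> v g" and w: "is_H01_gradient \<Omega> w k"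
    and eq: "AE x in lebesgue_on \<Omega>. v x = w x"
  shows "AE x in lebesgue_on \<Omega>. g x = k x"
proof -
  have "AE x in lebesgue_on \<Omega>. 1 *\<^sub>R g x + (-1) *\<^sub>R k x = 0"
    by (rule H01_gradient_of_null_function[OF \<Omega> is_H01_gradient_lincomb[OF \<Omega> v w]]) (use eq in auto)
  then show ?thesis by simp
qed

lemma weak_gradient_works: "v \<in> H01 \<Omega> \<Longrightarrow> is_H01_gradient \<Omega> v (weak_gradient \<Omega> v)"
  unfolding H01_def weak_gradient_def mem_Collect_eq by (rule someI_ex[of "is_H01_gradient \<Omega> v"])

lemma H01_lincomb:
  assumes "open \<Omega>" "v \<in> H01 \<Omega>" "w \<in> H01 \<Omega>"
  shows "(\<lambda>x. a * v x + b * w x) \<in> H01 \<Omega>"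
  using is_H01_gradient_lincomb[OF assms(1) assms(2,3)[THEN weak_gradient_works], of a b]
  unfolding H01_def by blast

lemma H01_L2:
  assumes "v \<in> H01 \<Omega>"
  shows "v \<in> L2_space \<Omega>" "weak_gradient \<Omega> v \<in> L2_space \<Omega>"
  using is_H01_gradientD[OF weak_gradient_works[OF assms]] by auto

lemma weak_gradient_lincomb:
  assumes "open \<Omega>" "v \<in> H01 \<Omega>" "w \<in> H01 \<Omega>"
  shows "AE x in lebesgue_on \<Omega>. weak_gradient \<Omega> (\<lambda>x. a * v x + b * w x) x
    = a *\<^sub>R weak_gradient \<Omega> v x + b *\<^sub>R weak_gradient \<Omega> w x"
  using assms by (intro H01_gradient_unique[OF _ weak_gradient_works is_H01_gradient_lincomb[OF _ weak_gradient_works weak_gradient_works]])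
     (auto intro: H01_lincomb)

lemma H01_sum:
  assumes "open \<Omega>" "v \<in> H01 \<Omega>" "finite I" "\<And>i. i \<in> I \<Longrightarrow> e i \<in> H01 \<Omega>"
  shows "(\<lambda>x. v x + (\<Sum>i\<in>I. c i * e i x)) \<in> H01 \<Omega>"
  using assms(3,4)
proof (induction I rule: finite_induct)
  case (insert i I)
  have "(\<lambda>x. 1 * (v x + (\<Sum>i\<in>I. c i * e i x)) + c i * e i x) \<in> H01 \<Omega>"
    using insert assms by (intro H01_lincomb) auto
  then show ?case using insert by (simp add: algebra_simps)
qed (use assms in simp)

section \<open>The elliptic operator\<close>

text \<open>All terms of the operator are pointwise bilinear products of a bounded coefficient with a
  square-integrable function; only the product differs.\<close>

lemma Linf_bilinear_L2:
  assumes B: "bounded_bilinear B" and h: "h \<in> Linf_space \<Omega>" and g: "g \<in> L2_space \<Omega>"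
  shows "(\<lambda>x. B (h x) (g x)) \<in> L2_space \<Omega>"
proof -
  have [measurable]: "h \<in> borel_measurable (lebesgue_on \<Omega>)" "g \<in> borel_measurable (lebesgue_on \<Omega>)"
    and gi: "integrable (lebesgue_on \<Omega>) (\<lambda>x. (norm (g x))\<^sup>2)"
    using h g by (auto simp: Linf_space_def L2_space_def)
  obtain C where C: "AE x in lebesgue_on \<Omega>. norm (h x) \<le> C"
    using h by (auto simp: Linf_space_def)
  obtain K where K: "\<And>a b. norm (B a b) \<le> norm a * norm b * K"
    using bounded_bilinear.bounded[OF B] by blast
  have "(\<lambda>p. B (fst p) (snd p)) \<in> borel_measurable borel"
    by (rule borel_measurable_continuous_onI)
       (intro bounded_bilinear.continuous_on[OF B] continuous_intros)
  then have m: "(\<lambda>x. B (h x) (g x)) \<in> borel_measurable (lebesgue_on \<Omega>)"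
    using measurable_compose[of "\<lambda>x. (h x, g x)" "lebesgue_on \<Omega>" borel "\<lambda>p. B (fst p) (snd p)" borel]
    by (simp add: borel_measurable_Pair)
  have "integrable (lebesgue_on \<Omega>) (\<lambda>x. (norm (B (h x) (g x)))\<^sup>2)"
  proof (rule Bochner_Integration.integrable_bound)
    show "integrable (lebesgue_on \<Omega>) (\<lambda>x. (C * K)\<^sup>2 * (norm (g x))\<^sup>2)" using gi by simp
    show "(\<lambda>x. (norm (B (h x) (g x)))\<^sup>2) \<in> borel_measurable (lebesgue_on \<Omega>)" using m by simp
    show "AE x in lebesgue_on \<Omega>. norm ((norm (B (h x) (g x)))\<^sup>2) \<le> norm ((C * K)\<^sup>2 * (norm (g x))\<^sup>2)"
      using C
    proof eventually_elim
      case (elim x)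
      have "0 \<le> C" using elim norm_ge_zero order_trans by blast
      have "norm (B (h x) (g x)) \<le> norm (h x) * norm (g x) * \<bar>K\<bar>"
        by (rule order_trans[OF K]) (simp add: mult_left_mono)
      also have "\<dots> \<le> C * norm (g x) * \<bar>K\<bar>"
        using elim by (intro mult_right_mono) auto
      finally have "(norm (B (h x) (g x)))\<^sup>2 \<le> (C * norm (g x) * \<bar>K\<bar>)\<^sup>2"
        by (rule power_mono) simp
      then show ?case by (simp add: power_mult_distrib mult_ac)
    qed
  qed
  with m show ?thesis by (simp add: L2_space_def)
qed

lemma bounded_bilinear_matrix_vector_mult:
  "bounded_bilinear (\<lambda>(A :: real^'n^'m) v. A *v v)"
  unfolding bilinear_conv_bounded_bilinear[symmetric] bilinear_def
  by (auto intro!: linearI simp: matrix_vector_right_distrib matrix_vector_mult_add_rdistrib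
      matrix_vector_mult_scaleR scaleR_matrix_vector_assoc)

text \<open>The bilinear form of the operator is \<open>\<langle>flux v, \<nabla>\<phi>\<rangle> + \<langle>lower_order v, \<phi>\<rangle>\<close> with both factors in
  \<open>L\<^sub>2(\<Omega>)\<close>, so that its boundedness is the Cauchy-Schwarz inequality.\<close>

definition flux :: "(real^'n) set \<Rightarrow> 'n elliptic_operator \<Rightarrow> (real^'n \<Rightarrow> real) \<Rightarrow> real^'n \<Rightarrow> real^'n" where
  "flux \<Omega> L v x = coeff_A L x *v weak_gradient \<Omega> v x + v x *\<^sub>R coeff_d L x"

definition lower_order :: "(real^'n) set \<Rightarrow> 'n elliptic_operator \<Rightarrow> (real^'n \<Rightarrow> real) \<Rightarrow> real^'n \<Rightarrow> real" where
  "lower_order \<Omega> L v x = coeff_b L x \<bullet> weak_gradient \<Omega> v x + coeff_c L x * v x"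

lemma flux_L2:
  assumes L: "elliptic \<Omega> L" and v: "v \<in> H01 \<Omega>"
  shows "flux \<Omega> L v \<in> L2_space \<Omega>" "lower_order \<Omega> L v \<in> L2_space \<Omega>"
proof -
  have c: "coeff_A L \<in> Linf_space \<Omega>" "coeff_d L \<in> Linf_space \<Omega>" "coeff_b L \<in> Linf_space \<Omega>" "coeff_c L \<in> Linf_space \<Omega>"
    using L by (auto simp: elliptic_def)
  show "flux \<Omega> L v \<in> L2_space \<Omega>"
    using L2_space_lincomb[OF Linf_bilinear_L2[OF bounded_bilinear_matrix_vector_mult c(1) H01_L2(2)[OF v]]
        Linf_bilinear_L2[OF bounded_bilinear.flip[OF bounded_bilinear_scaleR] c(2) H01_L2(1)[OF v]], of 1 1]
    by (simp add: flux_def[abs_def])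
  show "lower_order \<Omega> L v \<in> L2_space \<Omega>"
    using L2_space_lincomb[OF Linf_bilinear_L2[OF bounded_bilinear_inner c(3) H01_L2(2)[OF v]]
        Linf_bilinear_L2[OF bounded_bilinear_mult c(4) H01_L2(1)[OF v]], of 1 1]
    by (simp add: lower_order_def[abs_def])
qed

lemma op_app_eq:
  assumes L: "elliptic \<Omega> L" and v: "v \<in> H01 \<Omega>" and \<phi>: "\<phi> \<in> H01 \<Omega>"
  shows "op_app \<Omega> L v \<phi> = (\<integral>x. flux \<Omega> L v x \<bullet> weak_gradient \<Omega> \<phi> x \<partial>lebesgue_on \<Omega>) + pairing \<Omega> (lower_order \<Omega> L v) \<phi>"
  unfolding op_app_def flux_def[symmetric] lower_order_def[symmetric] pairing_def
  by (intro Bochner_Integration.integral_add L2_inner(1) L2_mult(1) flux_L2[OF L v] H01_L2[OF \<phi>])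

lemma L2_inner_lincomb:
  assumes u: "u \<in> L2_space \<Omega>" and v: "v \<in> L2_space \<Omega>" and w: "w \<in> L2_space \<Omega>" and z: "z \<in> L2_space \<Omega>"
    and ae: "AE x in lebesgue_on \<Omega>. z x = a *\<^sub>R v x + b *\<^sub>R w x"
  shows "(\<integral>x. u x \<bullet> z x \<partial>lebesgue_on \<Omega>)
    = a * (\<integral>x. u x \<bullet> v x \<partial>lebesgue_on \<Omega>) + b * (\<integral>x. u x \<bullet> w x \<partial>lebesgue_on \<Omega>)"
proof -
  have "(\<integral>x. u x \<bullet> z x \<partial>lebesgue_on \<Omega>) = (\<integral>x. a * (u x \<bullet> v x) + b * (u x \<bullet> w x) \<partial>lebesgue_on \<Omega>)"
    using L2_inner(1)[OF u v] L2_inner(1)[OF u w] L2_inner(1)[OF u z] ae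
    by (intro integral_cong_AE) (auto simp: inner_add_right elim!: eventually_mono)
  also have "\<dots> = (\<integral>x. a * (u x \<bullet> v x) \<partial>lebesgue_on \<Omega>) + (\<integral>x. b * (u x \<bullet> w x) \<partial>lebesgue_on \<Omega>)"
    using L2_inner(1)[OF u v] L2_inner(1)[OF u w] by (intro Bochner_Integration.integral_add) auto
  finally show ?thesis by simp
qed

text \<open>The form depends on its arguments only through weak gradients, which are linear merely up to null
  sets; this suffices, as they occur under the integral.\<close>

lemma op_app_lincomb_right:
  assumes \<Omega>: "open \<Omega>" and L: "elliptic \<Omega> L" and v: "v \<in> H01 \<Omega>" and \<phi>: "\<phi> \<in> H01 \<Omega>" "\<rho> \<in> H01 \<Omega>"
  shows "op_app \<Omega> L v (\<lambda>x. a * \<phi> x + b * \<rho> x) = a * op_app \<Omega> L v \<phi> + b * op_app \<Omega> L v \<rho>"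
proof -
  note h = H01_lincomb[OF \<Omega> \<phi>, of a b]
  show ?thesis
    unfolding op_app_eq[OF L v h] op_app_eq[OF L v \<phi>(1)] op_app_eq[OF L v \<phi>(2)]
      L2_inner_lincomb[OF flux_L2(1)[OF L v] H01_L2(2)[OF \<phi>(1)] H01_L2(2)[OF \<phi>(2)] H01_L2(2)[OF h]
        weak_gradient_lincomb[OF \<Omega> \<phi>]]
      pairing_lincomb(1)[OF flux_L2(2)[OF L v] H01_L2(1)[OF \<phi>(1)] H01_L2(1)[OF \<phi>(2)]]
    by (simp add: algebra_simps)
qed

lemma op_app_lincomb_left:
  assumes \<Omega>: "open \<Omega>" and L: "elliptic \<Omega> L" and v: "v \<in> H01 \<Omega>" and w: "w \<in> H01 \<Omega>" and \<phi>: "\<phi> \<in> H01 \<Omega>"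
  shows "op_app \<Omega> L (\<lambda>x. a * v x + b * w x) \<phi> = a * op_app \<Omega> L v \<phi> + b * op_app \<Omega> L w \<phi>"
proof -
  let ?z = "\<lambda>x. a * v x + b * w x"
  have z: "?z \<in> H01 \<Omega>" by (rule H01_lincomb[OF \<Omega> v w])
  note fv = flux_L2[OF L v] and fw = flux_L2[OF L w] and fz = flux_L2[OF L z]
  have fl: "AE x in lebesgue_on \<Omega>. flux \<Omega> L ?z x = a *\<^sub>R flux \<Omega> L v x + b *\<^sub>R flux \<Omega> L w x"
    using weak_gradient_lincomb[OF \<Omega> v w, of a b]
    by eventually_elim (simp add: flux_def matrix_vector_right_distrib matrix_vector_mult_scaleR algebra_simps)
  have lo: "AE x in lebesgue_on \<Omega>. lower_order \<Omega> L ?z x = a *\<^sub>R lower_order \<Omega> L v x + b *\<^sub>R lower_order \<Omega> L w x"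
    using weak_gradient_lincomb[OF \<Omega> v w, of a b]
    by eventually_elim (simp add: lower_order_def inner_add_right algebra_simps)
  show ?thesis
    using L2_inner_lincomb[OF H01_L2(2)[OF \<phi>] fv(1) fw(1) fz(1) fl]
      L2_inner_lincomb[OF H01_L2(1)[OF \<phi>] fv(2) fw(2) fz(2) lo]
    unfolding op_app_eq[OF L z \<phi>] op_app_eq[OF L v \<phi>] op_app_eq[OF L w \<phi>] pairing_def
    by (simp add: inner_commute algebra_simps)
qed

lemma L2_norms_le_H1_norm:
  assumes "\<phi> \<in> H01 \<Omega>"
  shows "L2_norm \<Omega> \<phi> \<le> H1_norm \<Omega> \<phi>" "L2_norm \<Omega> (weak_gradient \<Omega> \<phi>) \<le> H1_norm \<Omega> \<phi>"
proof -
  have "H1_inner \<Omega> \<phi> \<phi> = (\<integral>x. \<phi> x * \<phi> x \<partial>lebesgue_on \<Omega>) + (\<integral>x. weak_gradient \<Omega> \<phi> x \<bullet> weak_gradient \<Omega> \<phi> x \<partial>lebesgue_on \<Omega>)"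
    unfolding H1_inner_def
    by (intro Bochner_Integration.integral_add L2_mult(1) L2_inner(1) H01_L2 assms)
  then have "H1_norm \<Omega> \<phi> = sqrt ((\<integral>x. (norm (\<phi> x))\<^sup>2 \<partial>lebesgue_on \<Omega>) + (\<integral>x. (norm (weak_gradient \<Omega> \<phi> x))\<^sup>2 \<partial>lebesgue_on \<Omega>))"
    by (simp add: H1_norm_def dot_square_norm power2_eq_square)
  moreover have "0 \<le> (\<integral>x. (norm (\<phi> x))\<^sup>2 \<partial>lebesgue_on \<Omega>)" "0 \<le> (\<integral>x. (norm (weak_gradient \<Omega> \<phi> x))\<^sup>2 \<partial>lebesgue_on \<Omega>)"
    by simp_all
  ultimately show "L2_norm \<Omega> \<phi> \<le> H1_norm \<Omega> \<phi>" "L2_norm \<Omega> (weak_gradient \<Omega> \<phi>) \<le> H1_norm \<Omega> \<phi>"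
    unfolding L2_norm_def by (auto intro!: real_sqrt_le_mono)
qed

lemma op_app_in_Hm1:
  assumes \<Omega>: "open \<Omega>" and L: "elliptic \<Omega> L" and v: "v \<in> H01 \<Omega>"
  shows "op_app \<Omega> L v \<in> Hm1 \<Omega>"
proof -
  have "\<bar>op_app \<Omega> L v \<phi>\<bar> \<le> (L2_norm \<Omega> (flux \<Omega> L v) + L2_norm \<Omega> (lower_order \<Omega> L v)) * H1_norm \<Omega> \<phi>"
    if \<phi>: "\<phi> \<in> H01 \<Omega>" for \<phi>
  proof -
    have "\<bar>op_app \<Omega> L v \<phi>\<bar> \<le> \<bar>\<integral>x. flux \<Omega> L v x \<bullet> weak_gradient \<Omega> \<phi> x \<partial>lebesgue_on \<Omega>\<bar> + \<bar>pairing \<Omega> (lower_order \<Omega> L v) \<phi>\<bar>"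
      unfolding op_app_eq[OF L v \<phi>] by (rule abs_triangle_ineq)
    also have "\<dots> \<le> L2_norm \<Omega> (flux \<Omega> L v) * L2_norm \<Omega> (weak_gradient \<Omega> \<phi>) + L2_norm \<Omega> (lower_order \<Omega> L v) * L2_norm \<Omega> \<phi>"
      by (intro add_mono L2_inner(2) L2_mult(2) flux_L2[OF L v] H01_L2[OF \<phi>])
    also have "\<dots> \<le> L2_norm \<Omega> (flux \<Omega> L v) * H1_norm \<Omega> \<phi> + L2_norm \<Omega> (lower_order \<Omega> L v) * H1_norm \<Omega> \<phi>"
      by (intro add_mono mult_left_mono L2_norms_le_H1_norm[OF \<phi>] L2_norm_nonneg)
    finally show ?thesis by (simp add: algebra_simps)
  qed
  then show ?thesis
    unfolding Hm1_def using op_app_lincomb_right[OF \<Omega> L v] by blast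
qed

lemma pairing_in_Hm1:
  assumes "g \<in> L2_space \<Omega>"
  shows "pairing \<Omega> g \<in> Hm1 \<Omega>"
proof -
  have "\<bar>pairing \<Omega> g \<phi>\<bar> \<le> L2_norm \<Omega> g * H1_norm \<Omega> \<phi>" if \<phi>: "\<phi> \<in> H01 \<Omega>" for \<phi>
    using order_trans[OF L2_mult(2)[OF assms H01_L2(1)[OF \<phi>]] mult_left_mono[OF L2_norms_le_H1_norm(1)[OF \<phi>] L2_norm_nonneg]] .
  then show ?thesis
    unfolding Hm1_def using pairing_lincomb(1)[OF assms H01_L2(1) H01_L2(1)] by blast
qed

lemma Hm1_lincomb:
  assumes "F \<in> Hm1 \<Omega>" "G \<in> Hm1 \<Omega>"
  shows "(\<lambda>\<phi>. a * F \<phi> + b * G \<phi>) \<in> Hm1 \<Omega>"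
proof -
  obtain C D where C: "\<And>\<phi>. \<phi> \<in> H01 \<Omega> \<Longrightarrow> \<bar>F \<phi>\<bar> \<le> C * H1_norm \<Omega> \<phi>" "\<And>\<phi>. \<phi> \<in> H01 \<Omega> \<Longrightarrow> \<bar>G \<phi>\<bar> \<le> D * H1_norm \<Omega> \<phi>"
    using assms unfolding Hm1_def by blast
  have "\<bar>a * F \<phi> + b * G \<phi>\<bar> \<le> (\<bar>a\<bar> * C + \<bar>b\<bar> * D) * H1_norm \<Omega> \<phi>" if \<phi>: "\<phi> \<in> H01 \<Omega>" for \<phi>
  proof -
    have "\<bar>a * F \<phi> + b * G \<phi>\<bar> \<le> \<bar>a\<bar> * \<bar>F \<phi>\<bar> + \<bar>b\<bar> * \<bar>G \<phi>\<bar>"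
      by (metis abs_mult abs_triangle_ineq)
    also have "\<dots> \<le> \<bar>a\<bar> * (C * H1_norm \<Omega> \<phi>) + \<bar>b\<bar> * (D * H1_norm \<Omega> \<phi>)"
      by (intro add_mono mult_left_mono C \<phi>) auto
    finally show ?thesis by (simp add: algebra_simps)
  qed
  moreover have "a * F (\<lambda>x. c * \<phi> x + d * \<rho> x) + b * G (\<lambda>x. c * \<phi> x + d * \<rho> x)
      = c * (a * F \<phi> + b * G \<phi>) + d * (a * F \<rho> + b * G \<rho>)" if "\<phi> \<in> H01 \<Omega>" "\<rho> \<in> H01 \<Omega>" for \<phi> \<rho> c d
    using assms that by (simp add: Hm1_def algebra_simps)
  ultimately show ?thesis unfolding Hm1_def by blast
qed

text \<open>Elements of \<open>H\<^sup>-\<^sup>1(\<Omega>)\<close> are functionals on equivalence classes.\<close>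

lemma Hm1_cong_AE:
  assumes \<Omega>: "open \<Omega>" and F: "F \<in> Hm1 \<Omega>" and \<phi>: "\<phi> \<in> H01 \<Omega>" and \<rho>: "\<rho> \<in> H01 \<Omega>"
    and eq: "AE x in lebesgue_on \<Omega>. \<phi> x = \<rho> x"
  shows "F \<phi> = F \<rho>"
proof -
  let ?d = "\<lambda>x. 1 * \<phi> x + (-1) * \<rho> x"
  have d: "?d \<in> H01 \<Omega>" by (rule H01_lincomb[OF \<Omega> \<phi> \<rho>])
  have "AE x in lebesgue_on \<Omega>. ?d x = 0" using eq by eventually_elim simp
  moreover from H01_gradient_of_null_function[OF \<Omega> weak_gradient_works[OF d] this]
  have "AE x in lebesgue_on \<Omega>. weak_gradient \<Omega> ?d x = 0" .
  ultimately have "AE x in lebesgue_on \<Omega>. ?d x * ?d x + weak_gradient \<Omega> ?d x \<bullet> weak_gradient \<Omega> ?d x = 0"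
    by eventually_elim simp
  then have "H1_inner \<Omega> ?d ?d = 0"
    unfolding H1_inner_def by (rule integral_eq_zero_AE)
  then have "H1_norm \<Omega> ?d = 0" by (simp add: H1_norm_def)
  moreover obtain C where "\<bar>F ?d\<bar> \<le> C * H1_norm \<Omega> ?d" using F d unfolding Hm1_def by blast
  moreover have "F ?d = 1 * F \<phi> + (-1) * F \<rho>" using F \<phi> \<rho> unfolding Hm1_def by blast
  ultimately show ?thesis by simp
qed

section \<open>Duality between integrable and bounded functions\<close>

text \<open>The inequality holds for every \<open>g\<close>: the norm of a non-measurable function is \<open>\<infinity>\<close>, and the pairing
  is \<open>0\<close> if the product is not integrable.\<close>

lemma pairing_le_Linf_L1:
  assumes v: "v \<in> L1_space \<Omega>"
  shows "ennreal \<bar>pairing \<Omega> g v\<bar> \<le> Linf_norm \<Omega> g * L1_norm \<Omega> v"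
proof (cases "integrable (lebesgue_on \<Omega>) (\<lambda>x. g x * v x)")
  case True
  have [measurable]: "v \<in> borel_measurable (lebesgue_on \<Omega>)" using v by (auto simp: L1_space_def)
  have "ennreal \<bar>pairing \<Omega> g v\<bar> \<le> (\<integral>\<^sup>+x. ennreal (norm (g x * v x)) \<partial>lebesgue_on \<Omega>)"
    using integral_norm_bound_ennreal[OF True] by (simp add: pairing_def)
  also have "\<dots> \<le> (\<integral>\<^sup>+x. Linf_norm \<Omega> g * ennreal \<bar>v x\<bar> \<partial>lebesgue_on \<Omega>)"
  proof (rule nn_integral_mono_AE)
    have "AE x in lebesgue_on \<Omega>. ennreal \<bar>g x\<bar> \<le> Linf_norm \<Omega> g"
      unfolding Linf_norm_def by (rule esssup_AE)
    then show "AE x in lebesgue_on \<Omega>. ennreal (norm (g x * v x)) \<le> Linf_norm \<Omega> g * ennreal \<bar>v x\<bar>"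
      by eventually_elim (simp add: abs_mult ennreal_mult mult_right_mono)
  qed
  also have "\<dots> = Linf_norm \<Omega> g * L1_norm \<Omega> v"
    unfolding L1_norm_def by (rule nn_integral_cmult) simp
  finally show ?thesis .
next
  case False
  then show ?thesis by (simp add: pairing_def not_integrable_integral_eq)
qed

lemma integrable_bounded_mult:
  assumes g: "g \<in> borel_measurable (lebesgue_on \<Omega>)" "Linf_norm \<Omega> g < \<infinity>" and v: "v \<in> L1_space \<Omega>"
  shows "integrable (lebesgue_on \<Omega>) (\<lambda>x. g x * v x)"
proof -
  have vi: "integrable (lebesgue_on \<Omega>) v" using v by (simp add: L1_space_def)
  then have [measurable]: "v \<in> borel_measurable (lebesgue_on \<Omega>)" by simp
  note g(1)[measurable]
  obtain C where C: "0 \<le> C" "Linf_norm \<Omega> g = ennreal C" using g(2) by (cases "Linf_norm \<Omega> g") auto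
  have "AE x in lebesgue_on \<Omega>. ennreal \<bar>g x\<bar> \<le> ennreal C"
    using esssup_AE[of "\<lambda>x. ennreal \<bar>g x\<bar>" "lebesgue_on \<Omega>"] C(2) by (simp add: Linf_norm_def)
  then have AE: "AE x in lebesgue_on \<Omega>. norm (g x * v x) \<le> norm (C * v x)"
    by eventually_elim (use C(1) in \<open>simp add: abs_mult mult_right_mono\<close>)
  show ?thesis
    by (rule Bochner_Integration.integrable_bound[OF integrable_mult_right[OF vi] _ AE]) simp
qed

text \<open>Pairing with a bounded function is a continuous functional on \<open>L\<^sub>1(\<Omega>)\<close>, hence commutes with the
  derivative in time.\<close>

lemma L1_derivative_pairing:
  assumes g: "g \<in> borel_measurable (lebesgue_on \<Omega>)" "Linf_norm \<Omega> g < \<infinity>"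
    and v: "\<And>s. s > 0 \<Longrightarrow> v s \<in> L1_space \<Omega>" and v': "v' \<in> L1_space \<Omega>"
    and t: "t > 0" and d: "has_L1_derivative \<Omega> v v' t"
  shows "((\<lambda>s. pairing \<Omega> g (v s)) has_real_derivative pairing \<Omega> g v') (at t)"
proof -
  let ?e = "\<lambda>h y. (v (t + h) y - v t y) / h - v' y"
  let ?E = "\<lambda>h. (pairing \<Omega> g (v (t + h)) - pairing \<Omega> g (v t)) / h - pairing \<Omega> g v'"
  have "((\<lambda>h. Linf_norm \<Omega> g * L1_norm \<Omega> (?e h)) \<longlongrightarrow> Linf_norm \<Omega> g * 0) (at 0)"
    using d g(2) unfolding has_L1_derivative_def by (intro ennreal_tendsto_cmult) auto
  then have lim: "((\<lambda>h. Linf_norm \<Omega> g * L1_norm \<Omega> (?e h)) \<longlongrightarrow> 0) (at 0)" by simp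
  have "eventually (\<lambda>h. dist h 0 < t) (at (0::real))"
    using t by (auto simp: eventually_at)
  then have "eventually (\<lambda>h. ennreal \<bar>?E h\<bar> \<le> Linf_norm \<Omega> g * L1_norm \<Omega> (?e h)) (at 0)"
  proof eventually_elim
    case (elim h)
    then have h: "t + h > 0" by (auto simp: dist_real_def)
    have i: "integrable (lebesgue_on \<Omega>) (v (t + h))" "integrable (lebesgue_on \<Omega>) (v t)" "integrable (lebesgue_on \<Omega>) v'"
      using v[OF h] v[OF t] v' by (auto simp: L1_space_def)
    note j = integrable_bounded_mult[OF g v[OF h]] integrable_bounded_mult[OF g v[OF t]] integrable_bounded_mult[OF g v']
    have "pairing \<Omega> g (?e h) = (\<integral>y. (g y * v (t + h) y - g y * v t y) / h - g y * v' y \<partial>lebesgue_on \<Omega>)"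
      unfolding pairing_def by (intro Bochner_Integration.integral_cong refl) (simp add: field_simps diff_divide_distrib)
    also have "\<dots> = ?E h" using j by (simp add: pairing_def)
    finally have "?E h = pairing \<Omega> g (?e h)" ..
    moreover have "?e h \<in> L1_space \<Omega>" using i by (simp add: L1_space_def)
    ultimately show ?case using pairing_le_Linf_L1[of "?e h" \<Omega> g] by simp
  qed
  then have "((\<lambda>h. ennreal \<bar>?E h\<bar>) \<longlongrightarrow> 0) (at 0)"
    by (intro tendsto_sandwich[OF _ _ tendsto_const lim]) auto
  then have "((\<lambda>h. ennreal \<bar>?E h\<bar>) \<longlongrightarrow> ennreal 0) (at 0)" unfolding ennreal_0 .
  from tendsto_ennreal_iff[THEN iffD1, OF _ _ this] have "((\<lambda>h. \<bar>?E h\<bar>) \<longlongrightarrow> 0) (at 0)" by (simp only: abs_ge_zero eventually_True order_refl simp_thms)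
  from LIM_zero_cancel[OF tendsto_rabs_zero_cancel[OF this]] show ?thesis unfolding DERIV_def .
qed

section \<open>Integrals against the derivative of a bubble function\<close>

lemma absolutely_integrable_closed_interval_iff:
  fixes f :: "real \<Rightarrow> real"
  shows "f absolutely_integrable_on {a..b} \<longleftrightarrow> f absolutely_integrable_on {a<..<b}"
  by (rule absolutely_integrable_spike_set_eq; rule negligible_subset[of "{a, b}"]) auto

lemma integral_closed_interval_eq_open:
  fixes f :: "real \<Rightarrow> real"
  shows "integral {a..b} f = integral {a<..<b} f"
  by (rule integral_spike_set; rule negligible_subset[of "{a, b}"]) auto

lemma continuous_bounded_absolutely_integrable:
  fixes f :: "real \<Rightarrow> real"
  assumes "continuous_on {a<..<b} f" "\<And>s. s \<in> {a<..<b} \<Longrightarrow> \<bar>f s\<bar> \<le> B"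
  shows "f absolutely_integrable_on {a..b}"
  unfolding absolutely_integrable_closed_interval_iff
proof (rule measurable_bounded_by_integrable_imp_absolutely_integrable)
  show "f \<in> borel_measurable (lebesgue_on {a<..<b})"
    by (rule continuous_imp_measurable_on_sets_lebesgue[OF assms(1)]) simp
  show "(\<lambda>_. B) integrable_on {a<..<b}"
    using integrable_const_ivl[of B a b] by (simp add: integrable_on_open_interval_real)
qed (use assms(2) in auto)

text \<open>The factor \<open>(a + b) / 2 - s\<close> is the derivative of the bubble \<open>(b - s) (s - a) / 2\<close>, which vanishes
  at both ends of the interval.  Integration by parts therefore produces no boundary terms, even if \<open>h\<close>
  has no limit there, and exchanges a bound on \<open>h\<close> for a bound on \<open>h'\<close>.  The bound \<open>D\<close> may be singular
  at the ends as long as its product with the bubble is integrable.\<close>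

lemma bubble_integration_by_parts:
  fixes h h' D :: "real \<Rightarrow> real"
  assumes ab: "a < b"
    and d: "\<And>s. s \<in> {a<..<b} \<Longrightarrow> (h has_real_derivative h' s) (at s)"
    and h: "\<And>s. s \<in> {a<..<b} \<Longrightarrow> \<bar>h s\<bar> \<le> K"
    and h': "\<And>s. s \<in> {a<..<b} \<Longrightarrow> \<bar>h' s\<bar> \<le> D s"
    and D: "(\<lambda>s. (b - s) * (s - a) / 2 * D s) integrable_on {a..b}"
  shows "(\<lambda>s. ((a + b) / 2 - s) * h s) absolutely_integrable_on {a..b}"
    and "\<bar>integral {a..b} (\<lambda>s. ((a + b) / 2 - s) * h s)\<bar> \<le> K * integral {a..b} (\<lambda>s. \<bar>(a + b) / 2 - s\<bar>)"
    and "\<bar>integral {a..b} (\<lambda>s. ((a + b) / 2 - s) * h s)\<bar> \<le> integral {a..b} (\<lambda>s. (b - s) * (s - a) / 2 * D s)"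
proof -
  let ?m = "\<lambda>s. ((a + b) / 2 - s) * h s"
  have K: "0 \<le> K" using h[of "(a + b) / 2"] ab by auto
  have hc: "continuous_on {a<..<b} h"
    by (rule DERIV_continuous_on[OF has_field_derivative_at_within[OF d]])
  have mb: "\<bar>?m s\<bar> \<le> K * \<bar>(a + b) / 2 - s\<bar>" if "s \<in> {a<..<b}" for s
    using mult_left_mono[OF h[OF that], of "\<bar>(a + b) / 2 - s\<bar>"] by (simp add: abs_mult mult.commute)
  show m: "?m absolutely_integrable_on {a..b}"
  proof (rule continuous_bounded_absolutely_integrable)
    show "continuous_on {a<..<b} ?m" by (intro continuous_intros hc)
    show "\<bar>?m s\<bar> \<le> K * (b - a)" if "s \<in> {a<..<b}" for s
    proof (rule order_trans[OF mb[OF that] mult_left_mono[OF _ K]])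
      have "a < s" "s < b" using that by auto
      then show "\<bar>(a + b) / 2 - s\<bar> \<le> b - a" by (auto simp: field_simps abs_if)
    qed
  qed
  have mi: "?m integrable_on {a..b}" using m by (simp add: absolutely_integrable_on_def)
  have "norm (integral {a<..<b} ?m) \<le> integral {a<..<b} (\<lambda>s. K * \<bar>(a + b) / 2 - s\<bar>)"
  proof (rule integral_norm_bound_integral)
    show "?m integrable_on {a<..<b}" using mi by (simp add: integrable_on_open_interval_real)
    have "(\<lambda>s. K * \<bar>(a + b) / 2 - s\<bar>) integrable_on {a..b}"
      by (intro integrable_continuous_real continuous_intros)
    then show "(\<lambda>s. K * \<bar>(a + b) / 2 - s\<bar>) integrable_on {a<..<b}" by (simp add: integrable_on_open_interval_real)
  qed (use mb in auto)
  then show "\<bar>integral {a..b} ?m\<bar> \<le> K * integral {a..b} (\<lambda>s. \<bar>(a + b) / 2 - s\<bar>)"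
    by (simp add: integral_closed_interval_eq_open)
  \<comment> \<open>The product \<open>P\<close> of the bubble and \<open>h\<close>, extended by \<open>0\<close> to the ends, is continuous since \<open>h\<close> is bounded.\<close>
  define p where "p s = (b - s) * (s - a) / 2" for s
  define P where "P s = (if s \<in> {a<..<b} then p s * h s else 0)" for s
  have p0: "0 \<le> p s" if "s \<in> {a..b}" for s using that by (auto simp: p_def)
  have Pb: "\<bar>P s\<bar> \<le> K * p s" if "s \<in> {a..b}" for s
    using that p0[OF that] h[of s] K mult_left_mono[of "\<bar>h s\<bar>" K "p s"] by (auto simp: P_def abs_mult mult.commute)
  have Pd: "(P has_real_derivative ?m s + p s * h' s) (at s)" if s: "s \<in> {a<..<b}" for s
  proof -
    have "((\<lambda>s. p s * h s) has_real_derivative ?m s + p s * h' s) (at s)"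
      unfolding p_def by (auto intro!: derivative_eq_intros d[OF s] simp: field_simps)
    then show ?thesis
      by (rule has_field_derivative_transform_within_open[of _ _ _ "{a<..<b}"]) (use s in \<open>auto simp: P_def\<close>)
  qed
  have Pc: "continuous_on {a..b} P"
    unfolding continuous_on_eq_continuous_within
  proof
    fix s assume s: "s \<in> {a..b}"
    show "continuous (at s within {a..b}) P"
    proof (cases "s \<in> {a<..<b}")
      case True
      then show ?thesis using DERIV_isCont[OF Pd[OF True]] continuous_at_imp_continuous_at_within by blast
    next
      case False
      with s have sab: "s = a \<or> s = b" by auto
      then have Ps: "P s = 0" "p s = 0" by (auto simp: P_def p_def)
      have "((\<lambda>r. K * p r) \<longlongrightarrow> K * p s) (at s within {a..b})"
        unfolding p_def by (intro tendsto_intros) simp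
      then have lim: "((\<lambda>r. K * p r) \<longlongrightarrow> 0) (at s within {a..b})" by (simp add: Ps)
      have "((\<lambda>r. \<bar>P r\<bar>) \<longlongrightarrow> 0) (at s within {a..b})"
        by (rule tendsto_sandwich[OF _ _ tendsto_const lim]) (use Pb in \<open>auto simp: eventually_at_topological\<close>)
      then show ?thesis using tendsto_rabs_zero_cancel by (auto simp: continuous_within Ps)
    qed
  qed
  have "((\<lambda>s. ?m s + p s * h' s) has_integral P b - P a) {a..b}"
    using Pd by (intro fundamental_theorem_of_calculus_interior Pc) (auto simp: ab less_imp_le has_real_derivative_iff_has_vector_derivative)
  then have tot: "((\<lambda>s. ?m s + p s * h' s) has_integral 0) {a..b}" by (simp add: P_def)
  from has_integral_diff[OF this integrable_integral[OF mi]]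
  have ph: "((\<lambda>s. p s * h' s) has_integral - integral {a..b} ?m) {a..b}" by simp
  have "norm (integral {a..b} (\<lambda>s. p s * h' s)) \<le> integral {a..b} (\<lambda>s. p s * D s)"
  proof (rule integral_norm_bound_integral)
    show "(\<lambda>s. p s * h' s) integrable_on {a..b}" by (rule has_integral_integrable[OF ph])
    show "(\<lambda>s. p s * D s) integrable_on {a..b}" using D by (simp add: p_def)
    fix s assume s: "s \<in> {a..b}"
    show "norm (p s * h' s) \<le> p s * D s"
    proof (cases "s \<in> {a<..<b}")
      case True
      then show ?thesis using h'[OF True] p0[OF s] by (simp add: abs_mult mult_left_mono)
    next
      case False
      then have "p s = 0" using s by (auto simp: p_def)
      then show ?thesis by simp
    qed
  qed
  then show "\<bar>integral {a..b} ?m\<bar> \<le> integral {a..b} (\<lambda>s. (b - s) * (s - a) / 2 * D s)"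
    using integral_unique[OF ph] by (simp add: p_def)
qed

text \<open>This will be used with \<open>F\<close> the norm of a function of time, whose measurability is not known.  As
  pulling a constant out of an integral needs a measurable integrand, \<open>c\<close> is moved to the side of \<open>h\<close>.\<close>

lemma nn_integral_le_cmult:
  assumes [measurable]: "h \<in> borel_measurable M" and c: "c < \<infinity>" and le: "\<And>x. x \<in> space M \<Longrightarrow> h x \<le> c * F x"
  shows "(\<integral>\<^sup>+x. h x \<partial>M) \<le> c * (\<integral>\<^sup>+x. F x \<partial>M)"
proof (cases "c = 0")
  case True
  then have "(\<integral>\<^sup>+x. h x \<partial>M) = (\<integral>\<^sup>+x. 0 \<partial>M)" using le by (intro nn_integral_cong) auto
  then show ?thesis by simp
next
  case False
  then have inv: "c * inverse c = 1"
    using c ennreal_divide_self[of c] by (simp add: divide_ennreal_def)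
  have "inverse c * (\<integral>\<^sup>+x. h x \<partial>M) = (\<integral>\<^sup>+x. inverse c * h x \<partial>M)"
    by (rule nn_integral_cmult[symmetric]) simp
  also have "\<dots> \<le> (\<integral>\<^sup>+x. F x \<partial>M)"
  proof (rule nn_integral_mono)
    fix x assume "x \<in> space M"
    then have "inverse c * h x \<le> inverse c * (c * F x)" by (intro mult_left_mono le) auto
    also have "\<dots> = F x" using inv by (simp add: mult.assoc[symmetric] mult.commute[of _ c])
    finally show "inverse c * h x \<le> F x" .
  qed
  finally have "c * (inverse c * (\<integral>\<^sup>+x. h x \<partial>M)) \<le> c * (\<integral>\<^sup>+x. F x \<partial>M)" by (rule mult_left_mono) simp
  then show ?thesis by (simp add: mult.assoc[symmetric] inv)
qed

text \<open>Triangle inequality for an integrand that is split into an integrable part \<open>m\<close> and a remainder.\<close>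

lemma ennreal_integral_split_le:
  fixes f m r :: "real \<Rightarrow> real"
  assumes f: "f absolutely_integrable_on {a..b}" and m: "m absolutely_integrable_on {a..b}"
    and eq: "\<And>s. s \<in> {a<..<b} \<Longrightarrow> f s = r s + m s"
  shows "r \<in> borel_measurable (lebesgue_on {a<..<b})"
    and "ennreal \<bar>integral {a..b} f\<bar> \<le> (\<integral>\<^sup>+s. ennreal \<bar>r s\<bar> \<partial>lebesgue_on {a<..<b}) + ennreal \<bar>integral {a..b} m\<bar>"
proof -
  have i: "integrable (lebesgue_on {a<..<b}) f" "integrable (lebesgue_on {a<..<b}) m"
    using f m unfolding absolutely_integrable_closed_interval_iff
    by (simp_all add: integrable_restrict_space set_integrable_def)
  have "integrable (lebesgue_on {a<..<b}) (\<lambda>s. f s - m s)" using i by simp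
  also have "?this \<longleftrightarrow> integrable (lebesgue_on {a<..<b}) r"
    by (rule Bochner_Integration.integrable_cong) (auto simp: eq)
  finally have r: "integrable (lebesgue_on {a<..<b}) r" .
  then show "r \<in> borel_measurable (lebesgue_on {a<..<b})" by simp
  have eqi: "integral {a..b} k = (\<integral>s. k s \<partial>lebesgue_on {a<..<b})" if "k absolutely_integrable_on {a..b}" for k :: "real \<Rightarrow> real"
    using that set_lebesgue_integral_eq_integral(2)[of "{a<..<b}" k]
    unfolding absolutely_integrable_closed_interval_iff integral_closed_interval_eq_open
    by (simp add: set_lebesgue_integral_def integral_restrict_space)
  have "integral {a..b} f = (\<integral>s. r s + m s \<partial>lebesgue_on {a<..<b})"
    unfolding eqi[OF f] by (rule Bochner_Integration.integral_cong) (auto simp: eq)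
  also have "\<dots> = (\<integral>s. r s \<partial>lebesgue_on {a<..<b}) + integral {a..b} m"
    using r i by (simp add: eqi[OF m])
  finally have "\<bar>integral {a..b} f\<bar> \<le> \<bar>\<integral>s. r s \<partial>lebesgue_on {a<..<b}\<bar> + \<bar>integral {a..b} m\<bar>" by simp
  then have "ennreal \<bar>integral {a..b} f\<bar> \<le> ennreal \<bar>\<integral>s. r s \<partial>lebesgue_on {a<..<b}\<bar> + ennreal \<bar>integral {a..b} m\<bar>"
    by (simp add: ennreal_leI flip: ennreal_plus)
  also have "\<dots> \<le> (\<integral>\<^sup>+s. ennreal \<bar>r s\<bar> \<partial>lebesgue_on {a<..<b}) + ennreal \<bar>integral {a..b} m\<bar>"
    using integral_norm_bound_ennreal[OF r] by (intro add_right_mono) simp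
  finally show "ennreal \<bar>integral {a..b} f\<bar> \<le> (\<integral>\<^sup>+s. ennreal \<bar>r s\<bar> \<partial>lebesgue_on {a<..<b}) + ennreal \<bar>integral {a..b} m\<bar>" .
qed

section \<open>The Green's function against bounded functions\<close>

lemma green_functionD:
  assumes "green_function \<Omega> L dG" "x \<in> \<Omega>" "s > 0"
  shows "p \<le> 2 \<Longrightarrow> dG p x s \<in> L1_space \<Omega>" "p < 2 \<Longrightarrow> has_L1_derivative \<Omega> (dG p x) (dG (Suc p) x s) s"
    "dG 0 x s \<in> H01 \<Omega>"
  using assms by (auto simp: green_function_def time_derivatives_def)

lemma green_boundsD:
  assumes "green_bounds \<Omega> dG T \<kappa> \<kappa>' \<gamma>"
  shows "p \<le> 2 \<Longrightarrow> 0 \<le> \<kappa> p" "p \<le> 2 \<Longrightarrow> 0 \<le> \<kappa>' p" "\<kappa>' 0 = 0" "0 \<le> \<gamma>"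
    "x \<in> \<Omega> \<Longrightarrow> s \<in> {0<..T} \<Longrightarrow> p \<le> 2 \<Longrightarrow>
      L1_norm \<Omega> (dG p x s) \<le> ennreal ((\<kappa> p / s ^ p + \<kappa>' p) * exp (- \<gamma> * s))"
  using assms by (auto simp: green_bounds_def)

text \<open>The weight \<open>e\<^sup>-\<^sup>\<gamma>\<^sup>s\<close> is replaced by its value at an earlier time \<open>r\<close>.  With \<open>s\<close> the distance of a
  point of a mesh interval to the final time and \<open>r\<close> that of the right end of the interval, this is
  what makes the weight of the estimator constant on each mesh interval.\<close>

lemma green_pairing_le:
  assumes green: "green_function \<Omega> L dG" and bounds: "green_bounds \<Omega> dG T \<kappa> \<kappa>' \<gamma>"
    and x: "x \<in> \<Omega>" and s: "s \<in> {0<..T}" and r: "r \<le> s" and p: "p \<le> 2"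
  shows "ennreal \<bar>pairing \<Omega> g (dG p x s)\<bar> \<le> ennreal ((\<kappa> p / s ^ p + \<kappa>' p) * exp (- \<gamma> * r)) * Linf_norm \<Omega> g"
proof -
  have s0: "s > 0" using s by simp
  have "exp (- \<gamma> * s) \<le> exp (- \<gamma> * r)"
    using green_boundsD(4)[OF bounds] r by (simp add: mult_left_mono)
  then have "(\<kappa> p / s ^ p + \<kappa>' p) * exp (- \<gamma> * s) \<le> (\<kappa> p / s ^ p + \<kappa>' p) * exp (- \<gamma> * r)"
    using green_boundsD(1,2)[OF bounds p] s0 by (intro mult_left_mono) auto
  then have L1: "L1_norm \<Omega> (dG p x s) \<le> ennreal ((\<kappa> p / s ^ p + \<kappa>' p) * exp (- \<gamma> * r))"
    using order_trans[OF green_boundsD(5)[OF bounds x s p]] ennreal_leI by blast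
  have "ennreal \<bar>pairing \<Omega> g (dG p x s)\<bar> \<le> Linf_norm \<Omega> g * L1_norm \<Omega> (dG p x s)"
    by (rule pairing_le_Linf_L1[OF green_functionD(1)[OF green x s0 p]])
  also have "\<dots> \<le> Linf_norm \<Omega> g * ennreal ((\<kappa> p / s ^ p + \<kappa>' p) * exp (- \<gamma> * r))"
    by (rule mult_left_mono[OF L1]) simp
  finally show ?thesis by (simp only: mult.commute)
qed

lemma green_pairing_le_real:
  assumes green: "green_function \<Omega> L dG" and bounds: "green_bounds \<Omega> dG T \<kappa> \<kappa>' \<gamma>"
    and x: "x \<in> \<Omega>" and s: "s \<in> {0<..T}" and r: "r \<le> s" and p: "p \<le> 2"
    and N: "0 \<le> N" "Linf_norm \<Omega> g = ennreal N"
  shows "\<bar>pairing \<Omega> g (dG p x s)\<bar> \<le> (\<kappa> p / s ^ p + \<kappa>' p) * exp (- \<gamma> * r) * N"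
proof -
  have nn: "0 \<le> (\<kappa> p / s ^ p + \<kappa>' p) * exp (- \<gamma> * r)"
    using green_boundsD(1,2)[OF bounds p] s by (intro mult_nonneg_nonneg add_nonneg_nonneg) auto
  have "ennreal \<bar>pairing \<Omega> g (dG p x s)\<bar> \<le> ennreal ((\<kappa> p / s ^ p + \<kappa>' p) * exp (- \<gamma> * r) * N)"
    using green_pairing_le[OF green bounds x s r p, of g] nn N by (simp only: N(2) ennreal_mult)
  then show ?thesis using nn N by (subst (asm) ennreal_le_iff) auto
qed

lemma green_pairing_derivative:
  assumes green: "green_function \<Omega> L dG" and x: "x \<in> \<Omega>" and s: "s > 0"
    and g: "g \<in> borel_measurable (lebesgue_on \<Omega>)" "Linf_norm \<Omega> g < \<infinity>"
  shows "((\<lambda>s. pairing \<Omega> g (dG 0 x s)) has_real_derivative pairing \<Omega> g (dG 1 x s)) (at s)"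
  using green_functionD[OF green x] s
  by (intro L1_derivative_pairing[OF g]) force+

text \<open>If one of the two bounds on \<open>\<G>\<close> and \<open>\<partial>\<^sub>t\<G>\<close> vanishes, \<open>\<G>\<close> does not depend on time: testing
  with the sign of \<open>\<G>(t) - \<G>(t')\<close> gives a function of time with zero derivative.\<close>

lemma green_constant_in_time:
  assumes green: "green_function \<Omega> L dG" and bounds: "green_bounds \<Omega> dG T \<kappa> \<kappa>' \<gamma>"
    and x: "x \<in> \<Omega>" and zero: "\<kappa> 0 = 0 \<or> (\<kappa> 1 = 0 \<and> \<kappa>' 1 = 0)"
    and r: "r \<in> {0<..T}" and s: "s \<in> {0<..T}"
  shows "AE y in lebesgue_on \<Omega>. dG 0 x r y = dG 0 x s y"
proof -
  have L1: "dG 0 x r \<in> L1_space \<Omega>" "dG 0 x s \<in> L1_space \<Omega>"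
    using r s by (auto intro: green_functionD(1)[OF green x])
  then have i: "integrable (lebesgue_on \<Omega>) (dG 0 x r)" "integrable (lebesgue_on \<Omega>) (dG 0 x s)"
    by (auto simp: L1_space_def)
  note [measurable] = borel_measurable_integrable[OF i(1)] borel_measurable_integrable[OF i(2)]
  let ?g = "\<lambda>y. if dG 0 x r y \<ge> dG 0 x s y then 1 else - 1 :: real"
  have g: "?g \<in> borel_measurable (lebesgue_on \<Omega>)" by measurable
  have g1: "Linf_norm \<Omega> ?g \<le> ennreal 1"
    unfolding Linf_norm_def using g by (intro esssup_I AE_I2) auto
  have gfin: "Linf_norm \<Omega> ?g < \<infinity>" using g1 by (auto simp: less_top[symmetric] top_unique)
  obtain N where N: "0 \<le> N" "Linf_norm \<Omega> ?g = ennreal N" using gfin by (cases "Linf_norm \<Omega> ?g") auto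
  have eq: "pairing \<Omega> ?g (dG 0 x r) = pairing \<Omega> ?g (dG 0 x s)"
    using zero
  proof
    assume "\<kappa> 0 = 0"
    then show ?thesis
      using green_pairing_le_real[OF green bounds x r order_refl _ N, of 0]
        green_pairing_le_real[OF green bounds x s order_refl _ N, of 0] green_boundsD(3)[OF bounds] by simp
  next
    assume z: "\<kappa> 1 = 0 \<and> \<kappa>' 1 = 0"
    have d: "((\<lambda>s. pairing \<Omega> ?g (dG 0 x s)) has_real_derivative 0) (at \<xi>)" if "\<xi> \<in> {0<..T}" for \<xi>
      using green_pairing_derivative[OF green x _ g gfin, of \<xi>] that
        green_pairing_le_real[OF green bounds x that order_refl _ N, of 1] z by simp
    have const: "pairing \<Omega> ?g (dG 0 x a) = pairing \<Omega> ?g (dG 0 x b)" if "a < b" "0 < a" "b \<le> T" for a b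
    proof (rule DERIV_isconst_end[OF that(1), symmetric])
      show "continuous_on {a..b} (\<lambda>s. pairing \<Omega> ?g (dG 0 x s))"
        by (rule DERIV_continuous_on[OF has_field_derivative_at_within[OF d]]) (use that in auto)
      show "((\<lambda>s. pairing \<Omega> ?g (dG 0 x s)) has_real_derivative 0) (at \<xi>)" if "a < \<xi>" "\<xi> < b" for \<xi>
        using that \<open>0 < a\<close> \<open>b \<le> T\<close> by (intro d) auto
    qed
    show ?thesis using const[of r s] const[of s r] r s by (cases r s rule: linorder_cases) auto
  qed
  have "(\<integral>y. \<bar>dG 0 x r y - dG 0 x s y\<bar> \<partial>lebesgue_on \<Omega>) = (\<integral>y. ?g y * dG 0 x r y - ?g y * dG 0 x s y \<partial>lebesgue_on \<Omega>)"
    by (intro Bochner_Integration.integral_cong refl) auto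
  also have "\<dots> = pairing \<Omega> ?g (dG 0 x r) - pairing \<Omega> ?g (dG 0 x s)"
    unfolding pairing_def
    by (intro Bochner_Integration.integral_diff integrable_bounded_mult[OF g gfin] L1)
  finally have "(\<integral>y. \<bar>dG 0 x r y - dG 0 x s y\<bar> \<partial>lebesgue_on \<Omega>) = 0" using eq by simp
  then have "AE y in lebesgue_on \<Omega>. \<bar>dG 0 x r y - dG 0 x s y\<bar> = 0"
    using i by (subst (asm) integral_nonneg_eq_0_iff_AE) auto
  then show ?thesis by eventually_elim simp
qed

section \<open>The constants of the estimator\<close>

text \<open>In the last mesh interval \<open>b = T\<close>, and the singularity of the weight is compensated by the zero of
  the bubble.\<close>

lemma bubble_weight_integrable:
  fixes a b T :: real
  assumes "a < b" "b \<le> T"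
  shows "(\<lambda>s. (b - s) * (s - a) / (T - s)) integrable_on {a..b}"
proof (rule measurable_bounded_by_integrable_imp_integrable)
  have "(\<lambda>s. (b - s) * (s - a) / (T - s)) \<in> borel_measurable borel" by measurable
  then show "(\<lambda>s. (b - s) * (s - a) / (T - s)) \<in> borel_measurable (lebesgue_on {a..b})"
    by (intro measurable_restrict_space1) (simp add: measurable_completion)
  show "(\<lambda>_. b - a) integrable_on {a..b}" by (rule integrable_const_ivl)
  show "norm ((b - s) * (s - a) / (T - s)) \<le> b - a" if s: "s \<in> {a..b}" for s
  proof (cases "s = T")
    case False
    then have pos: "0 < T - s" using s assms by auto
    have "(b - s) * (s - a) \<le> (T - s) * (b - a)"
      using s assms by (intro mult_mono) auto
    with pos have "(b - s) * (s - a) / (T - s) \<le> b - a" by (simp add: pos_divide_le_eq mult.commute)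
    moreover have "0 \<le> (b - s) * (s - a) / (T - s)" using s pos by auto
    ultimately show ?thesis by (simp only: real_norm_def abs_of_nonneg)
  qed (use assms in simp)
qed simp

lemma bubble_has_integral:
  fixes a b :: real
  assumes "a < b"
  shows "((\<lambda>s. (b - s) * (s - a)) has_integral (b - a) ^ 3 / 6) {a..b}"
proof -
  let ?F = "\<lambda>s. (b - a) / 2 * (s - a)\<^sup>2 - 1 / 3 * (s - a) ^ 3"
  have "((\<lambda>s. (b - s) * (s - a)) has_integral ?F b - ?F a) {a..b}"
  proof (rule fundamental_theorem_of_calculus)
    show "(?F has_vector_derivative (b - s) * (s - a)) (at s within {a..b})" for s
      unfolding has_real_derivative_iff_has_vector_derivative[symmetric]
      by (auto intro!: derivative_eq_intros simp: power2_eq_square field_simps)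
  qed (use assms in simp)
  moreover have "?F b - ?F a = (b - a) ^ 3 / 6" by (simp add: power3_eq_cube power2_eq_square)
  ultimately show ?thesis by simp
qed

text \<open>A constant of the estimator vanishes only if the constants in the bound of the Green's function from
  which it comes do.  This decides what happens to a residual of infinite norm, since \<open>0 \<cdot> \<infinity> = 0\<close>.\<close>

lemma Phi1_nonneg_eq_0:
  assumes ab: "t (j - 1) < t j" "0 \<le> t (j - 1)" "t j \<le> T" and \<kappa>: "0 \<le> \<kappa>1" "0 \<le> \<kappa>1'"
  shows "0 \<le> Phi1 t T \<kappa>1 \<kappa>1' j" "Phi1 t T \<kappa>1 \<kappa>1' j = 0 \<Longrightarrow> \<kappa>1 = 0 \<and> \<kappa>1' = 0"
proof -
  let ?a = "t (j - 1)" and ?b = "t j"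
  let ?I = "integral {?a..?b} (\<lambda>s. (?b - s) * (s - ?a) / (T - s))"
  have T: "T > 0" using ab by simp
  have "integral {?a..?b} (\<lambda>s. (?b - s) * (s - ?a) / T) \<le> ?I"
  proof (rule integral_le)
    show "(\<lambda>s. (?b - s) * (s - ?a) / T) integrable_on {?a..?b}"
      by (intro integrable_continuous_real continuous_intros) (use T in auto)
    show "(\<lambda>s. (?b - s) * (s - ?a) / (T - s)) integrable_on {?a..?b}"
      by (rule bubble_weight_integrable[OF ab(1,3)])
    show "(?b - s) * (s - ?a) / T \<le> (?b - s) * (s - ?a) / (T - s)" if s: "s \<in> {?a..?b}" for s
    proof (cases "s = T")
      case True
      then have "?b - s = 0" using s ab by auto
      then show ?thesis by simp
    next
      case False
      with s ab have "0 < T - s" "T - s \<le> T" "0 \<le> (?b - s) * (s - ?a)" by auto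
      then show ?thesis by (intro divide_left_mono) auto
    qed
  qed
  moreover have "integral {?a..?b} (\<lambda>s. (?b - s) * (s - ?a) / T) = (?b - ?a) ^ 3 / 6 / T"
    by (rule integral_unique[OF has_integral_divide[OF bubble_has_integral[OF ab(1)]]])
  moreover have c: "0 < (?b - ?a) ^ 3 / 6" using ab by simp
  ultimately have I: "0 < ?I" using T by (smt (verit) divide_pos_pos)
  show "0 \<le> Phi1 t T \<kappa>1 \<kappa>1' j"
    unfolding Phi1_def tau_def using I c \<kappa> by (intro add_nonneg_nonneg mult_nonneg_nonneg) auto
  assume "Phi1 t T \<kappa>1 \<kappa>1' j = 0"
  then have "\<kappa>1 * ?I = 0 \<and> \<kappa>1' * ((?b - ?a) ^ 3 / 6) = 0"
    unfolding Phi1_def tau_def using I c \<kappa> add_nonneg_eq_0_iff[of "\<kappa>1 * ?I" "\<kappa>1' * ((?b - ?a) ^ 3 / 6)"] by simp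
  then show "\<kappa>1 = 0 \<and> \<kappa>1' = 0" using I c by auto
qed

text \<open>The derivative in the definition is twice the factor \<open>t\<^sub>j\<^sub>-\<^sub>1\<^sub>/\<^sub>2 - s\<close> of the residual.\<close>

lemma Phi1_star_eq:
  "Phi1_star t \<kappa>0 j = \<kappa>0 * (2 * integral {t (j - 1)..t j} (\<lambda>s. \<bar>(t (j - 1) + t j) / 2 - s\<bar>))"
proof -
  let ?a = "t (j - 1)" and ?b = "t j"
  have "((\<lambda>r. (?b - r) * (r - ?a)) has_real_derivative ?a + ?b - 2 * s) (at s)" for s
    by (auto intro!: derivative_eq_intros)
  then have "deriv (\<lambda>r. (?b - r) * (r - ?a)) s = ?a + ?b - 2 * s" for s
    by (rule DERIV_imp_deriv)
  moreover have "\<bar>?a + ?b - 2 * s\<bar> = 2 * \<bar>(?a + ?b) / 2 - s\<bar>" for s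
    by (simp add: abs_if field_simps)
  ultimately show ?thesis unfolding Phi1_star_def by simp
qed

lemma Phi1_star_nonneg_eq_0:
  assumes ab: "t (j - 1) < t j" and \<kappa>: "0 \<le> \<kappa>0"
  shows "0 \<le> Phi1_star t \<kappa>0 j" "Phi1_star t \<kappa>0 j = 0 \<Longrightarrow> \<kappa>0 = 0"
proof -
  let ?a = "t (j - 1)" and ?b = "t j"
  let ?I = "integral {?a..?b} (\<lambda>s. \<bar>(?a + ?b) / 2 - s\<bar>)"
  have c: "continuous_on {?a..?b} (\<lambda>s. \<bar>(?a + ?b) / 2 - s\<bar>)" by (intro continuous_intros)
  have "0 \<le> ?I" by (rule integral_nonneg[OF integrable_continuous_real[OF c]]) simp
  moreover have "?I \<noteq> 0"
  proof
    assume "?I = 0"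
    then have "\<forall>s\<in>{?a..?b}. \<bar>(?a + ?b) / 2 - s\<bar> = 0" using integral_eq_0_iff[OF c ab] by auto
    from bspec[OF this, of ?a] ab show False by simp
  qed
  ultimately have I: "0 < ?I" by simp
  show "0 \<le> Phi1_star t \<kappa>0 j" unfolding Phi1_star_eq using I \<kappa> by simp
  show "\<kappa>0 = 0" if "Phi1_star t \<kappa>0 j = 0" using that I unfolding Phi1_star_eq by auto
qed

section \<open>The residual on one mesh interval\<close>

text \<open>The two bounds of \<open>bubble_integration_by_parts\<close>, with \<open>h(s) = \<langle>g, \<G>(T - s)\<rangle>\<close>, give the two constants
  whose minimum is taken in the estimator.\<close>

lemma residual_integral_le:
  fixes t :: "nat \<Rightarrow> real" and j :: nat
  defines "a \<equiv> t (j - 1)" and "b \<equiv> t j"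
  assumes green: "green_function \<Omega> L dG" and bounds: "green_bounds \<Omega> dG T \<kappa> \<kappa>' \<gamma>" and x: "x \<in> \<Omega>"
    and ab: "0 \<le> a" "a < b" "b \<le> T"
    and g: "g \<in> borel_measurable (lebesgue_on \<Omega>)" and N: "0 \<le> N" "Linf_norm \<Omega> g = ennreal N"
  shows "(\<lambda>s. ((a + b) / 2 - s) * pairing \<Omega> g (dG 0 x (T - s))) absolutely_integrable_on {a..b}"
    and "\<bar>integral {a..b} (\<lambda>s. ((a + b) / 2 - s) * pairing \<Omega> g (dG 0 x (T - s)))\<bar>
      \<le> exp (- \<gamma> * (T - b)) * (Psi1 t T (\<kappa> 0) (\<kappa> 1) (\<kappa>' 1) j / 2) * N"
proof -
  let ?e = "exp (- \<gamma> * (T - b))"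
  let ?D = "\<lambda>s. (\<kappa> 1 / (T - s) + \<kappa>' 1) * ?e * N"
  let ?W = "\<lambda>s. (b - s) * (s - a) / (T - s)"
  have Ts: "T - s \<in> {0<..T}" "T - b \<le> T - s" if "s \<in> {a<..<b}" for s using that ab by auto
  have d: "((\<lambda>s. pairing \<Omega> g (dG 0 x (T - s))) has_real_derivative - pairing \<Omega> g (dG 1 x (T - s))) (at s)"
    if s: "s \<in> {a<..<b}" for s
  proof -
    have "((\<lambda>s. pairing \<Omega> g (dG 0 x (T - s))) has_real_derivative pairing \<Omega> g (dG 1 x (T - s)) * (-1)) (at s)"
      using Ts[OF s] N by (intro DERIV_chain2[OF green_pairing_derivative[OF green x _ g]]) (auto intro!: derivative_eq_intros)
    then show ?thesis by simp
  qed
  have h: "\<bar>pairing \<Omega> g (dG 0 x (T - s))\<bar> \<le> \<kappa> 0 * ?e * N" if s: "s \<in> {a<..<b}" for s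
    using green_pairing_le_real[OF green bounds x Ts[OF s] _ N, of 0] green_boundsD(3)[OF bounds] by simp
  have h': "\<bar>- pairing \<Omega> g (dG 1 x (T - s))\<bar> \<le> ?D s" if s: "s \<in> {a<..<b}" for s
    using green_pairing_le_real[OF green bounds x Ts[OF s] _ N, of 1] by simp
  have Weq: "(b - s) * (s - a) / 2 * ?D s = ?e * N / 2 * (\<kappa> 1 * ?W s + \<kappa>' 1 * ((b - s) * (s - a)))" for s
    unfolding divide_inverse by (simp only: ring_distribs mult_ac add_ac)
  have W: "((\<lambda>s. (b - s) * (s - a) / 2 * ?D s) has_integral ?e * N / 2 * Phi1 t T (\<kappa> 1) (\<kappa>' 1) j) {a..b}"
    unfolding Weq Phi1_def tau_def a_def[symmetric] b_def[symmetric]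
    by (intro has_integral_mult_right has_integral_add bubble_has_integral[OF ab(2)]
        integrable_integral bubble_weight_integrable[OF ab(2,3)])
  note ibp = bubble_integration_by_parts[OF ab(2) d h h' has_integral_integrable[OF W]]
  show "(\<lambda>s. ((a + b) / 2 - s) * pairing \<Omega> g (dG 0 x (T - s))) absolutely_integrable_on {a..b}"
    by (rule ibp(1))
  let ?X = "\<bar>integral {a..b} (\<lambda>s. ((a + b) / 2 - s) * pairing \<Omega> g (dG 0 x (T - s)))\<bar>"
  have "?X \<le> ?e * N / 2 * Phi1 t T (\<kappa> 1) (\<kappa>' 1) j"
    using ibp(3) unfolding integral_unique[OF W] .
  moreover have "?X \<le> ?e * N / 2 * Phi1_star t (\<kappa> 0) j"
    using ibp(2) unfolding Phi1_star_eq a_def[symmetric] b_def[symmetric] by (simp add: mult_ac)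
  ultimately show "?X \<le> ?e * (Psi1 t T (\<kappa> 0) (\<kappa> 1) (\<kappa>' 1) j / 2) * N"
    unfolding Psi1_def min_def by (auto simp: mult_ac)
qed

lemma le_cmult_Inf_ennreal:
  fixes c :: ennreal
  assumes c: "c \<noteq> 0" "c < \<infinity>" and le: "\<And>y. y \<in> S \<Longrightarrow> x \<le> c * y"
  shows "x \<le> c * Inf S"
proof -
  have inv: "c * inverse c = 1"
    using c ennreal_divide_self[of c] by (simp add: divide_ennreal_def)
  have "inverse c * x \<le> Inf S"
  proof (rule Inf_greatest)
    fix y assume "y \<in> S"
    then have "inverse c * x \<le> inverse c * (c * y)" by (intro mult_left_mono le) auto
    also have "\<dots> = y" using inv by (simp add: mult.assoc[symmetric] mult.commute[of _ c])
    finally show "inverse c * x \<le> y" .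
  qed
  then have "c * (inverse c * x) \<le> c * Inf S" by (rule mult_left_mono) simp
  then show ?thesis by (simp add: mult.assoc[symmetric] inv)
qed

text \<open>Contribution of one mesh interval to the error, for a source made of a function \<open>g\<close> and of a
  functional \<open>R\<close> multiplied by the derivative of the bubble.  The estimate holds also where no bounded
  function represents \<open>R\<close>, so that its norm is \<open>\<infinity>\<close>: if the constant of the estimator is positive, there
  is nothing to prove; if it vanishes, the Green's function is constant in time, and the derivative of
  the bubble has integral zero.\<close>

lemma interval_estimate:
  fixes t :: "nat \<Rightarrow> real" and j :: nat
  defines "a \<equiv> t (j - 1)" and "b \<equiv> t j"
  assumes \<Omega>: "open \<Omega>" and green: "green_function \<Omega> L dG" and bounds: "green_bounds \<Omega> dG T \<kappa> \<kappa>' \<gamma>" and x: "x \<in> \<Omega>"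
    and ab: "0 \<le> a" "a < b" "b \<le> T"
    and R: "R \<in> Hm1 \<Omega>" and F: "F absolutely_integrable_on {a..b}"
    and eq: "\<And>s. s \<in> {a<..<b} \<Longrightarrow>
      F s = pairing \<Omega> (g s) (dG 0 x (T - s)) + ((a + b) / 2 - s) * R (dG 0 x (T - s))"
  shows "ennreal \<bar>integral {a..b} F\<bar> \<le> ennreal (exp (- \<gamma> * (T - b))) *
    (ennreal (\<kappa> 0) * (\<integral>\<^sup>+s. Linf_norm \<Omega> (g s) \<partial>lebesgue_on {a<..<b})
      + ennreal (Psi1 t T (\<kappa> 0) (\<kappa> 1) (\<kappa>' 1) j / 2) * Hm1_Linf_norm \<Omega> R)"
proof -
  let ?e = "exp (- \<gamma> * (T - b))" and ?\<Psi> = "Psi1 t T (\<kappa> 0) (\<kappa> 1) (\<kappa>' 1) j"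
  let ?m = "\<lambda>s. ((a + b) / 2 - s) * R (dG 0 x (T - s))"
  let ?r = "\<lambda>s. pairing \<Omega> (g s) (dG 0 x (T - s))"
  let ?S = "{Linf_norm \<Omega> g | g. g \<in> borel_measurable (lebesgue_on \<Omega>) \<and> Linf_norm \<Omega> g < \<infinity> \<and>
     (\<forall>\<phi>\<in>H01 \<Omega> \<inter> L1_space \<Omega>. R \<phi> = pairing \<Omega> g \<phi>)}"
  have \<kappa>: "0 \<le> \<kappa> 0" "0 \<le> \<kappa> 1" "0 \<le> \<kappa>' 1" using green_boundsD(1,2)[OF bounds] by auto
  have Ts: "T - s \<in> {0<..T}" "T - b \<le> T - s" if "s \<in> {a<..<b}" for s using that ab by auto
  have G: "dG 0 x (T - s) \<in> H01 \<Omega>" "dG 0 x (T - s) \<in> L1_space \<Omega>" if "s \<in> {a<..<b}" for s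
    using Ts[OF that] green_functionD[OF green x, of "T - s"] by auto
  have \<Phi>: "0 \<le> Phi1 t T (\<kappa> 1) (\<kappa>' 1) j" "Phi1 t T (\<kappa> 1) (\<kappa>' 1) j = 0 \<Longrightarrow> \<kappa> 1 = 0 \<and> \<kappa>' 1 = 0"
    "0 \<le> Phi1_star t (\<kappa> 0) j" "Phi1_star t (\<kappa> 0) j = 0 \<Longrightarrow> \<kappa> 0 = 0"
    using Phi1_nonneg_eq_0[of t j T "\<kappa> 1" "\<kappa>' 1"] Phi1_star_nonneg_eq_0[of t j "\<kappa> 0"] ab \<kappa>
    unfolding a_def b_def by auto
  then have \<Psi>: "0 \<le> ?\<Psi>" by (simp add: Psi1_def)
  have split: "ennreal \<bar>integral {a..b} F\<bar> \<le> ennreal ?e * (ennreal (\<kappa> 0) * (\<integral>\<^sup>+s. Linf_norm \<Omega> (g s) \<partial>lebesgue_on {a<..<b}))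
      + ennreal \<bar>integral {a..b} ?m\<bar>" if m: "?m absolutely_integrable_on {a..b}"
  proof -
    note sp = ennreal_integral_split_le[OF F m eq]
    have "(\<integral>\<^sup>+s. ennreal \<bar>?r s\<bar> \<partial>lebesgue_on {a<..<b})
        \<le> ennreal (?e * \<kappa> 0) * (\<integral>\<^sup>+s. Linf_norm \<Omega> (g s) \<partial>lebesgue_on {a<..<b})"
    proof (rule nn_integral_le_cmult)
      show "(\<lambda>s. ennreal \<bar>?r s\<bar>) \<in> borel_measurable (lebesgue_on {a<..<b})" using sp(1) by simp
      fix s assume "s \<in> space (lebesgue_on {a<..<b})"
      then have s: "s \<in> {a<..<b}" by simp
      show "ennreal \<bar>?r s\<bar> \<le> ennreal (?e * \<kappa> 0) * Linf_norm \<Omega> (g s)"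
        using green_pairing_le[OF green bounds x Ts[OF s], of 0 "g s"] green_boundsD(3)[OF bounds]
        by (simp add: mult.commute)
    qed simp
    moreover have "ennreal (?e * \<kappa> 0) = ennreal ?e * ennreal (\<kappa> 0)" using \<kappa> by (simp add: ennreal_mult)
    ultimately show ?thesis using order_trans[OF sp(2) add_right_mono] by (simp add: mult.assoc)
  qed
  consider (const) "?\<Psi> = 0" | (repr) "?\<Psi> \<noteq> 0" "?S \<noteq> {}" | (infinite) "?\<Psi> \<noteq> 0" "?S = {}" by blast
  then show ?thesis
  proof cases
    case const
    then have "\<kappa> 0 = 0 \<or> (\<kappa> 1 = 0 \<and> \<kappa>' 1 = 0)"
      using \<Phi> by (auto simp: Psi1_def min_def split: if_splits)
    note AE = green_constant_in_time[OF green bounds x this]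
    \<comment> \<open>The value of \<open>R\<close> on the Green's function does not depend on time; the midpoint is as good as any other
      interior time.\<close>
    let ?c = "R (dG 0 x (T - (a + b) / 2))"
    have mid: "(a + b) / 2 \<in> {a<..<b}" using ab by simp
    have eqc: "?m s = ((a + b) / 2 - s) * ?c" if s: "s \<in> {a<..<b}" for s
      using Hm1_cong_AE[OF \<Omega> R G(1)[OF s] G(1)[OF mid] AE[OF Ts(1)[OF s] Ts(1)[OF mid]]] by simp
    have "(\<lambda>s. ((a + b) / 2 - s) * ?c) absolutely_integrable_on {a..b}"
      by (intro absolutely_integrable_continuous_real continuous_intros)
    then have m: "?m absolutely_integrable_on {a..b}"
      unfolding absolutely_integrable_closed_interval_iff
      by (rule set_integrable_cong[THEN iffD1, OF refl refl, rotated]) (simp add: eqc)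
    have "((\<lambda>s. ((a + b) / 2 - s) * ?c) has_integral
        (b * (a + b) / 2 - b\<^sup>2 / 2) * ?c - (a * (a + b) / 2 - a\<^sup>2 / 2) * ?c) {a..b}"
    proof (rule fundamental_theorem_of_calculus)
      show "((\<lambda>s. (s * (a + b) / 2 - s\<^sup>2 / 2) * ?c) has_vector_derivative ((a + b) / 2 - s) * ?c) (at s within {a..b})" for s
        unfolding has_real_derivative_iff_has_vector_derivative[symmetric]
        by (auto intro!: derivative_eq_intros)
    qed (use ab in simp)
    moreover have "(b * (a + b) / 2 - b\<^sup>2 / 2) * ?c - (a * (a + b) / 2 - a\<^sup>2 / 2) * ?c = 0"
      by (simp add: power2_eq_square field_simps)
    ultimately have "((\<lambda>s. ((a + b) / 2 - s) * ?c) has_integral 0) {a..b}" by (simp only:)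
    then have "integral {a..b} (\<lambda>s. ((a + b) / 2 - s) * ?c) = 0" by (rule integral_unique)
    moreover have "integral {a..b} ?m = integral {a..b} (\<lambda>s. ((a + b) / 2 - s) * ?c)"
      unfolding integral_closed_interval_eq_open by (rule integral_cong) (rule eqc)
    ultimately have "integral {a..b} ?m = 0" by (simp only:)
    then show ?thesis using split[OF m] const by simp
  next
    case repr
    have rep: "?m absolutely_integrable_on {a..b} \<and> ennreal \<bar>integral {a..b} ?m\<bar> \<le> ennreal (?e * (?\<Psi> / 2)) * y"
      if y: "y \<in> ?S" for y
    proof -
      obtain h where h: "y = Linf_norm \<Omega> h" "h \<in> borel_measurable (lebesgue_on \<Omega>)" "Linf_norm \<Omega> h < \<infinity>"
        "\<And>\<phi>. \<phi> \<in> H01 \<Omega> \<inter> L1_space \<Omega> \<Longrightarrow> R \<phi> = pairing \<Omega> h \<phi>" using y by blast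
      obtain N where N: "0 \<le> N" "Linf_norm \<Omega> h = ennreal N" using h(3) by (cases "Linf_norm \<Omega> h") auto
      let ?k = "\<lambda>s. ((a + b) / 2 - s) * pairing \<Omega> h (dG 0 x (T - s))"
      note res = residual_integral_le[where t = t and j = j, folded a_def b_def, OF green bounds x ab h(2) N]
      have eqk: "?k s = ?m s" if "s \<in> {a<..<b}" for s using h(4) G[OF that] by simp
      have m: "?m absolutely_integrable_on {a..b}"
        using res(1) unfolding absolutely_integrable_closed_interval_iff
        by (rule set_integrable_cong[THEN iffD1, OF refl refl, rotated]) (rule eqk)
      have "integral {a..b} ?m = integral {a..b} ?k"
        unfolding integral_closed_interval_eq_open by (rule integral_cong) (rule eqk[symmetric])
      then have "\<bar>integral {a..b} ?m\<bar> \<le> ?e * (?\<Psi> / 2) * N" using res(2) by simp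
      then have "ennreal \<bar>integral {a..b} ?m\<bar> \<le> ennreal (?e * (?\<Psi> / 2) * N)" by (rule ennreal_leI)
      also have "\<dots> = ennreal (?e * (?\<Psi> / 2)) * y"
        unfolding h(1) N(2) using \<Psi> N(1) by (intro ennreal_mult) auto
      finally show ?thesis using m by blast
    qed
    then have m: "?m absolutely_integrable_on {a..b}" using repr by blast
    have "ennreal \<bar>integral {a..b} ?m\<bar> \<le> ennreal (?e * (?\<Psi> / 2)) * Inf ?S"
      using repr(1) \<Psi> rep by (intro le_cmult_Inf_ennreal) (auto simp: ennreal_eq_0_iff not_le)
    also have "\<dots> = ennreal ?e * (ennreal (?\<Psi> / 2) * Hm1_Linf_norm \<Omega> R)"
      unfolding Hm1_Linf_norm_def mult.assoc[symmetric] using \<Psi>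
      by (intro arg_cong2[where f = "(*)"] ennreal_mult refl) auto
    finally show ?thesis
      using order_trans[OF split[OF m] add_left_mono] by (simp add: distrib_left)
  next
    case infinite
    then have "Hm1_Linf_norm \<Omega> R = top" unfolding Hm1_Linf_norm_def by (simp only: Inf_empty)
    then show ?thesis using infinite(1) \<Psi> by (simp add: ennreal_mult_top ennreal_eq_0_iff)
  qed
qed

section \<open>The reconstruction in time\<close>

lemma mesh_less: "mesh t M T \<Longrightarrow> j \<in> {1..M} \<Longrightarrow> t (j - 1) < t j"
  unfolding mesh_def by (cases j) auto

lemma mesh_mono:
  assumes "mesh t M T" "i \<le> j" "j \<le> M"
  shows "t i \<le> t j"
  using assms(2,3)
proof (induction j rule: dec_induct)
  case (step n)
  then show ?case using assms(1) unfolding mesh_def by (metis Suc_le_lessD less_imp_le order_trans)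
qed simp

lemma mesh_bounds:
  assumes "mesh t M T" "j \<le> M"
  shows "0 \<le> t j" "t j \<le> T"
  using mesh_mono[OF assms(1), of 0 j] mesh_mono[OF assms(1), of j M] assms by (auto simp: mesh_def)

lemma integral_over_mesh:
  fixes k :: "real \<Rightarrow> real"
  assumes mesh: "mesh t M T" and k: "k integrable_on {0..T}"
  shows "integral {0..T} k = (\<Sum>j=1..M. integral {t (j - 1)..t j} k)"
proof -
  have "integral {0..t n} k = (\<Sum>j=1..n. integral {t (j - 1)..t j} k)" if "n \<le> M" for n
    using that
  proof (induction n)
    case 0
    then show ?case using mesh by (simp add: mesh_def)
  next
    case (Suc n)
    have "k integrable_on {0..t (Suc n)}"
      by (rule integrable_on_subinterval[OF k]) (use mesh_bounds[OF mesh Suc.prems] in auto)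
    then have "integral {0..t n} k + integral {t n..t (Suc n)} k = integral {0..t (Suc n)} k"
      using mesh_bounds[OF mesh, of n] mesh_mono[OF mesh, of n "Suc n"] Suc.prems
      by (intro Henstock_Kurzweil_Integration.integral_combine) auto
    then show ?case using Suc by simp
  qed
  from this[of M] show ?thesis using mesh by (simp add: mesh_def)
qed

text \<open>The time spent in \<open>[t\<^sub>j\<^sub>-\<^sub>1, t\<^sub>j]\<close> up to time \<open>s\<close>.  Written with it, the reconstruction is one
  formula on all of \<open>[0,T]\<close>, and its continuity and its derivative off the mesh points need no gluing.\<close>

definition elapsed :: "(nat \<Rightarrow> real) \<Rightarrow> nat \<Rightarrow> real \<Rightarrow> real" where
  "elapsed t j s = max 0 (min (tau t j) (s - t (j - 1)))"

text \<open>Common form of the reconstruction and of its derivative: both are combinations of \<open>U\<^sup>0\<close>, of the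
  difference quotients \<open>\<delta>\<^sub>tU\<^sup>j\<close> and of the \<open>q\<^sup>j\<close>, with coefficients that depend on time.\<close>

definition step_combination :: "(nat \<Rightarrow> real) \<Rightarrow> nat \<Rightarrow> (nat \<Rightarrow> real^'n \<Rightarrow> real) \<Rightarrow> (nat \<Rightarrow> real^'n \<Rightarrow> real) \<Rightarrow>
    real \<Rightarrow> (nat \<Rightarrow> real) \<Rightarrow> (nat \<Rightarrow> real) \<Rightarrow> real^'n \<Rightarrow> real" where
  "step_combination t M U q c a b x = c * U 0 x +
     (\<Sum>j=1..M. a j * ((U j x - U (j - 1) x) / tau t j)) + (\<Sum>j=1..M. b j * q j x)"

text \<open>The piecewise linear interpolant of the \<open>U\<^sup>j\<close>, corrected by the bubble times \<open>q\<^sup>j\<close> on each interval.\<close>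

definition reconstruction :: "(nat \<Rightarrow> real) \<Rightarrow> nat \<Rightarrow> (nat \<Rightarrow> real^'n \<Rightarrow> real) \<Rightarrow> (nat \<Rightarrow> real^'n \<Rightarrow> real) \<Rightarrow>
    real \<Rightarrow> real^'n \<Rightarrow> real" where
  "reconstruction t M U q s = step_combination t M U q 1
     (\<lambda>j. elapsed t j s) (\<lambda>j. (tau t j - elapsed t j s) * elapsed t j s / 2)"

definition reconstruction_derivative :: "(nat \<Rightarrow> real) \<Rightarrow> nat \<Rightarrow> (nat \<Rightarrow> real^'n \<Rightarrow> real) \<Rightarrow>
    (nat \<Rightarrow> real^'n \<Rightarrow> real) \<Rightarrow> real \<Rightarrow> real^'n \<Rightarrow> real" where
  "reconstruction_derivative t M U q s = step_combination t M U q 0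
     (\<lambda>j. indicator {t (j - 1)<..<t j} s)
     (\<lambda>j. indicator {t (j - 1)<..<t j} s * ((t (j - 1) + t j) / 2 - s))"

lemma step_combination_single:
  assumes j: "j \<in> {1..M}" and a: "\<And>i. i \<in> {1..M} \<Longrightarrow> i \<noteq> j \<Longrightarrow> a i = 0 \<and> b i = 0"
  shows "step_combination t M U q c a b x
    = c * U 0 x + a j * ((U j x - U (j - 1) x) / tau t j) + b j * q j x"
proof -
  have "(\<Sum>i=1..M. a i * ((U i x - U (i - 1) x) / tau t i)) = (\<Sum>i\<in>{j}. a i * ((U i x - U (i - 1) x) / tau t i))"
    by (rule sum.mono_neutral_right) (use j a in auto)
  moreover have "(\<Sum>i=1..M. b i * q i x) = (\<Sum>i\<in>{j}. b i * q i x)"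
    by (rule sum.mono_neutral_right) (use j a in auto)
  ultimately show ?thesis by (simp add: step_combination_def)
qed

lemma elapsed_on_interval:
  assumes mesh: "mesh t M T" and j: "j \<in> {1..M}" and i: "i \<in> {1..M}" and s: "s \<in> {t (j - 1)..t j}"
  shows "elapsed t i s = (if i < j then tau t i else if i = j then s - t (j - 1) else 0)"
proof -
  have "i < j \<Longrightarrow> t i \<le> t (j - 1)" "i > j \<Longrightarrow> t j \<le> t (i - 1)"
    using i j by (auto intro!: mesh_mono[OF mesh])
  then show ?thesis
    using mesh_less[OF mesh i] s by (auto simp: elapsed_def tau_def)
qed

lemma reconstruction_on_interval:
  assumes mesh: "mesh t M T" and j: "j \<in> {1..M}" and s: "s \<in> {t (j - 1)..t j}"
  shows "reconstruction t M U q s x = U (j - 1) x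
    + (s - t (j - 1)) * ((U j x - U (j - 1) x) / tau t j) + (t j - s) * (s - t (j - 1)) / 2 * q j x"
proof -
  note e = elapsed_on_interval[OF mesh j _ s]
  have tele: "(\<Sum>i\<in>{1..<n}. U i x - U (i - 1) x) = U (n - 1) x - U 0 x" if "1 \<le> n" for n
    using that by (induction n rule: dec_induct) (auto simp: sum.atLeastLessThan_Suc)
  let ?d = "\<lambda>i. elapsed t i s * ((U i x - U (i - 1) x) / tau t i)"
  have split: "(\<Sum>i=1..M. ?d i) = (\<Sum>i\<in>{1..<j}. ?d i) + (\<Sum>i=j..M. ?d i)"
  proof -
    have "{1..M} = {1..<j} \<union> {j..M}" using j by auto
    then show ?thesis by (simp add: sum.union_disjoint ivl_disj_int)
  qed
  have before: "(\<Sum>i\<in>{1..<j}. ?d i) = (\<Sum>i\<in>{1..<j}. U i x - U (i - 1) x)"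
  proof (rule sum.cong[OF refl])
    fix i assume i: "i \<in> {1..<j}"
    then have i': "i \<in> {1..M}" using j by auto
    then have "tau t i \<noteq> 0" using mesh_less[OF mesh i'] by (simp add: tau_def)
    then show "?d i = U i x - U (i - 1) x" using e[OF i'] i by simp
  qed
  have "(\<Sum>i=j..M. ?d i) = (\<Sum>i\<in>{j}. ?d i)"
    by (rule sum.mono_neutral_right) (use j in \<open>auto simp: e\<close>)
  then have steps: "(\<Sum>i=1..M. ?d i) = U (j - 1) x - U 0 x + (s - t (j - 1)) * ((U j x - U (j - 1) x) / tau t j)"
    unfolding split before using tele[of j] j e[OF j] by simp
  have "(\<Sum>i=1..M. (tau t i - elapsed t i s) * elapsed t i s / 2 * q i x)
      = (\<Sum>i\<in>{j}. (tau t i - elapsed t i s) * elapsed t i s / 2 * q i x)"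
    by (rule sum.mono_neutral_right) (use j in \<open>auto simp: e\<close>)
  also have "\<dots> = (t j - s) * (s - t (j - 1)) / 2 * q j x"
    using e[OF j] by (simp add: tau_def)
  finally show ?thesis
    unfolding reconstruction_def step_combination_def steps by simp
qed

lemma reconstruction_at_end:
  assumes mesh: "mesh t M T" and T: "T > 0"
  shows "reconstruction t M U q T x = U M x"
proof -
  have M: "M \<in> {1..M}" "t M = T" using mesh T by (cases M; auto simp: mesh_def)+
  have "t (M - 1) < t M" by (rule mesh_less[OF mesh M(1)])
  then show ?thesis
    using reconstruction_on_interval[OF mesh M(1), of T U q x] M(2) by (simp add: tau_def)
qed

lemma reconstruction_at_0:
  assumes mesh: "mesh t M T"
  shows "reconstruction t M U q 0 x = U 0 x"
proof -
  have "elapsed t j 0 = 0" if "j \<in> {1..M}" for j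
  proof -
    have "0 \<le> t (j - 1)" by (rule mesh_bounds(1)[OF mesh]) (use that in auto)
    then have "min (tau t j) (0 - t (j - 1)) \<le> 0" by (simp add: min.coboundedI2)
    then show ?thesis by (simp add: elapsed_def)
  qed
  then show ?thesis by (simp add: reconstruction_def step_combination_def)
qed

lemma reconstruction_piecewise_poly:
  assumes mesh: "mesh t M T"
  shows "reconstruction t M U q \<in> discrete_piecewise_poly t M U q"
proof -
  \<comment> \<open>The coefficient of \<open>U\<^sup>j\<close> in the linear interpolant.\<close>
  define l where "l j = [:- t (j - 1) / tau t j, 1 / tau t j:]" for j
  define a where "a j i = (if i = j then l j else if i = j - 1 then 1 - l j else 0)" for j i :: nat
  define b where "b j i = (if i = j then smult (1 / 2) ([:t j, - 1:] * [:- t (j - 1), 1:]) else 0)" for j i :: nat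
  have "reconstruction t M U q s x = (\<Sum>i\<le>M. poly (a j i) s * U i x) + (\<Sum>i=1..M. poly (b j i) s * q i x)"
    if j: "j \<in> {1..M}" and s: "s \<in> {t (j - 1)..t j}" for j s x
  proof -
    have "(\<Sum>i\<le>M. poly (a j i) s * U i x) = (\<Sum>i\<in>{j - 1, j}. poly (a j i) s * U i x)"
      by (rule sum.mono_neutral_right) (use j in \<open>auto simp: a_def\<close>)
    also have "\<dots> = poly (1 - l j) s * U (j - 1) x + poly (l j) s * U j x"
      using j by (auto simp: a_def)
    also have "\<dots> = U (j - 1) x + (s - t (j - 1)) * ((U j x - U (j - 1) x) / tau t j)"
      by (simp add: l_def diff_divide_distrib algebra_simps)
    finally have 1: "(\<Sum>i\<le>M. poly (a j i) s * U i x) = \<dots>" .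
    have "(\<Sum>i=1..M. poly (b j i) s * q i x) = (\<Sum>i\<in>{j}. poly (b j i) s * q i x)"
      by (rule sum.mono_neutral_right) (use j in \<open>auto simp: b_def\<close>)
    also have "\<dots> = (t j - s) * (s - t (j - 1)) / 2 * q j x"
      by (simp add: b_def field_simps)
    finally show ?thesis unfolding reconstruction_on_interval[OF mesh j s] 1 by simp
  qed
  then show ?thesis unfolding discrete_piecewise_poly_def by blast
qed

lemma step_combination_H01:
  assumes \<Omega>: "open \<Omega>" and U: "\<And>j. j \<le> M \<Longrightarrow> U j \<in> H01 \<Omega>" and q: "\<And>j. j \<in> {1..M} \<Longrightarrow> q j \<in> H01 \<Omega>"
  shows "step_combination t M U q c a b \<in> H01 \<Omega>"
    and "\<phi> \<in> H01 \<Omega> \<Longrightarrow> pairing \<Omega> (step_combination t M U q c a b) \<phi> = c * pairing \<Omega> (U 0) \<phi> +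
      (\<Sum>j=1..M. a j * pairing \<Omega> (\<lambda>x. (U j x - U (j - 1) x) / tau t j) \<phi>) + (\<Sum>j=1..M. b j * pairing \<Omega> (q j) \<phi>)"
proof -
  let ?D = "\<lambda>j x. (U j x - U (j - 1) x) / tau t j"
  have D: "?D j \<in> H01 \<Omega>" if "j \<in> {1..M}" for j
  proof -
    have "j \<le> M" "j - 1 \<le> M" using that by auto
    from H01_lincomb[OF \<Omega> U[OF this(1)] U[OF this(2)], of "1 / tau t j" "- 1 / tau t j"]
    show ?thesis by (simp add: diff_divide_distrib)
  qed
  have U0: "(\<lambda>x. c * U 0 x + 0 * U 0 x) \<in> H01 \<Omega>" by (intro H01_lincomb \<Omega> U) auto
  have U0D: "(\<lambda>x. (c * U 0 x + 0 * U 0 x) + (\<Sum>j=1..M. a j * ?D j x)) \<in> H01 \<Omega>"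
    by (rule H01_sum[OF \<Omega> U0 _ D]) auto
  have "(\<lambda>x. ((c * U 0 x + 0 * U 0 x) + (\<Sum>j=1..M. a j * ?D j x)) + (\<Sum>j=1..M. b j * q j x)) \<in> H01 \<Omega>"
    by (rule H01_sum[OF \<Omega> U0D _ q]) auto
  then show "step_combination t M U q c a b \<in> H01 \<Omega>"
    by (simp add: step_combination_def[abs_def])
  assume \<phi>: "\<phi> \<in> H01 \<Omega>"
  have sum: "pairing \<Omega> (\<lambda>x. v x + (\<Sum>i\<in>I. k i * e i x)) \<phi> = pairing \<Omega> v \<phi> + (\<Sum>i\<in>I. k i * pairing \<Omega> (e i) \<phi>)"
    if v: "v \<in> H01 \<Omega>" and I: "finite I" "\<And>i. i \<in> I \<Longrightarrow> e i \<in> H01 \<Omega>" for v e k and I :: "nat set"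
    using I
  proof (induction I rule: finite_induct)
    case (insert i I)
    have h: "(\<lambda>x. v x + (\<Sum>i\<in>I. k i * e i x)) \<in> H01 \<Omega>" "e i \<in> H01 \<Omega>"
      using insert by (auto intro!: H01_sum[OF \<Omega> v])
    have "pairing \<Omega> (\<lambda>x. 1 * (v x + (\<Sum>i\<in>I. k i * e i x)) + k i * e i x) \<phi>
        = 1 * pairing \<Omega> (\<lambda>x. v x + (\<Sum>i\<in>I. k i * e i x)) \<phi> + k i * pairing \<Omega> (e i) \<phi>"
      by (rule pairing_lincomb(2)[OF H01_L2(1)[OF \<phi>] H01_L2(1)[OF h(1)] H01_L2(1)[OF h(2)]])
    then show ?case using insert by (simp add: algebra_simps)
  qed simp
  have "pairing \<Omega> (\<lambda>x. c * U 0 x + 0 * U 0 x) \<phi> = c * pairing \<Omega> (U 0) \<phi>"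
    using pairing_lincomb(2)[OF H01_L2(1)[OF \<phi>] H01_L2(1)[OF U] H01_L2(1)[OF U], of 0 0 c 0] by simp
  then show "pairing \<Omega> (step_combination t M U q c a b) \<phi> = c * pairing \<Omega> (U 0) \<phi> +
      (\<Sum>j=1..M. a j * pairing \<Omega> (?D j) \<phi>) + (\<Sum>j=1..M. b j * pairing \<Omega> (q j) \<phi>)"
    using sum[OF U0D _ q, of "{1..M}" "\<lambda>i. i" b] sum[OF U0 _ D, of "{1..M}" "\<lambda>i. i" a]
    by (simp add: step_combination_def[abs_def])
qed

lemma elapsed_derivative:
  assumes "t (j - 1) < t j" "s \<noteq> t (j - 1)" "s \<noteq> t j"
  shows "(elapsed t j has_real_derivative indicator {t (j - 1)<..<t j} s) (at s)"
proof -
  consider "s < t (j - 1)" | "t (j - 1) < s" "s < t j" | "t j < s" using assms by linarith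
  then show ?thesis
  proof cases
    case 1
    have "((\<lambda>_. 0) has_real_derivative 0) (at s)" by simp
    then have "(elapsed t j has_real_derivative 0) (at s)"
      by (rule has_field_derivative_transform_within_open[of _ _ _ "{..<t (j - 1)}"]) (use 1 assms in \<open>auto simp: elapsed_def tau_def\<close>)
    then show ?thesis using 1 by simp
  next
    case 2
    have "((\<lambda>s. s - t (j - 1)) has_real_derivative 1) (at s)" by (auto intro!: derivative_eq_intros)
    then have "(elapsed t j has_real_derivative 1) (at s)"
      by (rule has_field_derivative_transform_within_open[of _ _ _ "{t (j - 1)<..<t j}"]) (use 2 in \<open>auto simp: elapsed_def tau_def\<close>)
    then show ?thesis using 2 by simp
  next
    case 3
    have "((\<lambda>_. tau t j) has_real_derivative 0) (at s)" by simp
    then have "(elapsed t j has_real_derivative 0) (at s)"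
      by (rule has_field_derivative_transform_within_open[of _ _ _ "{t j<..}"]) (use 3 assms in \<open>auto simp: elapsed_def tau_def\<close>)
    then show ?thesis using 3 by simp
  qed
qed

text \<open>Paired with a fixed function, the reconstruction is a continuous function of time that is
  differentiable off the mesh points, so that the fundamental theorem of calculus applies.\<close>

lemma reconstruction_weak_derivative:
  assumes \<Omega>: "open \<Omega>" and mesh: "mesh t M T"
    and U: "\<And>j. j \<le> M \<Longrightarrow> U j \<in> H01 \<Omega>" and q: "\<And>j. j \<in> {1..M} \<Longrightarrow> q j \<in> H01 \<Omega>" and \<phi>: "\<phi> \<in> H01 \<Omega>"
    and r: "0 \<le> r"
  shows "(\<lambda>s. pairing \<Omega> (reconstruction_derivative t M U q s) \<phi>) absolutely_integrable_on {0..r}"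
    and "pairing \<Omega> (reconstruction t M U q r) \<phi> - pairing \<Omega> (reconstruction t M U q 0) \<phi>
      = integral {0..r} (\<lambda>s. pairing \<Omega> (reconstruction_derivative t M U q s) \<phi>)"
proof -
  define \<alpha> where "\<alpha> j = pairing \<Omega> (\<lambda>x. (U j x - U (j - 1) x) / tau t j) \<phi>" for j
  define \<rho> where "\<rho> j = pairing \<Omega> (q j) \<phi>" for j
  let ?m = "\<lambda>s. pairing \<Omega> (reconstruction t M U q s) \<phi>"
  let ?d = "\<lambda>s. pairing \<Omega> (reconstruction_derivative t M U q s) \<phi>"
  let ?i = "\<lambda>j s. indicator {t (j - 1)<..<t j} s :: real"
  have comb: "pairing \<Omega> (step_combination t M U q c a b) \<phi>
      = c * pairing \<Omega> (U 0) \<phi> + (\<Sum>j=1..M. a j * \<alpha> j) + (\<Sum>j=1..M. b j * \<rho> j)" for c a b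
    unfolding \<alpha>_def \<rho>_def by (rule step_combination_H01(2)[OF \<Omega> U q \<phi>])
  have m: "?m = (\<lambda>s. pairing \<Omega> (U 0) \<phi> + (\<Sum>j=1..M. elapsed t j s * \<alpha> j)
      + (\<Sum>j=1..M. (tau t j - elapsed t j s) * elapsed t j s / 2 * \<rho> j))"
    unfolding reconstruction_def comb by simp
  have d: "?d s = (\<Sum>j=1..M. ?i j s * \<alpha> j) + (\<Sum>j=1..M. ?i j s * ((t (j - 1) + t j) / 2 - s) * \<rho> j)" for s
    unfolding reconstruction_derivative_def comb by simp
  have c: "continuous_on {0..r} ?m" unfolding m elapsed_def by (intro continuous_intros) auto
  have "(?m has_real_derivative ?d s) (at s)" if s: "s \<notin> t ` {..M}" for s
  proof -
    have e: "(elapsed t j has_real_derivative ?i j s) (at s)" if j: "j \<in> {1..M}" for j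
      using s j by (intro elapsed_derivative mesh_less[OF mesh j]) auto
    have b: "((\<lambda>s. (tau t j - elapsed t j s) * elapsed t j s / 2 * \<rho> j) has_real_derivative
        ?i j s * ((t (j - 1) + t j) / 2 - s) * \<rho> j) (at s)" if j: "j \<in> {1..M}" for j
    proof -
      have "((\<lambda>s. (tau t j - elapsed t j s) * elapsed t j s / 2 * \<rho> j) has_real_derivative
        ((0 - ?i j s) * elapsed t j s + ?i j s * (tau t j - elapsed t j s)) / 2 * \<rho> j) (at s)"
        by (intro DERIV_mult DERIV_diff DERIV_cdivide DERIV_const DERIV_cmult_right e[OF j])
      moreover have "((0 - ?i j s) * elapsed t j s + ?i j s * (tau t j - elapsed t j s)) / 2
          = ?i j s * ((t (j - 1) + t j) / 2 - s)"
        by (auto simp: indicator_def elapsed_def tau_def field_simps)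
      ultimately show ?thesis by (simp only:)
    qed
    have "((\<lambda>s. pairing \<Omega> (U 0) \<phi> + (\<Sum>j=1..M. elapsed t j s * \<alpha> j)
      + (\<Sum>j=1..M. (tau t j - elapsed t j s) * elapsed t j s / 2 * \<rho> j)) has_real_derivative
      (0 + (\<Sum>j=1..M. ?i j s * \<alpha> j)) + (\<Sum>j=1..M. ?i j s * ((t (j - 1) + t j) / 2 - s) * \<rho> j)) (at s)"
      by (intro DERIV_add DERIV_const DERIV_sum DERIV_cmult_right e b)
    then show ?thesis unfolding m d add_0 .
  qed
  then have "(?d has_integral ?m r - ?m 0) {0..r}"
    by (intro fundamental_theorem_of_calculus_interior_strong[of "t ` {..M}"] c r)
       (auto simp: has_real_derivative_iff_has_vector_derivative)
  then have i: "?d integrable_on {0..r}" and eq: "integral {0..r} ?d = ?m r - ?m 0"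
    by (auto intro: has_integral_integrable simp: integral_unique)
  show "?m r - ?m 0 = integral {0..r} ?d" using eq by simp
  have "norm (?d s) \<le> (\<Sum>j=1..M. \<bar>\<alpha> j\<bar>) + (\<Sum>j=1..M. tau t j * \<bar>\<rho> j\<bar>)" for s
  proof -
    have "\<bar>?i j s * \<alpha> j\<bar> \<le> \<bar>\<alpha> j\<bar>" for j by (auto simp: indicator_def)
    moreover have "\<bar>?i j s * ((t (j - 1) + t j) / 2 - s) * \<rho> j\<bar> \<le> tau t j * \<bar>\<rho> j\<bar>" if j: "j \<in> {1..M}" for j
    proof -
      have "\<bar>?i j s * ((t (j - 1) + t j) / 2 - s)\<bar> \<le> tau t j"
        using mesh_less[OF mesh j] by (auto simp: indicator_def tau_def abs_if field_simps)
      from mult_right_mono[OF this, of "\<bar>\<rho> j\<bar>"] show ?thesis by (simp add: abs_mult)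
    qed
    ultimately show ?thesis unfolding d real_norm_def
      by (intro order_trans[OF abs_triangle_ineq] add_mono order_trans[OF sum_abs sum_mono])
  qed
  then show "?d absolutely_integrable_on {0..r}"
    by (intro absolutely_integrable_integrable_bound[OF _ i integrable_const_ivl])
qed

section \<open>The residual of the reconstruction\<close>

text \<open>The image of \<open>u - v\<close> under \<open>\<partial>\<^sub>t + \<L>\<close>, where \<open>v\<close> is the reconstruction.  At the mesh points, where \<open>v\<close>
  is not differentiable, the derivative of \<open>v\<close> is given the value zero.\<close>

definition error_source :: "(real^'n) set \<Rightarrow> 'n elliptic_operator \<Rightarrow> (nat \<Rightarrow> real) \<Rightarrow> nat \<Rightarrow>
    (real \<Rightarrow> real^'n \<Rightarrow> real) \<Rightarrow> (nat \<Rightarrow> real^'n \<Rightarrow> real) \<Rightarrow> (nat \<Rightarrow> real^'n \<Rightarrow> real) \<Rightarrow>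
    real \<Rightarrow> (real^'n \<Rightarrow> real) \<Rightarrow> real" where
  "error_source \<Omega> L t M f U q s \<phi> = pairing \<Omega> (f s) \<phi> - op_app \<Omega> L (reconstruction t M U q s) \<phi>
     - pairing \<Omega> (reconstruction_derivative t M U q s) \<phi>"

definition psi_residual :: "(real^'n) set \<Rightarrow> 'n elliptic_operator \<Rightarrow> (nat \<Rightarrow> real) \<Rightarrow>
    (real \<Rightarrow> real^'n \<Rightarrow> real) \<Rightarrow> (nat \<Rightarrow> real^'n \<Rightarrow> real) \<Rightarrow> (nat \<Rightarrow> real^'n \<Rightarrow> real) \<Rightarrow>
    nat \<Rightarrow> (real^'n \<Rightarrow> real) \<Rightarrow> real" where
  "psi_residual \<Omega> L t f U q j \<phi> =
     (psi \<Omega> L t f U j \<phi> - psi \<Omega> L t f U (j - 1) \<phi>) / tau t j - pairing \<Omega> (q j) \<phi>"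

lemma psi_residual_in_Hm1:
  assumes \<Omega>: "open \<Omega>" and L: "elliptic \<Omega> L"
    and U: "U j \<in> H01 \<Omega>" "U (j - 1) \<in> H01 \<Omega>" and q: "q j \<in> H01 \<Omega>"
    and f: "f (t j) \<in> L2_space \<Omega>" "f (t (j - 1)) \<in> L2_space \<Omega>"
  shows "psi_residual \<Omega> L t f U q j \<in> Hm1 \<Omega>"
proof -
  have psi: "(\<lambda>\<phi>. 1 * op_app \<Omega> L v \<phi> + (-1) * pairing \<Omega> g \<phi>) \<in> Hm1 \<Omega>"
    if "v \<in> H01 \<Omega>" "g \<in> L2_space \<Omega>" for v g
    by (rule Hm1_lincomb[OF op_app_in_Hm1[OF \<Omega> L that(1)] pairing_in_Hm1[OF that(2)]])
  have "(\<lambda>\<phi>. 1 * (1 / tau t j * (1 * op_app \<Omega> L (U j) \<phi> + (-1) * pairing \<Omega> (f (t j)) \<phi>)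
      + (- 1 / tau t j) * (1 * op_app \<Omega> L (U (j - 1)) \<phi> + (-1) * pairing \<Omega> (f (t (j - 1))) \<phi>))
      + (-1) * pairing \<Omega> (q j) \<phi>) \<in> Hm1 \<Omega>"
    by (intro Hm1_lincomb[OF Hm1_lincomb[OF psi psi] pairing_in_Hm1] U f H01_L2(1)[OF q])
  then show ?thesis
    by (simp add: psi_residual_def[abs_def] psi_def diff_divide_distrib add_divide_distrib algebra_simps)
qed

text \<open>The key identity.  With \<open>\<psi>\<^sup>j = \<L>U\<^sup>j - f\<^sup>j\<close> the scheme reads \<open>\<delta>\<^sub>tU\<^sup>j = - (\<psi>\<^sup>j + \<psi>\<^sup>j\<^sup>-\<^sup>1) / 2\<close>, the negative of the
  midpoint value of the linear interpolant of the \<open>\<psi>\<^sup>j\<close>.  So without correction the source would be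
  \<open>f\<close> minus its linear interpolant, plus \<open>(t\<^sub>j\<^sub>-\<^sub>1\<^sub>/\<^sub>2 - s) \<delta>\<^sub>t\<psi>\<^sup>j\<close>.  The correction changes \<open>\<delta>\<^sub>t\<psi>\<^sup>j\<close> into \<open>\<delta>\<^sub>t\<psi>\<^sup>j - q\<^sup>j\<close>
  through its time derivative, and adds \<open>\<beta>\<^sup>j = \<L>q\<^sup>j\<close> times the bubble to the interpolant of \<open>f\<close>, which
  becomes \<open>f_tilde\<close>.\<close>

lemma error_source_on_interval:
  assumes \<Omega>: "open \<Omega>" and L: "elliptic \<Omega> L" and mesh: "mesh t M T"
    and f: "\<forall>s\<in>{0..T}. f s \<in> L2_space \<Omega>"
    and U: "crank_nicolson \<Omega> L t M f u0 U"
    and q: "elliptic_solution \<Omega> L (beta t f j) (q j)"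
    and j: "j \<in> {1..M}" and s: "s \<in> {t (j - 1)<..<t j}" and \<phi>: "\<phi> \<in> H01 \<Omega>"
  shows "error_source \<Omega> L t M f U q s \<phi> = pairing \<Omega> (\<lambda>x. f s x - f_tilde t f j s x) \<phi>
    + ((t (j - 1) + t j) / 2 - s) * psi_residual \<Omega> L t f U q j \<phi>"
proof -
  let ?a = "t (j - 1)" and ?b = "t j"
  let ?\<tau> = "tau t j" and ?p = "(?b - s) * (s - ?a) / 2" and ?\<mu> = "(?a + ?b) / 2 - s"
  have ab: "?a < ?b" by (rule mesh_less[OF mesh j])
  have \<tau>: "?\<tau> = ?b - ?a" "?\<tau> \<noteq> 0" using ab by (auto simp: tau_def)
  have UH: "U j \<in> H01 \<Omega>" "U (j - 1) \<in> H01 \<Omega>" using U j by (auto simp: crank_nicolson_def)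
  have qH: "q j \<in> H01 \<Omega>" and qB: "op_app \<Omega> L (q j) \<phi> = pairing \<Omega> (beta t f j) \<phi>"
    using q \<phi> by (auto simp: elliptic_solution_def)
  have jM: "j \<le> M" "j - 1 \<le> M" using j by auto
  have times: "?a \<in> {0..T}" "?b \<in> {0..T}" "?b - ?\<tau> / 2 \<in> {0..T}" "s \<in> {0..T}"
    using mesh_bounds[OF mesh jM(1)] mesh_bounds[OF mesh jM(2)] ab s by (auto simp: \<tau> field_simps)
  then have fL: "f ?a \<in> L2_space \<Omega>" "f ?b \<in> L2_space \<Omega>" "f (?b - ?\<tau> / 2) \<in> L2_space \<Omega>" "f s \<in> L2_space \<Omega>"
    using f by auto
  note \<phi>L = H01_L2(1)[OF \<phi>]
  note lin = pairing_lincomb(2)[OF \<phi>L]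
  define A A' Fb Fa Fs B Q P where "A = op_app \<Omega> L (U j) \<phi>" and "A' = op_app \<Omega> L (U (j - 1)) \<phi>"
    and "Fb = pairing \<Omega> (f ?b) \<phi>" and "Fa = pairing \<Omega> (f ?a) \<phi>" and "Fs = pairing \<Omega> (f s) \<phi>"
    and "B = pairing \<Omega> (beta t f j) \<phi>" and "Q = pairing \<Omega> (q j) \<phi>"
    and "P = pairing \<Omega> (\<lambda>x. (U j x - U (j - 1) x) / ?\<tau>) \<phi>"
  have rec: "reconstruction t M U q s = (\<lambda>x. 1 * ((1 - (s - ?a) / ?\<tau>) * U (j - 1) x + (s - ?a) / ?\<tau> * U j x) + ?p * q j x)"
    by (rule ext, subst reconstruction_on_interval[OF mesh j])
       (use s in \<open>auto simp: algebra_simps diff_divide_distrib add_divide_distrib\<close>)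
  have Lv: "op_app \<Omega> L (reconstruction t M U q s) \<phi> = (1 - (s - ?a) / ?\<tau>) * A' + (s - ?a) / ?\<tau> * A + ?p * B"
    unfolding rec op_app_lincomb_left[OF \<Omega> L H01_lincomb[OF \<Omega> UH(2,1)] qH \<phi>]
      op_app_lincomb_left[OF \<Omega> L UH(2,1) \<phi>] qB A_def A'_def B_def by simp
  have D: "(\<lambda>x. (U j x - U (j - 1) x) / ?\<tau>) \<in> H01 \<Omega>"
    using H01_lincomb[OF \<Omega> UH, of "1 / ?\<tau>" "- 1 / ?\<tau>"] by (simp add: diff_divide_distrib)
  have "reconstruction_derivative t M U q s = (\<lambda>x. 1 * ((U j x - U (j - 1) x) / ?\<tau>) + ?\<mu> * q j x)"
  proof
    fix x
    have off: "s \<notin> {t (i - 1)<..<t i}" if i: "i \<in> {1..M}" "i \<noteq> j" for i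
    proof -
      have "i < j \<Longrightarrow> t i \<le> ?a" "i > j \<Longrightarrow> ?b \<le> t (i - 1)"
        using i j by (auto intro!: mesh_mono[OF mesh])
      then show ?thesis using s i by (cases i j rule: linorder_cases) auto
    qed
    show "reconstruction_derivative t M U q s x = 1 * ((U j x - U (j - 1) x) / ?\<tau>) + ?\<mu> * q j x"
      unfolding reconstruction_derivative_def
      by (subst step_combination_single[OF j]) (use off s in auto)
  qed
  then have dv: "pairing \<Omega> (reconstruction_derivative t M U q s) \<phi> = P + ?\<mu> * Q"
    using lin[OF H01_L2(1)[OF D] H01_L2(1)[OF qH], of 1 ?\<mu>] by (simp add: P_def Q_def)
  have "P + (A + A') / 2 = pairing \<Omega> (\<lambda>x. (f ?b x + f ?a x) / 2) \<phi>"
    using U j \<phi> unfolding crank_nicolson_def P_def A_def A'_def by blast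
  also have "\<dots> = (Fb + Fa) / 2"
    using lin[OF fL(2,1), of "1 / 2" "1 / 2"] by (simp add: Fa_def Fb_def add_divide_distrib)
  finally have CN: "P = (Fb + Fa) / 2 - (A + A') / 2" by (rule eq_diff_eq[THEN iffD2])
  have beta: "beta t f j = (\<lambda>x. 1 * ((- 4 / ?\<tau>\<^sup>2) * f ?b x + (- 4 / ?\<tau>\<^sup>2) * f ?a x) + (8 / ?\<tau>\<^sup>2) * f (?b - ?\<tau> / 2) x)"
  proof
    have "- 4 * ((X - 2 * Z + Y) / c) = 1 * (- 4 / c * X + - 4 / c * Y) + 8 / c * Z" for X Y Z c :: real
      by (simp add: divide_inverse algebra_simps)
    then show "beta t f j x = 1 * (- 4 / ?\<tau>\<^sup>2 * f ?b x + - 4 / ?\<tau>\<^sup>2 * f ?a x) + 8 / ?\<tau>\<^sup>2 * f (?b - ?\<tau> / 2) x" for x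
      unfolding beta_def .
  qed
  have betaL: "beta t f j \<in> L2_space \<Omega>"
    unfolding beta by (intro L2_space_lincomb_real fL)
  have ft: "(\<lambda>x. f s x - f_tilde t f j s x) = (\<lambda>x. 1 * (1 * f s x + (-1) *
      ((1 - (?b - s) / ?\<tau>) * f ?b x + (?b - s) / ?\<tau> * f ?a x)) + (- ?p) * beta t f j x)"
    by (rule ext) (simp add: f_tilde_def f_hat_def algebra_simps diff_divide_distrib add_divide_distrib)
  have hat: "(\<lambda>x. (1 - (?b - s) / ?\<tau>) * f ?b x + (?b - s) / ?\<tau> * f ?a x) \<in> L2_space \<Omega>"
    by (rule L2_space_lincomb_real[OF fL(2,1)])
  have tilde: "pairing \<Omega> (\<lambda>x. f s x - f_tilde t f j s x) \<phi>
      = Fs - ((1 - (?b - s) / ?\<tau>) * Fb + (?b - s) / ?\<tau> * Fa) - ?p * B"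
    unfolding ft lin[OF L2_space_lincomb_real[OF fL(4) hat] betaL] lin[OF fL(4) hat] lin[OF fL(2,1)]
      Fs_def Fa_def Fb_def B_def by simp
  have res: "psi_residual \<Omega> L t f U q j \<phi> = ((A - Fb) - (A' - Fa)) / ?\<tau> - Q"
    by (simp add: psi_residual_def psi_def A_def A'_def Fa_def Fb_def Q_def)
  \<comment> \<open>In terms of the relative position \<open>l\<close> of \<open>s\<close> in the interval, the identity is polynomial.\<close>
  define l where "l = (s - ?a) / ?\<tau>"
  have l: "(?b - s) / ?\<tau> = 1 - l" using \<tau> by (simp add: l_def field_simps)
  have l\<tau>: "l * ?\<tau> = s - ?a" using \<tau>(2) by (simp add: l_def)
  have "?\<mu> = (1 / 2 - l) * ?\<tau>"
    unfolding left_diff_distrib l\<tau> by (simp add: \<tau>(1) field_simps)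
  then have \<mu>: "?\<mu> * (X / ?\<tau>) = (1 / 2 - l) * X" for X using \<tau>(2) by simp
  show ?thesis
    unfolding error_source_def Lv dv tilde res CN Fs_def[symmetric] l l_def[symmetric] right_diff_distrib[of ?\<mu>] \<mu>
    by (simp add: algebra_simps add_divide_distrib diff_divide_distrib)
qed

text \<open>The representation formula for \<open>u - v\<close> can be used with \<open>error_source\<close> as right-hand side.\<close>

lemma parabolic_image_error:
  assumes \<Omega>: "open \<Omega>" and L: "elliptic \<Omega> L" and mesh: "mesh t M T"
    and f: "\<forall>s\<in>{0..T}. f s \<in> L2_space \<Omega>"
    and u: "parabolic_image \<Omega> L T u (\<lambda>s. pairing \<Omega> (f s))"
    and U: "\<And>j. j \<le> M \<Longrightarrow> U j \<in> H01 \<Omega>" and q: "\<And>j. j \<in> {1..M} \<Longrightarrow> q j \<in> H01 \<Omega>"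
  shows "parabolic_image \<Omega> L T (\<lambda>s x. u s x - reconstruction t M U q s x) (error_source \<Omega> L t M f U q)"
proof -
  let ?v = "reconstruction t M U q" and ?dv = "reconstruction_derivative t M U q"
  have v: "?v s \<in> H01 \<Omega>" "?dv s \<in> H01 \<Omega>" for s
    unfolding reconstruction_def reconstruction_derivative_def
    by (auto intro!: step_combination_H01(1)[OF \<Omega>] U q)
  have uH: "u s \<in> H01 \<Omega>" if "s \<in> {0..T}" for s using u that by (auto simp: parabolic_image_def)
  have w_eq: "(\<lambda>x. u s x - ?v s x) = (\<lambda>x. 1 * u s x + (-1) * ?v s x)" for s by simp
  have w: "(\<lambda>x. u s x - ?v s x) \<in> H01 \<Omega>" if "s \<in> {0..T}" for s
    unfolding w_eq by (rule H01_lincomb[OF \<Omega> uH[OF that] v(1)])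
  have "error_source \<Omega> L t M f U q s \<in> Hm1 \<Omega>" if s: "s \<in> {0..T}" for s
  proof -
    have "(\<lambda>\<phi>. 1 * (1 * pairing \<Omega> (f s) \<phi> + (-1) * op_app \<Omega> L (?v s) \<phi>) + (-1) * pairing \<Omega> (?dv s) \<phi>) \<in> Hm1 \<Omega>"
      using f s
      by (intro Hm1_lincomb[OF Hm1_lincomb[OF pairing_in_Hm1 op_app_in_Hm1[OF \<Omega> L v(1)]] pairing_in_Hm1[OF H01_L2(1)[OF v(2)]]]) auto
    then show ?thesis by (simp add: error_source_def[abs_def])
  qed
  moreover have "(\<lambda>s. error_source \<Omega> L t M f U q s \<phi> - op_app \<Omega> L (\<lambda>x. u s x - ?v s x) \<phi>) absolutely_integrable_on {0..r} \<and>
      pairing \<Omega> (\<lambda>x. u r x - ?v r x) \<phi> - pairing \<Omega> (\<lambda>x. u 0 x - ?v 0 x) \<phi> =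
        integral {0..r} (\<lambda>s. error_source \<Omega> L t M f U q s \<phi> - op_app \<Omega> L (\<lambda>x. u s x - ?v s x) \<phi>)"
    if \<phi>: "\<phi> \<in> H01 \<Omega>" and r: "r \<in> {0..T}" for \<phi> r
  proof -
    let ?k = "\<lambda>s. pairing \<Omega> (f s) \<phi> - op_app \<Omega> L (u s) \<phi>" and ?d = "\<lambda>s. pairing \<Omega> (?dv s) \<phi>"
    let ?l = "\<lambda>s. error_source \<Omega> L t M f U q s \<phi> - op_app \<Omega> L (\<lambda>x. u s x - ?v s x) \<phi>"
    have k: "?k absolutely_integrable_on {0..r}" "pairing \<Omega> (u r) \<phi> - pairing \<Omega> (u 0) \<phi> = integral {0..r} ?k"
      using u \<phi> r by (auto simp: parabolic_image_def)
    have r0: "0 \<le> r" using r by simp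
    have d: "?d absolutely_integrable_on {0..r}" "pairing \<Omega> (?v r) \<phi> - pairing \<Omega> (?v 0) \<phi> = integral {0..r} ?d"
      by (rule reconstruction_weak_derivative[OF \<Omega> mesh _ _ \<phi> r0]; rule U q; assumption)+
    have eq: "?k s - ?d s = ?l s" if s: "s \<in> {0..r}" for s
    proof -
      have "s \<in> {0..T}" using s r by auto
      from op_app_lincomb_left[OF \<Omega> L uH[OF this] v(1)[of s] \<phi>, of 1 "-1"]
      show ?thesis by (simp add: error_source_def)
    qed
    have kd: "(\<lambda>s. ?k s - ?d s) absolutely_integrable_on {0..r}"
      by (rule set_integral_diff(1)[OF k(1) d(1)])
    then have "?l absolutely_integrable_on {0..r}"
      by (rule set_integrable_cong[THEN iffD1, OF refl refl, rotated]) (rule eq)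
    moreover have "integral {0..r} ?l = integral {0..r} (\<lambda>s. ?k s - ?d s)"
      by (rule integral_cong) (rule eq[symmetric])
    moreover have "\<dots> = integral {0..r} ?k - integral {0..r} ?d"
      using k(1) d(1) by (intro Henstock_Kurzweil_Integration.integral_diff) (auto simp: absolutely_integrable_on_def)
    moreover have "pairing \<Omega> (\<lambda>x. u s x - ?v s x) \<phi> = pairing \<Omega> (u s) \<phi> - pairing \<Omega> (?v s) \<phi>" if "s \<in> {0..T}" for s
      using pairing_lincomb(2)[OF H01_L2(1)[OF \<phi>] H01_L2(1)[OF uH[OF that]] H01_L2(1)[OF v(1)[of s]], of 1 "-1"] by simp
    moreover have "0 \<in> {0..T}" using r by auto
    ultimately show ?thesis using k(2) d(2) r by simp
  qed
  ultimately show ?thesis unfolding parabolic_image_def using w by blast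
qed

theorem theorem8:
  fixes \<Omega> :: "(real^'n) set"
    and L :: "'n elliptic_operator"
    and dG :: "nat \<Rightarrow> real^'n \<Rightarrow> real \<Rightarrow> real^'n \<Rightarrow> real"
    and \<kappa> \<kappa>' :: "nat \<Rightarrow> real" and \<gamma> T :: real
    and t :: "nat \<Rightarrow> real" and M :: nat
    and f u :: "real \<Rightarrow> real^'n \<Rightarrow> real"
    and u0 :: "real^'n \<Rightarrow> real"
    and U q :: "nat \<Rightarrow> real^'n \<Rightarrow> real"
  assumes domain: "lipschitz_domain \<Omega>"
    and T: "T > 0"
    and L: "elliptic \<Omega> L"
    and f: "\<forall>s\<in>{0..T}. f s \<in> L2_space \<Omega>"
    and u: "parabolic_solution \<Omega> L T f u0 u"
    and green: "green_function \<Omega> L dG"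
    and representation: "\<forall>w\<in>W11_H01 \<Omega> T. green_representation \<Omega> L (dG 0) T w"
    and bounds: "green_bounds \<Omega> dG T \<kappa> \<kappa>' \<gamma>"
    and mesh: "mesh t M T"
    and U: "crank_nicolson \<Omega> L t M f u0 U"
    and solvable: "\<forall>j\<in>{1..M}. uniquely_solvable \<Omega> L (beta t f j)"
    and q: "\<forall>j\<in>{1..M}. elliptic_solution \<Omega> L (beta t f j) (q j)"
    and regularity: "\<forall>v\<in>discrete_piecewise_poly t M U q.
      green_representation \<Omega> L (dG 0) T (\<lambda>s x. u s x - v s x)"
  shows "Linf_norm \<Omega> (\<lambda>x. u T x - U M x) \<le>
    (\<Sum>j=1..M. ennreal (exp (- \<gamma> * (T - t j))) *
      (eta_f \<Omega> t f (\<kappa> 0) j + eta_psi \<Omega> L t T f U q (\<kappa> 0) (\<kappa> 1) (\<kappa>' 1) j))"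
proof -
  have \<Omega>: "open \<Omega>" using domain by (simp add: lipschitz_domain_def)
  have UH: "U j \<in> H01 \<Omega>" if "j \<le> M" for j using U that by (auto simp: crank_nicolson_def)
  have qH: "q j \<in> H01 \<Omega>" if "j \<in> {1..M}" for j using q that by (auto simp: elliptic_solution_def)
  have u_img: "parabolic_image \<Omega> L T u (\<lambda>s. pairing \<Omega> (f s))" and u_init: "AE x in lebesgue_on \<Omega>. u 0 x = u0 x"
    using u by (auto simp: parabolic_solution_def)
  let ?w = "\<lambda>s x. u s x - reconstruction t M U q s x" and ?F = "error_source \<Omega> L t M f U q"
  let ?\<eta> = "\<lambda>j. ennreal (exp (- \<gamma> * (T - t j))) *
      (eta_f \<Omega> t f (\<kappa> 0) j + eta_psi \<Omega> L t T f U q (\<kappa> 0) (\<kappa> 1) (\<kappa>' 1) j)"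
  \<comment> \<open>The representation formula is used at the final time only, where the reconstruction is \<open>U\<^sup>M\<close>.\<close>
  have "green_representation \<Omega> L (dG 0) T ?w"
    using regularity reconstruction_piecewise_poly[OF mesh] by blast
  then have repr: "AE x in lebesgue_on \<Omega>. (\<lambda>s. ?F s (dG 0 x (T - s))) absolutely_integrable_on {0..T} \<and>
      ?w T x = pairing \<Omega> (dG 0 x T) (?w 0) + integral {0..T} (\<lambda>s. ?F s (dG 0 x (T - s)))"
    unfolding green_representation_def
    using parabolic_image_error[OF \<Omega> L mesh f u_img UH qH] T by auto
  have "AE x in lebesgue_on \<Omega>. U 0 x = u0 x" using U by (auto simp: crank_nicolson_def)
  with u_init have w0: "AE x in lebesgue_on \<Omega>. ?w 0 x = 0"
    by eventually_elim (simp add: reconstruction_at_0[OF mesh])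
  have init: "pairing \<Omega> v (?w 0) = 0" for v
    unfolding pairing_def by (rule integral_eq_zero_AE) (use w0 in auto)
  have bound: "ennreal \<bar>u T x - U M x\<bar> \<le> (\<Sum>j=1..M. ?\<eta> j)"
    if x: "x \<in> \<Omega>" and int: "(\<lambda>s. ?F s (dG 0 x (T - s))) absolutely_integrable_on {0..T}"
      and wT: "?w T x = pairing \<Omega> (dG 0 x T) (?w 0) + integral {0..T} (\<lambda>s. ?F s (dG 0 x (T - s)))" for x
  proof -
    let ?k = "\<lambda>s. ?F s (dG 0 x (T - s))"
    have "u T x - U M x = integral {0..T} ?k"
      using wT by (simp add: init reconstruction_at_end[OF mesh T])
    also have "\<dots> = (\<Sum>j=1..M. integral {t (j - 1)..t j} ?k)"
      using int by (intro integral_over_mesh[OF mesh]) (simp add: absolutely_integrable_on_def)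
    finally have "\<bar>u T x - U M x\<bar> \<le> (\<Sum>j=1..M. \<bar>integral {t (j - 1)..t j} ?k\<bar>)" by simp
    then have "ennreal \<bar>u T x - U M x\<bar> \<le> (\<Sum>j=1..M. ennreal \<bar>integral {t (j - 1)..t j} ?k\<bar>)"
      by (subst sum_ennreal) (auto intro: ennreal_leI)
    also have "\<dots> \<le> (\<Sum>j=1..M. ?\<eta> j)"
    proof (rule sum_mono)
      fix j assume j: "j \<in> {1..M}"
      have b: "0 \<le> t (j - 1)" "t (j - 1) < t j" "t j \<le> T"
        using mesh_bounds[OF mesh, of j] mesh_bounds[OF mesh, of "j - 1"] mesh_less[OF mesh j] j by auto
      have R: "psi_residual \<Omega> L t f U q j \<in> Hm1 \<Omega>"
        using j b f by (intro psi_residual_in_Hm1 \<Omega> L UH qH) auto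
      have kj: "?k absolutely_integrable_on {t (j - 1)..t j}"
        by (rule set_integrable_subset[OF int]) (use b in auto)
      have eq: "?k s = pairing \<Omega> (\<lambda>x. f s x - f_tilde t f j s x) (dG 0 x (T - s))
          + ((t (j - 1) + t j) / 2 - s) * psi_residual \<Omega> L t f U q j (dG 0 x (T - s))"
        if s: "s \<in> {t (j - 1)<..<t j}" for s
        using q j s b by (intro error_source_on_interval[OF \<Omega> L mesh f U _ j s] green_functionD(3)[OF green x]) auto
      show "ennreal \<bar>integral {t (j - 1)..t j} ?k\<bar> \<le> ?\<eta> j"
        using interval_estimate[where t = t and j = j, OF \<Omega> green bounds x b R kj eq]
        unfolding eta_f_def eta_psi_def psi_residual_def[abs_def] .
    qed
    finally show ?thesis .
  qed
  have "u T \<in> L2_space \<Omega>" "U M \<in> L2_space \<Omega>"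
    using u_img T UH by (auto simp: parabolic_image_def intro: H01_L2(1))
  then have meas: "(\<lambda>x. ennreal \<bar>u T x - U M x\<bar>) \<in> borel_measurable (lebesgue_on \<Omega>)"
    by (auto simp: L2_space_def)
  show ?thesis
    unfolding Linf_norm_def
  proof (rule esssup_I[OF meas])
    have "AE x in lebesgue_on \<Omega>. x \<in> \<Omega>" by (rule AE_I2) simp
    with repr show "AE x in lebesgue_on \<Omega>. ennreal \<bar>u T x - U M x\<bar> \<le> (\<Sum>j=1..M. ?\<eta> j)"
      by eventually_elim (use bound in blast)
  qed
qed

end
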